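(* Let $S$ be an (additively written) abelian group and $\chi:S\to\mathbb{C}^{\times}$ an injective group homomorphism. Let $D_S$, $\tilde D^{\alpha}(x)$, $\mathfrak{g}_S$, $\widehat{\mathfrak{g}_S}$, the action of $S$ on $\widehat{\mathfrak{g}_S}$ and the $S$-covariant algebra $\widehat{\mathfrak{g}_S}/S$ be as defined in the context. Then the linear map $\pi:\widehat{\mathfrak{g}_S}\to D_S$ defined by $\pi(\mathbf{k})=\mathbf{c}$ and $$\pi(d^{\alpha,\beta}(x))=D^{\alpha,\beta}(x)=\chi(\beta)\tilde D^{\alpha}(\chi(\beta)x)\qquad\text{for }\alpha,\beta\in S$$ (applied coefficientwise) gives rise to a Lie algebra isomorphism from the covariant algebra $\widehat{\mathfrak{g}_S}/S$ to $D_S$.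
   Context: All vector spaces and Lie algebras are over $\mathbb{C}$. For $q\in\mathbb{C}^\times$, $[n]_q=\frac{q^n-q^{-n}}{q-q^{-1}}$ if $q\neq\pm1$, $[n]_1=n$, $[n]_{-1}=n(-1)^{n-1}$. $D_S$ is the Lie algebra with generators $\mathbf{c}$ and $D^{\alpha}(n)$ ($\alpha\in S$, $n\in\mathbb{Z}$), subject to: $\mathbf{c}$ is central, $D^{-\alpha}(n)=-D^{\alpha}(n)$, and $$[D^{\alpha}(n),D^{\beta}(m)]=(\chi(m\alpha-n\beta)-\chi(n\beta-m\alpha))D^{\alpha+\beta}(m+n)-(\chi(m\alpha+n\beta)-\chi(-m\alpha-n\beta))D^{\alpha-\beta}(m+n)+\left([m]_{\chi(\alpha+\beta)}-[m]_{\chi(\alpha-\beta)}\right)\delta_{m+n,0}\mathbf{c}$$ for $m,n\in\mathbb{Z}$, $\alpha,\beta\in S$. Set $D^{\alpha}(x)=\sum_{n\in\mathbb{Z}}D^{\alpha}(n)x^{-n-1}$, $\tilde D^{\alpha}(x)=D^{\alpha}(x)+(1-\delta_{2\alpha,0})\frac{1}{\chi(\alpha)-\chi(-\alpha)}\mathbf{c}x^{-1}$ (the second term is $0$ if $2\alpha=0$), and $D^{\alpha,\beta}(x)=\chi(\beta)\tilde D^{\alpha}(\chi(\beta)x)$. $\mathfrak{g}_S$ is the Lie algebra with generators $d^{\alpha,\beta}$ ($\alpha,\beta\in S$), subject to $d^{-\alpha,\beta}=-d^{\alpha,\beta}$ and $$[d^{\alpha,\beta},d^{\mu,\nu}]=\delta_{\alpha+\mu,\nu-\beta}d^{\alpha+\mu,-\alpha+\nu}-\delta_{\alpha+\mu,\beta-\nu}d^{\alpha+\mu,\alpha+\nu}-\delta_{\alpha-\mu,\nu-\beta}d^{\alpha-\mu,\nu-\alpha}+\delta_{\alpha-\mu,\beta-\nu}d^{\alpha-\mu,\alpha+\nu}$$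 for $\alpha,\beta,\mu,\nu\in S$. It is linearly spanned by the $d^{\alpha,\beta}$ and carries a symmetric invariant bilinear form determined by $$\langle d^{\alpha,\beta},d^{\mu,\nu}\rangle_{\chi}=\chi(\alpha+\mu)\delta_{2(\alpha+\mu),0}\delta_{\alpha+\mu,\beta-\nu}-\chi(\alpha-\mu)\delta_{2(\alpha-\mu),0}\delta_{\alpha-\mu,\beta-\nu}.$$ $\widehat{\mathfrak{g}_S}=\mathfrak{g}_S\otimes\mathbb{C}[t,t^{-1}]\oplus\mathbb{C}\mathbf{k}$ is the affine Lie algebra of $(\mathfrak{g}_S,\langle\cdot,\cdot\rangle_\chi)$: $\mathbf{k}$ is central and $[a\otimes t^m,b\otimes t^n]=[a,b]\otimes t^{m+n}+m\delta_{m+n,0}\langle a,b\rangle_\chi\mathbf{k}$. Write $a(n)=a\otimes t^n$ and $a(x)=\sum_{n\in\mathbb{Z}}a(n)x^{-n-1}$. $S$ acts on $\widehat{\mathfrak{g}_S}$ by automorphisms: $\gamma\cdot\mathbf{k}=\mathbf{k}$, $\gamma\cdot(d^{\alpha,\beta}(n))=\chi(\gamma)^n d^{\alpha,\beta+\gamma}(n)$. Covariant algebra: if a group $G$ acts by automorphisms on a Lie algebra $K$ so that for all $a,b\in K$, $[ga,b]=0$ for all but finitely many $g\in G$, set $[a,b]_G=\sum_{g\in G}[ga,b]$ and $I_G=\mathrm{span}\{a-ga\mid a\in K,g\in G\}$. Then $I_G$ is a two-sided ideal of the non-associative algebra $(K,[\cdot,\cdot]_G)$ and the quotient $K/G:=K/I_G$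 with the induced bracket is a Lie algebra, the $G$-covariant algebra of $K$.
   Formalization: The map is taken with π(k) = −c instead of π(k) = c: with the stated cocycle of D_S, the form on g_S and the correction term in D̃, the sign +c would force 2c = 0 (compare the brackets of the m-th and (−m)-th modes for 4α ≠ 0), so the printed sign is inconsistent. *)

theory Defs
  imports Complex_Main "HOL-Algebra.Module" "HOL-Algebra.QuotRing"
begin

section \<open>Lie algebras over the complex numbers\<close>

text \<open>
  A complex, not necessarily associative, algebra is a \<open>module\<close> record over the complex numbers:
  \<open>\<otimes>\<close> is its product (the bracket of a Lie algebra). The field \<open>one\<close> of the record plays no role.
\<close>

definition complex_ring :: "complex ring" where
  "complex_ring = \<lparr>carrier = UNIV, mult = (*), one = 1, zero = 0, add = (+)\<rparr>"

type_synonym 'v calg = "(complex, 'v) module"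

locale lie_algebra = module complex_ring L for L :: "'v calg" (structure) +
  assumes bracket_closed: "\<lbrakk>x \<in> carrier L; y \<in> carrier L\<rbrakk> \<Longrightarrow> x \<otimes> y \<in> carrier L"
    and bracket_add_left:
      "\<lbrakk>x \<in> carrier L; y \<in> carrier L; z \<in> carrier L\<rbrakk> \<Longrightarrow> (x \<oplus> y) \<otimes> z = x \<otimes> z \<oplus> y \<otimes> z"
    and bracket_add_right:
      "\<lbrakk>x \<in> carrier L; y \<in> carrier L; z \<in> carrier L\<rbrakk> \<Longrightarrow> x \<otimes> (y \<oplus> z) = x \<otimes> y \<oplus> x \<otimes> z"
    and bracket_smult_left:
      "\<lbrakk>x \<in> carrier L; y \<in> carrier L\<rbrakk> \<Longrightarrow> (r \<odot> x) \<otimes> y = r \<odot> (x \<otimes> y)"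
    and bracket_smult_right:
      "\<lbrakk>x \<in> carrier L; y \<in> carrier L\<rbrakk> \<Longrightarrow> x \<otimes> (r \<odot> y) = r \<odot> (x \<otimes> y)"
    and bracket_self: "x \<in> carrier L \<Longrightarrow> x \<otimes> x = \<zero>"
    and jacobi:
      "\<lbrakk>x \<in> carrier L; y \<in> carrier L; z \<in> carrier L\<rbrakk> \<Longrightarrow>
        x \<otimes> (y \<otimes> z) \<oplus> y \<otimes> (z \<otimes> x) \<oplus> z \<otimes> (x \<otimes> y) = \<zero>"

definition lin_maps :: "'v calg \<Rightarrow> 'w calg \<Rightarrow> ('v \<Rightarrow> 'w) set" where
  "lin_maps K L = {f \<in> carrier K \<rightarrow> carrier L.
     (\<forall>x\<in>carrier K. \<forall>y\<in>carrier K. f (x \<oplus>\<^bsub>K\<^esub> y) = f x \<oplus>\<^bsub>L\<^esub> f y) \<and>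
     (\<forall>r. \<forall>x\<in>carrier K. f (r \<odot>\<^bsub>K\<^esub> x) = r \<odot>\<^bsub>L\<^esub> f x)}"

definition lie_iso :: "'v calg \<Rightarrow> 'w calg \<Rightarrow> ('v \<Rightarrow> 'w) set" where
  "lie_iso K L = {f \<in> lin_maps K L. lie_algebra K \<and> lie_algebra L \<and>
     (\<forall>x\<in>carrier K. \<forall>y\<in>carrier K. f (x \<otimes>\<^bsub>K\<^esub> y) = f x \<otimes>\<^bsub>L\<^esub> f y) \<and>
     bij_betw f (carrier K) (carrier L)}"

definition lin_span :: "'v calg \<Rightarrow> 'v set \<Rightarrow> 'v set" where
  "lin_span K X = \<Inter>{H. submodule H complex_ring K \<and> X \<subseteq> H}"

definition gen_ideal :: "'v calg \<Rightarrow> 'v set \<Rightarrow> 'v set" where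
  "gen_ideal K X = \<Inter>{I. submodule I complex_ring K \<and>
     (\<forall>a\<in>carrier K. \<forall>x\<in>I. a \<otimes>\<^bsub>K\<^esub> x \<in> I \<and> x \<otimes>\<^bsub>K\<^esub> a \<in> I) \<and> X \<subseteq> I}"

definition quot_alg :: "'v calg \<Rightarrow> 'v set \<Rightarrow> 'v set calg" where
  "quot_alg K I = ring.extend (K Quot I) \<lparr>smult = (\<lambda>r A. \<Union>a\<in>A. I +>\<^bsub>K\<^esub> (r \<odot>\<^bsub>K\<^esub> a))\<rparr>"


section \<open>Generators and relations\<close>

datatype 'x magma = Gen 'x | Br "'x magma" "'x magma"

text \<open>
  The free nonassociative algebra on \<open>'x\<close> has the free magma as its basis; elements are coefficient
  functions of finite support.
\<close>

definition free_alg :: "('x magma \<Rightarrow> complex) calg" where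
  "free_alg = \<lparr>carrier = {f. finite {t. f t \<noteq> 0}},
     mult = (\<lambda>f g t. case t of Gen x \<Rightarrow> 0 | Br u v \<Rightarrow> f u * g v),
     one = (\<lambda>t. 0), zero = (\<lambda>t. 0), add = (\<lambda>f g t. f t + g t), smult = (\<lambda>r f t. r * f t)\<rparr>"

definition fgen :: "'x \<Rightarrow> 'x magma \<Rightarrow> complex" where
  "fgen x = (\<lambda>t. of_bool (t = Gen x))"

definition lie_identities :: "('x magma \<Rightarrow> complex) set" where
  "lie_identities =
     {a \<otimes>\<^bsub>free_alg\<^esub> a | a. a \<in> carrier free_alg} \<union>
     {a \<otimes>\<^bsub>free_alg\<^esub> (b \<otimes>\<^bsub>free_alg\<^esub> c) \<oplus>\<^bsub>free_alg\<^esub> b \<otimes>\<^bsub>free_alg\<^esub> (c \<otimes>\<^bsub>free_alg\<^esub> a)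
        \<oplus>\<^bsub>free_alg\<^esub> c \<otimes>\<^bsub>free_alg\<^esub> (a \<otimes>\<^bsub>free_alg\<^esub> b) | a b c.
        a \<in> carrier free_alg \<and> b \<in> carrier free_alg \<and> c \<in> carrier free_alg}"

text \<open>
  A pair \<open>(l, r)\<close> in \<open>R\<close> stands for the relation \<open>l = r\<close>. Dividing the free nonassociative algebra
  by the Lie identities alone gives the free Lie algebra.
\<close>

definition rel_ideal ::
    "(('x magma \<Rightarrow> complex) \<times> ('x magma \<Rightarrow> complex)) set \<Rightarrow> ('x magma \<Rightarrow> complex) set" where
  "rel_ideal R = gen_ideal free_alg (lie_identities \<union> {l \<ominus>\<^bsub>free_alg\<^esub> r | l r. (l, r) \<in> R})"

definition lie_present ::
    "(('x magma \<Rightarrow> complex) \<times> ('x magma \<Rightarrow> complex)) set \<Rightarrow> ('x magma \<Rightarrow> complex) set calg" where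
  "lie_present R = quot_alg free_alg (rel_ideal R)"

definition pgen ::
    "(('x magma \<Rightarrow> complex) \<times> ('x magma \<Rightarrow> complex)) set \<Rightarrow> 'x \<Rightarrow> ('x magma \<Rightarrow> complex) set" where
  "pgen R x = rel_ideal R +>\<^bsub>free_alg\<^esub> fgen x"


section \<open>The Lie algebra \<open>D\<^sub>S\<close>\<close>

text \<open>The group \<open>S\<close> is the type \<open>'s\<close>.\<close>

definition zmult :: "int \<Rightarrow> 's::ab_group_add \<Rightarrow> 's" (infixr \<open>\<cdot>\<close> 75) where
  "m \<cdot> \<alpha> = (if 0 \<le> m then (((+) \<alpha>) ^^ nat m) 0 else - (((+) \<alpha>) ^^ nat (- m)) 0)"

definition qint :: "complex \<Rightarrow> int \<Rightarrow> complex" where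
  "qint q n = (if q = 1 then of_int n
     else if q = -1 then of_int n * (-1) powi (n - 1)
     else (q powi n - q powi (- n)) / (q - q powi (- 1)))"

datatype 's Dgen = C | D 's int

definition DS_rels :: "('s::ab_group_add \<Rightarrow> complex) \<Rightarrow>
    (('s Dgen magma \<Rightarrow> complex) \<times> ('s Dgen magma \<Rightarrow> complex)) set" where
  "DS_rels \<chi> =
     {(fgen C \<otimes>\<^bsub>free_alg\<^esub> fgen x, \<zero>\<^bsub>free_alg\<^esub>) | x. True} \<union>
     {(fgen (D (- \<alpha>) n), \<ominus>\<^bsub>free_alg\<^esub> fgen (D \<alpha> n)) | \<alpha> n. True} \<union>
     {(fgen (D \<alpha> n) \<otimes>\<^bsub>free_alg\<^esub> fgen (D \<beta> m),
       (\<chi> (m \<cdot> \<alpha> - n \<cdot> \<beta>) - \<chi> (n \<cdot> \<beta> - m \<cdot> \<alpha>)) \<odot>\<^bsub>free_alg\<^esub> fgen (D (\<alpha> + \<beta>) (m + n))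
       \<ominus>\<^bsub>free_alg\<^esub> (\<chi> (m \<cdot> \<alpha> + n \<cdot> \<beta>) - \<chi> (- (m \<cdot> \<alpha>) - n \<cdot> \<beta>)) \<odot>\<^bsub>free_alg\<^esub> fgen (D (\<alpha> - \<beta>) (m + n))
       \<oplus>\<^bsub>free_alg\<^esub> ((qint (\<chi> (\<alpha> + \<beta>)) m - qint (\<chi> (\<alpha> - \<beta>)) m) * of_bool (m + n = 0))
          \<odot>\<^bsub>free_alg\<^esub> fgen C) | \<alpha> \<beta> m n. True}"

definition DS :: "('s::ab_group_add \<Rightarrow> complex) \<Rightarrow> ('s Dgen magma \<Rightarrow> complex) set calg" where
  "DS \<chi> = lie_present (DS_rels \<chi>)"

definition DS_c :: "('s::ab_group_add \<Rightarrow> complex) \<Rightarrow> ('s Dgen magma \<Rightarrow> complex) set" where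
  "DS_c \<chi> = pgen (DS_rels \<chi>) C"

definition DS_D ::
    "('s::ab_group_add \<Rightarrow> complex) \<Rightarrow> 's \<Rightarrow> int \<Rightarrow> ('s Dgen magma \<Rightarrow> complex) set" where
  "DS_D \<chi> \<alpha> n = pgen (DS_rels \<chi>) (D \<alpha> n)"

text \<open>
  A formal series \<open>a(x)\<close> is the function sending \<open>k\<close> to the coefficient of \<open>x\<^sup>k\<close>;
  \<open>modes a\<close> is the series of the \<open>a(n) x\<^bsup>-n-1\<^esup>\<close>.
\<close>

definition modes :: "(int \<Rightarrow> 'v) \<Rightarrow> int \<Rightarrow> 'v" where
  "modes a = (\<lambda>k. a (- k - 1))"

definition dilate :: "'v calg \<Rightarrow> complex \<Rightarrow> (int \<Rightarrow> 'v) \<Rightarrow> int \<Rightarrow> 'v" where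
  "dilate L z F = (\<lambda>k. z powi k \<odot>\<^bsub>L\<^esub> F k)"

definition D_tilde ::
    "('s::ab_group_add \<Rightarrow> complex) \<Rightarrow> 's \<Rightarrow> int \<Rightarrow> ('s Dgen magma \<Rightarrow> complex) set" where
  "D_tilde \<chi> \<alpha> = (\<lambda>k. modes (DS_D \<chi> \<alpha>) k \<oplus>\<^bsub>DS \<chi>\<^esub>
     (if k = -1 \<and> \<alpha> + \<alpha> \<noteq> 0 then 1 / (\<chi> \<alpha> - \<chi> (- \<alpha>)) else 0) \<odot>\<^bsub>DS \<chi>\<^esub> DS_c \<chi>)"

definition D_field ::
    "('s::ab_group_add \<Rightarrow> complex) \<Rightarrow> 's \<Rightarrow> 's \<Rightarrow> int \<Rightarrow> ('s Dgen magma \<Rightarrow> complex) set" where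
  "D_field \<chi> \<alpha> \<beta> = (\<lambda>k. \<chi> \<beta> \<odot>\<^bsub>DS \<chi>\<^esub> dilate (DS \<chi>) (\<chi> \<beta>) (D_tilde \<chi> \<alpha>) k)"


section \<open>The Lie algebra \<open>\<gg>\<^sub>S\<close>\<close>

definition gS_rels :: "(('s::ab_group_add \<times> 's) magma \<Rightarrow> complex) rel" where
  "gS_rels =
     {(fgen (- \<alpha>, \<beta>), \<ominus>\<^bsub>free_alg\<^esub> fgen (\<alpha>, \<beta>)) | \<alpha> \<beta>. True} \<union>
     {(fgen (\<alpha>, \<beta>) \<otimes>\<^bsub>free_alg\<^esub> fgen (\<mu>, \<nu>),
       of_bool (\<alpha> + \<mu> = \<nu> - \<beta>) \<odot>\<^bsub>free_alg\<^esub> fgen (\<alpha> + \<mu>, - \<alpha> + \<nu>)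
       \<ominus>\<^bsub>free_alg\<^esub> of_bool (\<alpha> + \<mu> = \<beta> - \<nu>) \<odot>\<^bsub>free_alg\<^esub> fgen (\<alpha> + \<mu>, \<alpha> + \<nu>)
       \<ominus>\<^bsub>free_alg\<^esub> of_bool (\<alpha> - \<mu> = \<nu> - \<beta>) \<odot>\<^bsub>free_alg\<^esub> fgen (\<alpha> - \<mu>, \<nu> - \<alpha>)
       \<oplus>\<^bsub>free_alg\<^esub> of_bool (\<alpha> - \<mu> = \<beta> - \<nu>) \<odot>\<^bsub>free_alg\<^esub> fgen (\<alpha> - \<mu>, \<alpha> + \<nu>)) | \<alpha> \<beta> \<mu> \<nu>. True}"

definition gS :: "(('s::ab_group_add \<times> 's) magma \<Rightarrow> complex) set calg" where
  "gS = lie_present gS_rels"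

definition gS_d :: "'s::ab_group_add \<Rightarrow> 's \<Rightarrow> (('s \<times> 's) magma \<Rightarrow> complex) set" where
  "gS_d \<alpha> \<beta> = pgen gS_rels (\<alpha>, \<beta>)"

definition sym_inv_form :: "'v calg \<Rightarrow> ('v \<Rightarrow> 'v \<Rightarrow> complex) \<Rightarrow> bool" where
  "sym_inv_form L B \<longleftrightarrow>
     (\<forall>x\<in>carrier L. \<forall>y\<in>carrier L. \<forall>z\<in>carrier L. B (x \<oplus>\<^bsub>L\<^esub> y) z = B x z + B y z) \<and>
     (\<forall>r. \<forall>x\<in>carrier L. \<forall>y\<in>carrier L. B (r \<odot>\<^bsub>L\<^esub> x) y = r * B x y) \<and>
     (\<forall>x\<in>carrier L. \<forall>y\<in>carrier L. B x y = B y x) \<and>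
     (\<forall>x\<in>carrier L. \<forall>y\<in>carrier L. \<forall>z\<in>carrier L. B (x \<otimes>\<^bsub>L\<^esub> y) z = B x (y \<otimes>\<^bsub>L\<^esub> z))"

definition is_gS_form :: "('s::ab_group_add \<Rightarrow> complex) \<Rightarrow>
    ((('s \<times> 's) magma \<Rightarrow> complex) set \<Rightarrow> (('s \<times> 's) magma \<Rightarrow> complex) set \<Rightarrow> complex) \<Rightarrow> bool" where
  "is_gS_form \<chi> B \<longleftrightarrow> sym_inv_form gS B \<and>
     (\<forall>\<alpha> \<beta> \<mu> \<nu>. B (gS_d \<alpha> \<beta>) (gS_d \<mu> \<nu>) =
        \<chi> (\<alpha> + \<mu>) * of_bool ((\<alpha> + \<mu>) + (\<alpha> + \<mu>) = 0) * of_bool (\<alpha> + \<mu> = \<beta> - \<nu>)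
        - \<chi> (\<alpha> - \<mu>) * of_bool ((\<alpha> - \<mu>) + (\<alpha> - \<mu>) = 0) * of_bool (\<alpha> - \<mu> = \<beta> - \<nu>))"

text \<open>
  As the \<open>gS_d \<alpha> \<beta>\<close> span \<open>gS\<close>, the values of the form on \<open>carrier gS\<close> are determined;
  only the irrelevant values outside of the carrier are left open by the choice operator.
\<close>

definition gS_form :: "('s::ab_group_add \<Rightarrow> complex) \<Rightarrow>
    (('s \<times> 's) magma \<Rightarrow> complex) set \<Rightarrow> (('s \<times> 's) magma \<Rightarrow> complex) set \<Rightarrow> complex" where
  "gS_form \<chi> = (SOME B. is_gS_form \<chi> B)"


section \<open>Affine Lie algebras\<close>

text \<open>
  The pair \<open>(f, z)\<close> stands for the sum of all \<open>f n \<otimes> t\<^sup>n\<close> plus \<open>z\<close> times the central element.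
\<close>

definition affine_alg :: "'v calg \<Rightarrow> ('v \<Rightarrow> 'v \<Rightarrow> complex) \<Rightarrow> ((int \<Rightarrow> 'v) \<times> complex) calg" where
  "affine_alg L B = \<lparr>
     carrier = {f. range f \<subseteq> carrier L \<and> finite {n. f n \<noteq> \<zero>\<^bsub>L\<^esub>}} \<times> UNIV,
     mult = (\<lambda>(f, y) (g, z).
       ((\<lambda>p. \<Oplus>\<^bsub>L\<^esub>m\<in>{m. f m \<noteq> \<zero>\<^bsub>L\<^esub>}. f m \<otimes>\<^bsub>L\<^esub> g (p - m)),
        (\<Sum>m | f m \<noteq> \<zero>\<^bsub>L\<^esub>. of_int m * B (f m) (g (- m))))),
     one = ((\<lambda>n. \<zero>\<^bsub>L\<^esub>), 0),
     zero = ((\<lambda>n. \<zero>\<^bsub>L\<^esub>), 0),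
     add = (\<lambda>(f, y) (g, z). ((\<lambda>n. f n \<oplus>\<^bsub>L\<^esub> g n), y + z)),
     smult = (\<lambda>r (f, z). ((\<lambda>n. r \<odot>\<^bsub>L\<^esub> f n), r * z))\<rparr>"

definition aff_mode :: "'v calg \<Rightarrow> 'v \<Rightarrow> int \<Rightarrow> (int \<Rightarrow> 'v) \<times> complex" where
  "aff_mode L a n = ((\<lambda>p. if p = n then a else \<zero>\<^bsub>L\<^esub>), 0)"

definition aff_k :: "'v calg \<Rightarrow> (int \<Rightarrow> 'v) \<times> complex" where
  "aff_k L = ((\<lambda>p. \<zero>\<^bsub>L\<^esub>), 1)"


section \<open>Covariant algebras\<close>

text \<open>The group acting is (the type) \<open>'g\<close>; \<open>act g\<close> is the automorphism given by \<open>g\<close>.\<close>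

definition cov_bracket :: "'v calg \<Rightarrow> ('g \<Rightarrow> 'v \<Rightarrow> 'v) \<Rightarrow> 'v \<Rightarrow> 'v \<Rightarrow> 'v" where
  "cov_bracket K act a b =
     (\<Oplus>\<^bsub>K\<^esub>g\<in>{g. act g a \<otimes>\<^bsub>K\<^esub> b \<noteq> \<zero>\<^bsub>K\<^esub>}. act g a \<otimes>\<^bsub>K\<^esub> b)"

definition cov_ideal :: "'v calg \<Rightarrow> ('g \<Rightarrow> 'v \<Rightarrow> 'v) \<Rightarrow> 'v set" where
  "cov_ideal K act = lin_span K {a \<ominus>\<^bsub>K\<^esub> act g a | a g. a \<in> carrier K}"

definition cov_alg :: "'v calg \<Rightarrow> ('g \<Rightarrow> 'v \<Rightarrow> 'v) \<Rightarrow> 'v set calg" where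
  "cov_alg K act = quot_alg (K\<lparr>mult := cov_bracket K act\<rparr>) (cov_ideal K act)"


section \<open>The affine Lie algebra of \<open>\<gg>\<^sub>S\<close> and the action of \<open>S\<close>\<close>

definition gS_hat :: "('s::ab_group_add \<Rightarrow> complex) \<Rightarrow>
    ((int \<Rightarrow> (('s \<times> 's) magma \<Rightarrow> complex) set) \<times> complex) calg" where
  "gS_hat \<chi> = affine_alg gS (gS_form \<chi>)"

abbreviation d_mode :: "'s::ab_group_add \<Rightarrow> 's \<Rightarrow> int \<Rightarrow>
    (int \<Rightarrow> (('s \<times> 's) magma \<Rightarrow> complex) set) \<times> complex" where
  "d_mode \<alpha> \<beta> n \<equiv> aff_mode gS (gS_d \<alpha> \<beta>) n"

text \<open>As above, the choice only concerns values outside of the carrier.\<close>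

definition gS_act :: "('s::ab_group_add \<Rightarrow> complex) \<Rightarrow> 's \<Rightarrow>
    (int \<Rightarrow> (('s \<times> 's) magma \<Rightarrow> complex) set) \<times> complex \<Rightarrow>
    (int \<Rightarrow> (('s \<times> 's) magma \<Rightarrow> complex) set) \<times> complex" where
  "gS_act \<chi> \<gamma> = (SOME \<phi>. \<phi> \<in> lie_iso (gS_hat \<chi>) (gS_hat \<chi>) \<and>
     \<phi> (aff_k gS) = aff_k gS \<and>
     (\<forall>\<alpha> \<beta> n. \<phi> (d_mode \<alpha> \<beta> n) = \<chi> \<gamma> powi n \<odot>\<^bsub>gS_hat \<chi>\<^esub> d_mode \<alpha> (\<beta> + \<gamma>) n))"

text \<open>
  Sign of the central elements. Let \<open>4\<alpha> \<noteq> 0\<close>. With the cocycle of \<open>DS_rels\<close> and the form of \<open>is_gS_form\<close>,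
  the bracket of the \<open>m\<close>-th and \<open>(-m)\<close>-th coefficients of \<open>D_tilde\<close> is
  \<open>(\<chi>(-2m\<alpha>) - \<chi>(2m\<alpha>))\<close> times the \<open>0\<close>-th coefficient of \<open>D_tilde\<close> at \<open>2\<alpha>\<close>, plus \<open>m c\<close>, whereas
  the covariant bracket of \<open>d_mode \<alpha> 0 m\<close> and \<open>d_mode \<alpha> 0 (-m)\<close> is the same multiple of
  \<open>d_mode (2\<alpha>) 0 0\<close> plus \<open>m \<langle>d, d\<rangle> k = - m k\<close>. So a homomorphism taking the \<open>d_mode\<close>s to the
  coefficients of \<open>D_field\<close> has to take \<open>k\<close> to \<open>- c\<close>; no isomorphism takes \<open>k\<close> to \<open>c\<close>.
\<close>

end

theory Submission
  imports Defs
begin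

text \<open>
  The inverse of the isomorphism is easier to construct than the isomorphism itself: a homomorphism from the
  presented algebra \<open>D\<^sub>S\<close> to the covariant algebra only needs the relations to hold among the classes
  of the \<open>d\<^bsup>\<alpha>,0\<^esup>(n)\<close> and \<open>k\<close>, and no Jacobi identity has to be checked for the
  structure constants of \<open>D\<^sub>S\<close>. That the covariant algebra is a Lie algebra is a general fact: the
  covariant bracket satisfies the Leibniz identity \<open>x (y z) = (x y) z + y (x z)\<close> even before passing to the
  quotient, where it becomes skew-symmetric. The linear map \<open>\<pi>\<close> exists because the \<open>d\<^bsup>\<alpha>,\<beta>\<^esup>\<close>
  satisfy no linear relations but the obvious ones, which is seen in a faithful representation of a groupoid
  algebra. It is invariant under \<open>S\<close>, and on the spanning generators it is inverse to the homomorphism above.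
\<close>

section \<open>Complex modules\<close>

text \<open>The central terms are what has to be matched. In the covariant bracket of
  \<open>u \<alpha> n\<close> and \<open>u \<mu> m\<close> only the translations by \<alpha> +
  \<mu>, \<alpha> - \<mu> and their negatives survive; their weights \<chi>(g)^n turn into the
  structure constants \<chi>(m\<alpha> - n\<mu>) and \<chi>(m\<alpha> + n\<mu>) of D_S. The central
  part that comes out lives on those s among \<alpha> + \<mu>, \<alpha> - \<mu> with 2s = 0, whereas
  D_S has q-integers for every s. The shift in \<open>D_tilde\<close> bridges the gap: for nonzero
  2s it contributes (q^m - q^-m) / (q - q^-1) with q = \<chi>(s), and injectivity of \<chi> makes 2s
  = 0 the same as q = 1 or q = -1, where the exceptional values of the q-integer agree with the
  form. The q-integers are taken at the mode m of the second factor, the affine cocycle at the mode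
  n = -m of the first; hence \<open>aff_k gS\<close> corresponds to minus
  \<open>DS_c\<close>.\<close>

lemma complex_ring_simps [simp]:
  "carrier complex_ring = UNIV" "mult complex_ring = (*)" "one complex_ring = 1"
  "zero complex_ring = 0" "add complex_ring = (+)"
  by (simp_all add: complex_ring_def)

lemma cring_complex_ring: "cring complex_ring"
proof (rule cringI)
  show "abelian_group complex_ring"
    by (rule abelian_groupI) (auto simp: add.assoc add.commute intro: exI [of _ "- x" for x] left_minus)
  show "comm_monoid complex_ring"
    by (rule comm_monoidI) (auto simp: mult.assoc mult.commute)
qed (auto simp: distrib_right)

lemma complex_ring_uminus [simp]: "\<ominus>\<^bsub>complex_ring\<^esub> a = - a"
proof -
  interpret cring complex_ring by (rule cring_complex_ring)
  show ?thesis
    using l_neg [of a] by (simp add: eq_neg_iff_add_eq_0)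
qed

locale complex_module = module complex_ring V for V :: "'v calg" (structure)

text \<open>Negatives need not be supplied: (-1) \<odot> x is one, by the axiom that 0 \<odot> x is
  zero. For pointwise operations and for cosets that axiom is immediate.\<close>

lemma complex_moduleI:
  fixes V (structure)
  assumes "\<And>x y. \<lbrakk>x \<in> carrier V; y \<in> carrier V\<rbrakk> \<Longrightarrow> x \<oplus> y \<in> carrier V"
    and "\<zero> \<in> carrier V"
    and "\<And>x y z. \<lbrakk>x \<in> carrier V; y \<in> carrier V; z \<in> carrier V\<rbrakk> \<Longrightarrow> (x \<oplus> y) \<oplus> z = x \<oplus> (y \<oplus> z)"
    and "\<And>x y. \<lbrakk>x \<in> carrier V; y \<in> carrier V\<rbrakk> \<Longrightarrow> x \<oplus> y = y \<oplus> x"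
    and "\<And>x. x \<in> carrier V \<Longrightarrow> \<zero> \<oplus> x = x"
    and "\<And>r x. x \<in> carrier V \<Longrightarrow> r \<odot> x \<in> carrier V"
    and "\<And>r s x. x \<in> carrier V \<Longrightarrow> (r + s) \<odot> x = r \<odot> x \<oplus> s \<odot> x"
    and "\<And>r x y. \<lbrakk>x \<in> carrier V; y \<in> carrier V\<rbrakk> \<Longrightarrow> r \<odot> (x \<oplus> y) = r \<odot> x \<oplus> r \<odot> y"
    and "\<And>r s x. x \<in> carrier V \<Longrightarrow> (r * s) \<odot> x = r \<odot> (s \<odot> x)"
    and "\<And>x. x \<in> carrier V \<Longrightarrow> 1 \<odot> x = x"
    and "\<And>x. x \<in> carrier V \<Longrightarrow> 0 \<odot> x = \<zero>"
  shows "complex_module V"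
proof -
  have "(- 1) \<odot> x \<oplus> x = \<zero>" if "x \<in> carrier V" for x
    using assms(7) [OF that, of "- 1" 1] assms(10,11) [OF that] by simp
  then have "abelian_group V"
    using assms by (intro abelian_groupI) (blast+)
  then show ?thesis
    using assms cring_complex_ring by (auto simp: complex_module_def intro!: moduleI)
qed

context complex_module
begin

lemma smult_closed' [simp, intro]: "x \<in> carrier V \<Longrightarrow> r \<odot> x \<in> carrier V"
  using smult_closed [of r x] by simp

lemma smult_add_left: "x \<in> carrier V \<Longrightarrow> (r + s) \<odot> x = r \<odot> x \<oplus> s \<odot> x"
  using smult_l_distr [of r s x] by simp

lemma smult_add_right: "\<lbrakk>x \<in> carrier V; y \<in> carrier V\<rbrakk> \<Longrightarrow> r \<odot> (x \<oplus> y) = r \<odot> x \<oplus> r \<odot> y"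
  using smult_r_distr [of r x y] by simp

lemma smult_mult: "x \<in> carrier V \<Longrightarrow> (r * s) \<odot> x = r \<odot> (s \<odot> x)"
  using smult_assoc1 [of r s x] by simp

lemma smult_smult [simp]: "x \<in> carrier V \<Longrightarrow> r \<odot> (s \<odot> x) = (r * s) \<odot> x"
  by (simp add: smult_mult)

lemma smult_1 [simp]: "x \<in> carrier V \<Longrightarrow> 1 \<odot> x = x"
  using smult_one [of x] by simp

lemma smult_0 [simp]: "x \<in> carrier V \<Longrightarrow> 0 \<odot> x = \<zero>"
  using smult_l_null [of x] by simp

lemma smult_zero [simp]: "r \<odot> \<zero> = \<zero>"
  using smult_r_null [of r] by simp

lemma smult_uminus_left: "x \<in> carrier V \<Longrightarrow> (- r) \<odot> x = \<ominus> (r \<odot> x)"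
  using smult_l_minus [of r x] by simp

lemma uminus_eq_smult: "x \<in> carrier V \<Longrightarrow> \<ominus> x = (- 1) \<odot> x"
  by (simp add: smult_uminus_left)

lemma minus_eq_smult: "\<lbrakk>x \<in> carrier V; y \<in> carrier V\<rbrakk> \<Longrightarrow> x \<ominus> y = x \<oplus> (- 1) \<odot> y"
  by (simp add: M.minus_eq uminus_eq_smult)

lemma smult_minus_right: "\<lbrakk>x \<in> carrier V; y \<in> carrier V\<rbrakk> \<Longrightarrow> r \<odot> (x \<ominus> y) = r \<odot> x \<ominus> r \<odot> y"
  by (simp add: minus_eq_smult smult_add_right)

lemma minus_eq_zero_iff: "\<lbrakk>x \<in> carrier V; y \<in> carrier V\<rbrakk> \<Longrightarrow> x \<ominus> y = \<zero> \<longleftrightarrow> x = y"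
  by (metis M.add.inv_solve_right M.l_zero M.minus_eq M.zero_closed)

text \<open>Division by 2. It recovers the alternating law from skew-symmetry, both on spanning sets
  and in the covariant algebra.\<close>

lemma self_eq_uminus: "x \<in> carrier V \<Longrightarrow> x = \<ominus> x \<Longrightarrow> x = \<zero>"
proof -
  assume x: "x \<in> carrier V" and "x = \<ominus> x"
  then have "x \<oplus> x = \<zero>" by (metis M.r_neg)
  then have "2 \<odot> x = \<zero>" using smult_add_left [OF x, of 1 1] x by simp
  then have "(1/2) \<odot> (2 \<odot> x) = \<zero>" by simp
  then show ?thesis using x by simp
qed

lemma submodule_zero: "submodule H complex_ring V \<Longrightarrow> \<zero> \<in> H"
  using submodule.axioms(1) subgroup.one_closed by fastforce

lemma submodule_subset: "submodule H complex_ring V \<Longrightarrow> H \<subseteq> carrier V"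
  by (rule submoduleE)

lemma submodule_add: "\<lbrakk>submodule H complex_ring V; x \<in> H; y \<in> H\<rbrakk> \<Longrightarrow> x \<oplus> y \<in> H"
  by (rule submoduleE)

lemma submodule_smult: "\<lbrakk>submodule H complex_ring V; x \<in> H\<rbrakk> \<Longrightarrow> r \<odot> x \<in> H"
  by (simp add: submoduleE)

lemma submodule_minus: "\<lbrakk>submodule H complex_ring V; x \<in> H; y \<in> H\<rbrakk> \<Longrightarrow> x \<ominus> y \<in> H"
  by (metis M.minus_eq submoduleE(3) submodule_add)

lemma complex_submoduleI:
  assumes "H \<subseteq> carrier V" "\<zero> \<in> H" "\<And>x y. \<lbrakk>x \<in> H; y \<in> H\<rbrakk> \<Longrightarrow> x \<oplus> y \<in> H"
    and "\<And>r x. x \<in> H \<Longrightarrow> r \<odot> x \<in> H"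
  shows "submodule H complex_ring V"
proof (rule submoduleI)
  show "\<ominus> x \<in> H" if "x \<in> H" for x
    using assms that uminus_eq_smult [of x] by auto
qed (use assms in auto)

lemma submodule_lin_span: "X \<subseteq> carrier V \<Longrightarrow> submodule (lin_span V X) complex_ring V"
  by (intro complex_submoduleI)
    (use carrier_is_submodule in \<open>auto simp: lin_span_def submodule_zero submodule_add submodule_smult\<close>)

lemma lin_span_superset: "X \<subseteq> lin_span V X"
  by (auto simp: lin_span_def)

lemma lin_span_minimal: "\<lbrakk>submodule H complex_ring V; X \<subseteq> H\<rbrakk> \<Longrightarrow> lin_span V X \<subseteq> H"
  by (auto simp: lin_span_def)

lemma lin_span_induct [consumes 2, case_names zero add smult base]:
  assumes "x \<in> lin_span V X" "X \<subseteq> carrier V"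
    and "P \<zero>"
    and "\<And>x y. \<lbrakk>x \<in> carrier V; y \<in> carrier V; P x; P y\<rbrakk> \<Longrightarrow> P (x \<oplus> y)"
    and "\<And>r x. \<lbrakk>x \<in> carrier V; P x\<rbrakk> \<Longrightarrow> P (r \<odot> x)"
    and "\<And>x. x \<in> X \<Longrightarrow> P x"
  shows "P x"
proof -
  have "submodule {x \<in> carrier V. P x} complex_ring V"
    using assms by (intro complex_submoduleI) auto
  then have "lin_span V X \<subseteq> {x \<in> carrier V. P x}"
    using assms by (intro lin_span_minimal) auto
  with assms(1) show ?thesis by auto
qed

text \<open>The covariant bracket sums over exactly the indices with a nonzero term, a set that
  changes with the arguments. Such sums can only be added over a common finite index set.\<close>

lemma finsum_superset:
  assumes "finite A" "{i. f i \<noteq> \<zero>} \<subseteq> A" "\<And>i. f i \<in> carrier V"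
  shows "(\<Oplus>i\<in>{i. f i \<noteq> \<zero>}. f i) = (\<Oplus>i\<in>A. f i)"
  using assms by (intro M.add.finprod_mono_neutral_cong_left) auto

lemma finsum_smult:
  "\<lbrakk>finite A; \<And>i. i \<in> A \<Longrightarrow> f i \<in> carrier V\<rbrakk> \<Longrightarrow> r \<odot> (\<Oplus>i\<in>A. f i) = (\<Oplus>i\<in>A. r \<odot> f i)"
  by (rule finsum_smult_ldistr) auto

end

lemma lin_maps_closed: "f \<in> lin_maps K L \<Longrightarrow> x \<in> carrier K \<Longrightarrow> f x \<in> carrier L"
  by (auto simp: lin_maps_def)

lemma lin_maps_add:
  "\<lbrakk>f \<in> lin_maps K L; x \<in> carrier K; y \<in> carrier K\<rbrakk> \<Longrightarrow> f (x \<oplus>\<^bsub>K\<^esub> y) = f x \<oplus>\<^bsub>L\<^esub> f y"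
  by (auto simp: lin_maps_def)

lemma lin_maps_smult:
  "\<lbrakk>f \<in> lin_maps K L; x \<in> carrier K\<rbrakk> \<Longrightarrow> f (r \<odot>\<^bsub>K\<^esub> x) = r \<odot>\<^bsub>L\<^esub> f x"
  by (auto simp: lin_maps_def)

lemma lin_maps_comp: "\<lbrakk>f \<in> lin_maps K L; g \<in> lin_maps L M\<rbrakk> \<Longrightarrow> (\<lambda>x. g (f x)) \<in> lin_maps K M"
  by (auto simp: lin_maps_def Pi_def)

lemma lin_maps_id: "(\<lambda>x. x) \<in> lin_maps K K"
  by (auto simp: lin_maps_def)

locale complex_module_pair = K: complex_module K + L: complex_module L
  for K :: "'v calg" (structure) and L :: "'w calg" (structure)
begin

lemma lin_maps_zero: "f \<in> lin_maps K L \<Longrightarrow> f \<zero>\<^bsub>K\<^esub> = \<zero>\<^bsub>L\<^esub>"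
  using lin_maps_smult [of f K L "\<zero>\<^bsub>K\<^esub>" 0] by (simp add: lin_maps_closed)

lemma lin_maps_uminus: "\<lbrakk>f \<in> lin_maps K L; x \<in> carrier K\<rbrakk> \<Longrightarrow> f (\<ominus>\<^bsub>K\<^esub> x) = \<ominus>\<^bsub>L\<^esub> f x"
  by (simp add: K.uminus_eq_smult L.uminus_eq_smult lin_maps_closed lin_maps_smult)

lemma lin_maps_minus:
  "\<lbrakk>f \<in> lin_maps K L; x \<in> carrier K; y \<in> carrier K\<rbrakk> \<Longrightarrow> f (x \<ominus>\<^bsub>K\<^esub> y) = f x \<ominus>\<^bsub>L\<^esub> f y"
  by (simp add: K.minus_eq_smult L.minus_eq_smult lin_maps_closed lin_maps_smult lin_maps_add)

lemma lin_maps_finsum: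
  assumes "f \<in> lin_maps K L" "\<And>i. i \<in> A \<Longrightarrow> x i \<in> carrier K"
  shows "f (\<Oplus>\<^bsub>K\<^esub>i\<in>A. x i) = (\<Oplus>\<^bsub>L\<^esub>i\<in>A. f (x i))"
proof (cases "finite A")
  case True
  then show ?thesis
    using assms(2)
  proof (induction A)
    case empty
    then show ?case using lin_maps_zero [OF assms(1)] by simp
  next
    case (insert a F)
    moreover have "f (x a) \<in> carrier L" "(\<lambda>i. f (x i)) \<in> F \<rightarrow> carrier L"
      using insert.prems lin_maps_closed [OF assms(1)] by auto
    ultimately show ?case using lin_maps_add [OF assms(1)] by (simp add: Pi_def)
  qed
next
  case False
  then show ?thesis using lin_maps_zero [OF assms(1)]
    by (simp add: K.M.add.finprod_infinite L.M.add.finprod_infinite)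
qed

lemma lin_maps_eqI:
  assumes "f \<in> lin_maps K L" "g \<in> lin_maps K L" "X \<subseteq> carrier K" "carrier K \<subseteq> lin_span K X"
    and "\<And>x. x \<in> X \<Longrightarrow> f x = g x" and "x \<in> carrier K"
  shows "f x = g x"
proof -
  have "x \<in> lin_span K X" using assms by auto
  then show ?thesis using \<open>X \<subseteq> carrier K\<close>
    by (induction rule: K.lin_span_induct)
      (use assms in \<open>simp_all add: lin_maps_zero lin_maps_add lin_maps_smult\<close>)
qed

end

text \<open>The universal property of the free module of finitely supported functions; used for the
  free magma and for coordinates on \<open>gS\<close>.\<close>

definition lin_ext :: "'v calg \<Rightarrow> ('i \<Rightarrow> 'v) \<Rightarrow> ('i \<Rightarrow> complex) \<Rightarrow> 'v" where
  "lin_ext V h f = (\<Oplus>\<^bsub>V\<^esub>i\<in>{i. f i \<noteq> 0}. f i \<odot>\<^bsub>V\<^esub> h i)"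

context complex_module
begin

lemma lin_ext_superset:
  assumes "\<And>i. h i \<in> carrier V" "finite A" "{i. f i \<noteq> 0} \<subseteq> A"
  shows "lin_ext V h f = (\<Oplus>i\<in>A. f i \<odot> h i)"
  unfolding lin_ext_def using assms by (intro M.add.finprod_mono_neutral_cong_left) auto

lemma lin_ext_closed:
  assumes "\<And>i. h i \<in> carrier V"
  shows "lin_ext V h f \<in> carrier V"
  unfolding lin_ext_def using assms by (intro M.finsum_closed) auto

lemma lin_ext_add:
  assumes "\<And>i. h i \<in> carrier V" "finite {i. f i \<noteq> 0}" "finite {i. g i \<noteq> 0}"
  shows "lin_ext V h (\<lambda>i. f i + g i) = lin_ext V h f \<oplus> lin_ext V h g"
proof -
  let ?A = "{i. f i \<noteq> 0} \<union> {i. g i \<noteq> 0}"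
  have "lin_ext V h (\<lambda>i. f i + g i) = (\<Oplus>i\<in>?A. (f i + g i) \<odot> h i)"
    using assms by (intro lin_ext_superset) auto
  also have "\<dots> = (\<Oplus>i\<in>?A. f i \<odot> h i \<oplus> g i \<odot> h i)"
    using assms(1) by (intro M.finsum_cong') (auto simp: smult_add_left)
  also have "\<dots> = (\<Oplus>i\<in>?A. f i \<odot> h i) \<oplus> (\<Oplus>i\<in>?A. g i \<odot> h i)"
    using assms(1) by (intro M.finsum_addf) auto
  also have "\<dots> = lin_ext V h f \<oplus> lin_ext V h g"
    using assms by (subst (1 2) lin_ext_superset [where A = ?A]) auto
  finally show ?thesis .
qed

lemma lin_ext_smult:
  assumes "\<And>i. h i \<in> carrier V" "finite {i. f i \<noteq> 0}"
  shows "lin_ext V h (\<lambda>i. r * f i) = r \<odot> lin_ext V h f"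
proof -
  let ?A = "{i. f i \<noteq> 0}"
  have "lin_ext V h (\<lambda>i. r * f i) = (\<Oplus>i\<in>?A. (r * f i) \<odot> h i)"
    using assms by (intro lin_ext_superset) auto
  also have "\<dots> = (\<Oplus>i\<in>?A. r \<odot> (f i \<odot> h i))"
    using assms(1) by (intro M.finsum_cong') auto
  also have "\<dots> = r \<odot> lin_ext V h f"
    unfolding lin_ext_def using assms by (intro finsum_smult [symmetric]) auto
  finally show ?thesis .
qed

lemma lin_ext_of_bool:
  assumes "\<And>i. h i \<in> carrier V"
  shows "lin_ext V h (\<lambda>j. of_bool (j = i)) = h i"
proof -
  have "lin_ext V h (\<lambda>j. of_bool (j = i)) = (\<Oplus>j\<in>{i}. of_bool (j = i) \<odot> h j)"
    using assms by (intro lin_ext_superset) auto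
  also have "\<dots> = h i"
    using assms by (simp add: Pi_def)
  finally show ?thesis .
qed

end

section \<open>Algebras and their quotients\<close>

text \<open>Kept apart from \<open>lie_algebra\<close> because the free nonassociative algebra, and
  the covariant bracket before passing to the quotient, are merely bilinear.\<close>

locale complex_algebra = complex_module L for L :: "'v calg" (structure) +
  assumes mult_closed [simp, intro]:
      "\<lbrakk>x \<in> carrier L; y \<in> carrier L\<rbrakk> \<Longrightarrow> x \<otimes> y \<in> carrier L"
    and mult_add_left:
      "\<lbrakk>x \<in> carrier L; y \<in> carrier L; z \<in> carrier L\<rbrakk> \<Longrightarrow> (x \<oplus> y) \<otimes> z = x \<otimes> z \<oplus> y \<otimes> z"
    and mult_add_right:
      "\<lbrakk>x \<in> carrier L; y \<in> carrier L; z \<in> carrier L\<rbrakk> \<Longrightarrow> x \<otimes> (y \<oplus> z) = x \<otimes> y \<oplus> x \<otimes> z"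
    and mult_smult_left:
      "\<lbrakk>x \<in> carrier L; y \<in> carrier L\<rbrakk> \<Longrightarrow> (r \<odot> x) \<otimes> y = r \<odot> (x \<otimes> y)"
    and mult_smult_right:
      "\<lbrakk>x \<in> carrier L; y \<in> carrier L\<rbrakk> \<Longrightarrow> x \<otimes> (r \<odot> y) = r \<odot> (x \<otimes> y)"
begin

lemma mult_lin_left: "y \<in> carrier L \<Longrightarrow> (\<lambda>x. x \<otimes> y) \<in> lin_maps L L"
  by (auto simp: lin_maps_def mult_add_left mult_smult_left)

lemma mult_lin_right: "x \<in> carrier L \<Longrightarrow> (\<lambda>y. x \<otimes> y) \<in> lin_maps L L"
  by (auto simp: lin_maps_def mult_add_right mult_smult_right)

lemma self_pair: "complex_module_pair L L"
  by (simp add: complex_module_pair_def complex_module_axioms)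

lemma mult_zero_left [simp]: "x \<in> carrier L \<Longrightarrow> \<zero> \<otimes> x = \<zero>"
  using complex_module_pair.lin_maps_zero [OF self_pair mult_lin_left] .

lemma mult_zero_right [simp]: "x \<in> carrier L \<Longrightarrow> x \<otimes> \<zero> = \<zero>"
  using complex_module_pair.lin_maps_zero [OF self_pair mult_lin_right] .

lemma mult_uminus_right: "\<lbrakk>x \<in> carrier L; y \<in> carrier L\<rbrakk> \<Longrightarrow> x \<otimes> (\<ominus> y) = \<ominus> (x \<otimes> y)"
  using complex_module_pair.lin_maps_uminus [OF self_pair mult_lin_right] .

lemma mult_minus_left:
  "\<lbrakk>x \<in> carrier L; y \<in> carrier L; z \<in> carrier L\<rbrakk> \<Longrightarrow> (x \<ominus> y) \<otimes> z = x \<otimes> z \<ominus> y \<otimes> z"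
  using complex_module_pair.lin_maps_minus [OF self_pair mult_lin_left] .

lemma mult_minus_right:
  "\<lbrakk>x \<in> carrier L; y \<in> carrier L; z \<in> carrier L\<rbrakk> \<Longrightarrow> x \<otimes> (y \<ominus> z) = x \<otimes> y \<ominus> x \<otimes> z"
  using complex_module_pair.lin_maps_minus [OF self_pair mult_lin_right] .

lemma mult_finsum_left:
  "\<lbrakk>\<And>i. i \<in> A \<Longrightarrow> f i \<in> carrier L; y \<in> carrier L\<rbrakk> \<Longrightarrow> (\<Oplus>i\<in>A. f i) \<otimes> y = (\<Oplus>i\<in>A. f i \<otimes> y)"
  using complex_module_pair.lin_maps_finsum [OF self_pair mult_lin_left] .

lemma mult_finsum_right:
  "\<lbrakk>\<And>i. i \<in> A \<Longrightarrow> f i \<in> carrier L; y \<in> carrier L\<rbrakk> \<Longrightarrow> y \<otimes> (\<Oplus>i\<in>A. f i) = (\<Oplus>i\<in>A. y \<otimes> f i)"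
  using complex_module_pair.lin_maps_finsum [OF self_pair mult_lin_right] .

end

lemma (in lie_algebra) complex_algebra: "complex_algebra L"
  by (intro complex_algebra.intro complex_module.intro complex_algebra_axioms.intro module_axioms
      bracket_closed bracket_add_left bracket_add_right bracket_smult_left bracket_smult_right)

sublocale lie_algebra \<subseteq> complex_algebra L
  by (rule complex_algebra)

lemma (in complex_algebra) lie_algebraI:
  assumes "\<And>x. x \<in> carrier L \<Longrightarrow> x \<otimes> x = \<zero>"
    and "\<And>x y z. \<lbrakk>x \<in> carrier L; y \<in> carrier L; z \<in> carrier L\<rbrakk> \<Longrightarrow>
      x \<otimes> (y \<otimes> z) \<oplus> y \<otimes> (z \<otimes> x) \<oplus> z \<otimes> (x \<otimes> y) = \<zero>"
  shows "lie_algebra L"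
  by (intro lie_algebra.intro lie_algebra_axioms.intro module_axioms mult_closed mult_add_left
      mult_add_right mult_smult_left mult_smult_right assms)

context lie_algebra
begin

lemma mult_antisym: "\<lbrakk>x \<in> carrier L; y \<in> carrier L\<rbrakk> \<Longrightarrow> x \<otimes> y = \<ominus> (y \<otimes> x)"
proof -
  assume xy: "x \<in> carrier L" "y \<in> carrier L"
  then have "\<zero> = (x \<oplus> y) \<otimes> (x \<oplus> y)" by (simp add: bracket_self)
  also have "\<dots> = x \<otimes> x \<oplus> y \<otimes> x \<oplus> (x \<otimes> y \<oplus> y \<otimes> y)"
    using xy by (simp add: mult_add_left mult_add_right)
  also have "\<dots> = x \<otimes> y \<oplus> y \<otimes> x"
    using xy by (simp add: bracket_self M.a_comm)
  finally show ?thesis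
    using xy by (simp add: M.minus_equality)
qed

end

text \<open>Skew-symmetry and the Jacobi identity are linear in each argument, so they pass from a
  spanning set to everything one argument at a time. The alternating law is quadratic and is
  therefore recovered afterwards, by \<open>self_eq_uminus\<close>.\<close>

lemma (in complex_algebra) lie_algebraI_span:
  assumes X: "X \<subseteq> carrier L" "carrier L \<subseteq> lin_span L X"
    and anti: "\<And>x y. \<lbrakk>x \<in> X; y \<in> X\<rbrakk> \<Longrightarrow> x \<otimes> y = \<ominus> (y \<otimes> x)"
    and jac: "\<And>x y z. \<lbrakk>x \<in> X; y \<in> X; z \<in> X\<rbrakk> \<Longrightarrow>
      x \<otimes> (y \<otimes> z) \<oplus> y \<otimes> (z \<otimes> x) \<oplus> z \<otimes> (x \<otimes> y) = \<zero>"
  shows "lie_algebra L"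
proof -
  have lin_eq: "f x = g x" if "f \<in> lin_maps L L" "g \<in> lin_maps L L" "\<And>x. x \<in> X \<Longrightarrow> f x = g x"
    "x \<in> carrier L" for f g x
    using complex_module_pair.lin_maps_eqI [OF self_pair that(1,2) X that(3,4)] .
  have lin_uminus: "(\<lambda>x. \<ominus> f x) \<in> lin_maps L L" if "f \<in> lin_maps L L" for f
    using that by (simp add: lin_maps_def Pi_def uminus_eq_smult smult_add_right mult.commute)
  have lin_zero: "(\<lambda>x. \<zero>) \<in> lin_maps L L"
    by (auto simp: lin_maps_def)
  have lin_add: "(\<lambda>x. f x \<oplus> g x) \<in> lin_maps L L"
    if "f \<in> lin_maps L L" "g \<in> lin_maps L L" for f g
    using that by (simp add: lin_maps_def Pi_def M.a_ac smult_add_right)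
  note lin = mult_lin_left mult_lin_right lin_uminus lin_add lin_zero
    lin_maps_comp [OF mult_lin_left mult_lin_left] lin_maps_comp [OF mult_lin_left mult_lin_right]
    lin_maps_comp [OF mult_lin_right mult_lin_left] lin_maps_comp [OF mult_lin_right mult_lin_right]
  have anti': "x \<otimes> y = \<ominus> (y \<otimes> x)" if xy: "x \<in> carrier L" "y \<in> carrier L" for x y
  proof (rule lin_eq [of "\<lambda>y. x \<otimes> y" "\<lambda>y. \<ominus> (y \<otimes> x)"])
    fix y assume y: "y \<in> X"
    show "x \<otimes> y = \<ominus> (y \<otimes> x)"
    proof (rule lin_eq [of "\<lambda>x. x \<otimes> y" "\<lambda>x. \<ominus> (y \<otimes> x)"])
      show "x \<otimes> y = \<ominus> (y \<otimes> x)" if "x \<in> X" for x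
        using that y by (rule anti)
    qed (use xy y X(1) in \<open>auto intro: lin\<close>)
  qed (use xy in \<open>auto intro: lin\<close>)
  let ?J = "\<lambda>x y z. x \<otimes> (y \<otimes> z) \<oplus> y \<otimes> (z \<otimes> x) \<oplus> z \<otimes> (x \<otimes> y)"
  have jac': "?J x y z = \<zero>" if xyz: "x \<in> carrier L" "y \<in> carrier L" "z \<in> carrier L" for x y z
  proof (rule lin_eq [of "\<lambda>z. ?J x y z" "\<lambda>z. \<zero>"])
    fix z assume z: "z \<in> X"
    show "?J x y z = \<zero>"
    proof (rule lin_eq [of "\<lambda>y. ?J x y z" "\<lambda>y. \<zero>"])
      fix y assume y: "y \<in> X"
      show "?J x y z = \<zero>"
        by (rule lin_eq [of "\<lambda>x. ?J x y z" "\<lambda>x. \<zero>"])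
          (use xyz y z X(1) jac in \<open>auto intro!: lin\<close>)
    qed (use xyz z X(1) in \<open>auto intro!: lin\<close>)
  qed (use xyz in \<open>auto intro!: lin\<close>)
  show ?thesis
  proof (rule lie_algebraI)
    show "x \<otimes> x = \<zero>" if "x \<in> carrier L" for x
      using self_eq_uminus [OF mult_closed anti'] that by blast
  qed (rule jac')
qed

section \<open>Cosets of submodules and quotients by ideals\<close>

context complex_module
begin

lemma abelian_subgroupI': "submodule I complex_ring V \<Longrightarrow> abelian_subgroup I V"
  by (intro abelian_subgroupI3 additive_subgroupI)
    (simp_all add: submodule_def M.abelian_group_axioms)

lemma mem_coset_iff:
  assumes "submodule I complex_ring V" "a \<in> carrier V"
  shows "x \<in> I +> a \<longleftrightarrow> x \<in> carrier V \<and> x \<ominus> a \<in> I"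
proof -
  interpret abelian_subgroup I V using assms(1) by (rule abelian_subgroupI')
  show ?thesis
    using assms a_rcos_module [of a x] a_elemrcos_carrier [of a x] by (auto simp: M.minus_eq)
qed

lemma coset_eq_iff:
  assumes "submodule I complex_ring V" "a \<in> carrier V" "b \<in> carrier V"
  shows "I +> a = I +> b \<longleftrightarrow> a \<ominus> b \<in> I"
proof -
  interpret abelian_subgroup I V using assms(1) by (rule abelian_subgroupI')
  have "I +> a = I +> b \<longleftrightarrow> a \<in> I +> b"
    using assms(2,3) a_repr_independence' [of a b] a_repr_independenceD [of a b] by auto
  then show ?thesis
    using assms by (simp add: mem_coset_iff)
qed

end

locale alg_ideal = complex_algebra K for K :: "'v calg" (structure) and I +
  assumes submodule: "submodule I complex_ring K"
    and ideal_left: "\<lbrakk>a \<in> carrier K; x \<in> I\<rbrakk> \<Longrightarrow> a \<otimes> x \<in> I"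
    and ideal_right: "\<lbrakk>a \<in> carrier K; x \<in> I\<rbrakk> \<Longrightarrow> x \<otimes> a \<in> I"
begin

abbreviation Q where "Q \<equiv> quot_alg K I"

lemmas mem_coset = mem_coset_iff [OF submodule]
lemmas coset_eq = coset_eq_iff [OF submodule]

lemma coset_self: "a \<in> carrier K \<Longrightarrow> a \<in> I +> a"
  by (simp add: mem_coset minus_eq_zero_iff [THEN iffD2] submodule_zero [OF submodule])

lemma coset_zero_iff: "a \<in> carrier K \<Longrightarrow> I +> a = I \<longleftrightarrow> a \<in> I"
proof -
  interpret abelian_subgroup I K by (rule abelian_subgroupI' [OF submodule])
  show "a \<in> carrier K \<Longrightarrow> I +> a = I \<longleftrightarrow> a \<in> I"
    using coset_self a_rcos_const by blast
qed

lemma quot_carrier: "carrier Q = (\<lambda>a. I +> a) ` carrier K"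
  by (auto simp: quot_alg_def ring.defs FactRing_def A_RCOSETS_def' a_r_coset_def')

lemma quot_zero: "\<zero>\<^bsub>Q\<^esub> = I"
  by (simp add: quot_alg_def ring.defs FactRing_def)

lemma coset_closed: "a \<in> carrier K \<Longrightarrow> I +> a \<in> carrier Q"
  by (simp add: quot_carrier)

lemma coset_add:
  assumes "a \<in> carrier K" "b \<in> carrier K"
  shows "(I +> a) \<oplus>\<^bsub>Q\<^esub> (I +> b) = I +> (a \<oplus> b)"
proof -
  interpret abelian_subgroup I K by (rule abelian_subgroupI' [OF submodule])
  show ?thesis
    using assms a_rcos_sum by (simp add: quot_alg_def ring.defs FactRing_def)
qed

lemma coset_smult:
  assumes "a \<in> carrier K"
  shows "r \<odot>\<^bsub>Q\<^esub> (I +> a) = I +> (r \<odot> a)"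
proof -
  have "I +> (r \<odot> x) = I +> (r \<odot> a)" if "x \<in> I +> a" for x
    using that assms submodule_smult [OF submodule, of "x \<ominus> a" r]
    by (auto simp: coset_eq mem_coset smult_minus_right)
  \<comment> \<open>The quotient operation is defined as a union over all representatives. It is
    constant on a nonempty index set, hence equal to a single coset.\<close>
  then have "(\<Union>x\<in>I +> a. I +> (r \<odot> x)) = I +> (r \<odot> a)"
    using coset_self [OF assms] by (intro SUP_eq_const) blast+
  then show ?thesis
    by (simp add: quot_alg_def ring.defs)
qed

lemma coset_mult:
  assumes "a \<in> carrier K" "b \<in> carrier K"
  shows "(I +> a) \<otimes>\<^bsub>Q\<^esub> (I +> b) = I +> (a \<otimes> b)"
proof -
  have "I +> (x \<otimes> y) = I +> (a \<otimes> b)" if "x \<in> I +> a" "y \<in> I +> b" for x y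
  proof -
    have xy: "x \<in> carrier K" "y \<in> carrier K" "x \<ominus> a \<in> I" "y \<ominus> b \<in> I"
      using that assms by (auto simp: mem_coset)
    have "I +> (x \<otimes> y) = I +> (a \<otimes> y)"
      using xy assms ideal_right [of y "x \<ominus> a"] by (simp add: coset_eq mult_minus_left)
    also have "\<dots> = I +> (a \<otimes> b)"
      using xy assms ideal_left [of a "y \<ominus> b"] by (simp add: coset_eq mult_minus_right)
    finally show ?thesis .
  qed
  then have "(\<Union>x\<in>I +> a. \<Union>y\<in>I +> b. I +> (x \<otimes> y)) = I +> (a \<otimes> b)"
    using coset_self assms by (intro SUP_eq_const) blast+
  then show ?thesis
    by (simp add: quot_alg_def ring.defs FactRing_def rcoset_mult_def)
qed

lemma coset_of_zero: "I +> \<zero> = I"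
  by (simp add: coset_zero_iff submodule_zero [OF submodule])

lemma quot_module: "complex_module Q"
proof (rule complex_moduleI)
  show "\<zero>\<^bsub>Q\<^esub> \<in> carrier Q"
    using coset_closed [of \<zero>] by (simp add: quot_zero coset_of_zero)
  fix X assume "X \<in> carrier Q"
  then obtain x where x: "x \<in> carrier K" "X = I +> x"
    by (auto simp: quot_carrier)
  show "\<zero>\<^bsub>Q\<^esub> \<oplus>\<^bsub>Q\<^esub> X = X"
    using x coset_add [of \<zero> x] by (simp add: quot_zero coset_of_zero)
  show "0 \<odot>\<^bsub>Q\<^esub> X = \<zero>\<^bsub>Q\<^esub>"
    using x by (simp add: coset_smult quot_zero coset_of_zero)
qed (auto simp: quot_carrier coset_add coset_smult M.a_ac smult_add_left smult_add_right)

lemma quot_algebra: "complex_algebra Q"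
proof (rule complex_algebra.intro [OF quot_module], rule complex_algebra_axioms.intro)
  fix X Y Z r assume "X \<in> carrier Q" "Y \<in> carrier Q"
  then obtain x y where xy: "x \<in> carrier K" "X = I +> x" "y \<in> carrier K" "Y = I +> y"
    by (auto simp: quot_carrier)
  show "X \<otimes>\<^bsub>Q\<^esub> Y \<in> carrier Q"
    using xy coset_closed [of "x \<otimes> y"] by (simp add: coset_mult)
  show "r \<odot>\<^bsub>Q\<^esub> X \<otimes>\<^bsub>Q\<^esub> Y = r \<odot>\<^bsub>Q\<^esub> (X \<otimes>\<^bsub>Q\<^esub> Y)" "X \<otimes>\<^bsub>Q\<^esub> (r \<odot>\<^bsub>Q\<^esub> Y) = r \<odot>\<^bsub>Q\<^esub> (X \<otimes>\<^bsub>Q\<^esub> Y)"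
    using xy by (simp_all add: coset_mult coset_smult mult_smult_left mult_smult_right)
  assume "Z \<in> carrier Q"
  then obtain z where z: "z \<in> carrier K" "Z = I +> z"
    by (auto simp: quot_carrier)
  show "(X \<oplus>\<^bsub>Q\<^esub> Y) \<otimes>\<^bsub>Q\<^esub> Z = X \<otimes>\<^bsub>Q\<^esub> Z \<oplus>\<^bsub>Q\<^esub> Y \<otimes>\<^bsub>Q\<^esub> Z"
    "X \<otimes>\<^bsub>Q\<^esub> (Y \<oplus>\<^bsub>Q\<^esub> Z) = X \<otimes>\<^bsub>Q\<^esub> Y \<oplus>\<^bsub>Q\<^esub> X \<otimes>\<^bsub>Q\<^esub> Z"
    using xy z by (simp_all add: coset_mult coset_add mult_add_left mult_add_right)
qed

lemma coset_lin: "(\<lambda>a. I +> a) \<in> lin_maps K Q"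
  by (auto simp: lin_maps_def coset_add coset_smult coset_closed)

lemma quot_lie_algebra:
  assumes "\<And>x. x \<in> carrier K \<Longrightarrow> x \<otimes> x \<in> I"
    and "\<And>x y z. \<lbrakk>x \<in> carrier K; y \<in> carrier K; z \<in> carrier K\<rbrakk> \<Longrightarrow>
      x \<otimes> (y \<otimes> z) \<oplus> y \<otimes> (z \<otimes> x) \<oplus> z \<otimes> (x \<otimes> y) \<in> I"
  shows "lie_algebra Q"
proof (rule complex_algebra.lie_algebraI [OF quot_algebra], goal_cases)
  case (1 X)
  then obtain x where "x \<in> carrier K" "X = I +> x" by (auto simp: quot_carrier)
  then show ?case
    using assms(1) [of x] coset_zero_iff [of "x \<otimes> x"] by (simp add: coset_mult quot_zero)
next
  case (2 X Y Z)
  then obtain x y z where "x \<in> carrier K" "X = I +> x" "y \<in> carrier K" "Y = I +> y"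
    "z \<in> carrier K" "Z = I +> z" by (auto simp: quot_carrier)
  then show ?case
    using assms(2) [of x y z] coset_zero_iff [of "x \<otimes> (y \<otimes> z) \<oplus> y \<otimes> (z \<otimes> x) \<oplus> z \<otimes> (x \<otimes> y)"]
    by (simp add: coset_mult coset_add quot_zero)
qed

lemma quot_lift:
  assumes "complex_module W" "f \<in> lin_maps K W" "\<And>x. x \<in> I \<Longrightarrow> f x = \<zero>\<^bsub>W\<^esub>"
  obtains g where "g \<in> lin_maps Q W" "\<And>a. a \<in> carrier K \<Longrightarrow> g (I +> a) = f a"
proof -
  interpret W: complex_module W by fact
  interpret complex_module_pair K W ..
  \<comment> \<open>Any representative will do: two of them differ by an element of
    \<open>I\<close>, where \<open>f\<close> vanishes.\<close>
  define g where "g A = f (SOME a. a \<in> A)" for A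
  have g: "g (I +> a) = f a" if a: "a \<in> carrier K" for a
  proof -
    have "(SOME x. x \<in> I +> a) \<in> I +> a"
      using coset_self [OF a] by (rule someI)
    then have "(SOME x. x \<in> I +> a) \<in> carrier K" "(SOME x. x \<in> I +> a) \<ominus> a \<in> I"
      using a by (auto simp: mem_coset)
    then show ?thesis
      using a assms(3) lin_maps_minus [OF assms(2)] W.minus_eq_zero_iff lin_maps_closed [OF assms(2)]
      by (metis g_def)
  qed
  show ?thesis
  proof
    show "g \<in> lin_maps Q W"
      using assms(2)
      by (auto simp: lin_maps_def quot_carrier coset_add coset_smult g Pi_def)
  qed (rule g)
qed

end

section \<open>Presentations\<close>

text \<open>Both sides are bilinear, so \<open>lin_maps_eqI\<close> applies to each argument in
  turn.\<close>

lemma lin_map_multI_span: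
  assumes K: "complex_algebra K" and L: "complex_algebra L" and f: "f \<in> lin_maps K L"
    and X: "X \<subseteq> carrier K" "carrier K \<subseteq> lin_span K X"
    and base: "\<And>x y. \<lbrakk>x \<in> X; y \<in> X\<rbrakk> \<Longrightarrow> f (x \<otimes>\<^bsub>K\<^esub> y) = f x \<otimes>\<^bsub>L\<^esub> f y"
    and xy: "x \<in> carrier K" "y \<in> carrier K"
  shows "f (x \<otimes>\<^bsub>K\<^esub> y) = f x \<otimes>\<^bsub>L\<^esub> f y"
proof -
  interpret K: complex_algebra K by fact
  interpret L: complex_algebra L by fact
  interpret complex_module_pair K L ..
  note f_closed = lin_maps_closed [OF f]
  show ?thesis
  proof (rule lin_maps_eqI [OF _ _ X, where x = y])
    show "(\<lambda>y. f (x \<otimes>\<^bsub>K\<^esub> y)) \<in> lin_maps K L"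
      by (rule lin_maps_comp [OF K.mult_lin_right [OF xy(1)] f])
    show "(\<lambda>y. f x \<otimes>\<^bsub>L\<^esub> f y) \<in> lin_maps K L"
      by (rule lin_maps_comp [OF f L.mult_lin_right [OF f_closed [OF xy(1)]]])
    fix y assume y: "y \<in> X"
    then have y': "y \<in> carrier K" using X by auto
    show "f (x \<otimes>\<^bsub>K\<^esub> y) = f x \<otimes>\<^bsub>L\<^esub> f y"
    proof (rule lin_maps_eqI [OF _ _ X, where x = x])
      show "(\<lambda>x. f (x \<otimes>\<^bsub>K\<^esub> y)) \<in> lin_maps K L"
        by (rule lin_maps_comp [OF K.mult_lin_left [OF y'] f])
      show "(\<lambda>x. f x \<otimes>\<^bsub>L\<^esub> f y) \<in> lin_maps K L"
        by (rule lin_maps_comp [OF f L.mult_lin_left [OF f_closed [OF y']]])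
    qed (use y xy base in auto)
  qed (use xy in auto)
qed

section \<open>The free nonassociative algebra, evaluation in an algebra, and the quotient by
  relations\<close>

lemma free_alg_sel [simp]:
  "f \<in> carrier free_alg \<longleftrightarrow> finite {t. f t \<noteq> 0}"
  "\<zero>\<^bsub>free_alg\<^esub> = (\<lambda>t. 0)"
  "f \<oplus>\<^bsub>free_alg\<^esub> g = (\<lambda>t. f t + g t)"
  "r \<odot>\<^bsub>free_alg\<^esub> f = (\<lambda>t. r * f t)"
  by (simp_all add: free_alg_def)

lemma free_alg_mult:
  "f \<otimes>\<^bsub>free_alg\<^esub> g = (\<lambda>t. case t of Gen x \<Rightarrow> 0 | Br u v \<Rightarrow> f u * g v)"
  by (simp add: free_alg_def)

lemma free_algebra: "complex_algebra free_alg"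
proof (rule complex_algebra.intro)
  have add: "finite {t. f t + g t \<noteq> 0}"
    if "finite {t. f t \<noteq> 0}" "finite {t. g t \<noteq> 0}" for f g :: "'x magma \<Rightarrow> complex"
    by (rule finite_subset [of _ "{t. f t \<noteq> 0} \<union> {t. g t \<noteq> 0}"]) (use that in auto)
  show "complex_module (free_alg :: ('x magma \<Rightarrow> complex) calg)"
    by (rule complex_moduleI) (auto simp: add algebra_simps)
  have mult: "finite {t. (case t of Gen x \<Rightarrow> 0 | Br u v \<Rightarrow> f u * g v) \<noteq> 0}"
    if "finite {t. f t \<noteq> 0}" "finite {t. g t \<noteq> 0}" for f g :: "'x magma \<Rightarrow> complex"
    by (rule finite_subset [of _ "(\<lambda>(u, v). Br u v) ` ({t. f t \<noteq> 0} \<times> {t. g t \<noteq> 0})"])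
      (use that in \<open>force split: magma.split_asm\<close>)+
  show "complex_algebra_axioms (free_alg :: ('x magma \<Rightarrow> complex) calg)"
    by (rule complex_algebra_axioms.intro)
      (auto simp: free_alg_mult mult fun_eq_iff algebra_simps split: magma.split)
qed

interpretation free_alg: complex_algebra free_alg
  by (rule free_algebra)

definition monomial :: "'x magma \<Rightarrow> 'x magma \<Rightarrow> complex" where
  "monomial t = (\<lambda>s. of_bool (s = t))"

lemma monomial_closed: "monomial t \<in> carrier free_alg"
  by (simp add: monomial_def)

lemma fgen_monomial: "fgen x = monomial (Gen x)"
  by (simp add: fgen_def monomial_def)

lemma fgen_closed: "fgen x \<in> carrier free_alg"
  unfolding fgen_monomial by (rule monomial_closed)

lemma monomial_Br: "monomial (Br u v) = monomial u \<otimes>\<^bsub>free_alg\<^esub> monomial v"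
  by (auto simp: monomial_def free_alg_mult fun_eq_iff split: magma.split)

lemma free_alg_span: "carrier free_alg \<subseteq> lin_span free_alg (range monomial)"
proof
  fix f :: "'x magma \<Rightarrow> complex" assume "f \<in> carrier free_alg"
  then have "finite {t. f t \<noteq> 0}" by simp
  have span: "submodule (lin_span free_alg (range (monomial :: 'x magma \<Rightarrow> _))) complex_ring free_alg"
    by (rule free_alg.submodule_lin_span) (use monomial_closed in auto)
  have "f \<in> lin_span free_alg (range monomial)" if "finite A" "{t. f t \<noteq> 0} \<subseteq> A"
    for A and f :: "'x magma \<Rightarrow> complex"
    using that
  proof (induction A arbitrary: f)
    case empty
    then have "f = \<zero>\<^bsub>free_alg\<^esub>" by auto
    then show ?case using free_alg.submodule_zero [OF span] by simp
  next
    case (insert a A)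
    have "f(a := 0) \<in> lin_span free_alg (range monomial)"
      using insert.prems by (intro insert.IH) auto
    moreover have "f a \<odot>\<^bsub>free_alg\<^esub> monomial a \<in> lin_span free_alg (range monomial)"
      by (intro free_alg.submodule_smult [OF span] subsetD [OF free_alg.lin_span_superset] rangeI)
    moreover have "f = f(a := 0) \<oplus>\<^bsub>free_alg\<^esub> f a \<odot>\<^bsub>free_alg\<^esub> monomial a"
      by (auto simp: fun_eq_iff monomial_def)
    ultimately show ?case using free_alg.submodule_add [OF span] by metis
  qed
  then show "f \<in> lin_span free_alg (range monomial)"
    using \<open>finite {t. f t \<noteq> 0}\<close> by blast
qed

primrec magma_eval :: "'v calg \<Rightarrow> ('x \<Rightarrow> 'v) \<Rightarrow> 'x magma \<Rightarrow> 'v" where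
  "magma_eval L h (Gen x) = h x"
| "magma_eval L h (Br u v) = magma_eval L h u \<otimes>\<^bsub>L\<^esub> magma_eval L h v"

definition free_eval :: "'v calg \<Rightarrow> ('x \<Rightarrow> 'v) \<Rightarrow> ('x magma \<Rightarrow> complex) \<Rightarrow> 'v" where
  "free_eval L h = lin_ext L (magma_eval L h)"

locale generator_map = complex_algebra L for L :: "'v calg" (structure) and h :: "'x \<Rightarrow> 'v" +
  assumes h_closed [simp]: "h x \<in> carrier L"
begin

lemma magma_eval_closed: "magma_eval L h t \<in> carrier L"
  by (induction t) auto

lemma free_eval_lin: "free_eval L h \<in> lin_maps free_alg L"
  by (auto simp: lin_maps_def free_eval_def lin_ext_closed lin_ext_add lin_ext_smult magma_eval_closed)

lemma free_eval_monomial: "free_eval L h (monomial t) = magma_eval L h t"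
  unfolding free_eval_def monomial_def by (rule lin_ext_of_bool) (rule magma_eval_closed)

lemma free_eval_fgen: "free_eval L h (fgen x) = h x"
  by (simp add: fgen_monomial free_eval_monomial)

text \<open>Monomials span, and the product of two monomials is again a monomial, evaluated by the
  recursion of \<open>magma_eval\<close>.\<close>

lemma free_eval_mult:
  assumes "f \<in> carrier free_alg" "g \<in> carrier free_alg"
  shows "free_eval L h (f \<otimes>\<^bsub>free_alg\<^esub> g) = free_eval L h f \<otimes> free_eval L h g"
proof (rule lin_map_multI_span [OF free_algebra complex_algebra_axioms free_eval_lin _ free_alg_span])
  fix x y :: "'x magma \<Rightarrow> complex" assume "x \<in> range monomial" "y \<in> range monomial"
  then show "free_eval L h (x \<otimes>\<^bsub>free_alg\<^esub> y) = free_eval L h x \<otimes> free_eval L h y"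
    by (auto simp: monomial_Br [symmetric] free_eval_monomial)
qed (use assms monomial_closed in auto)

sublocale free: complex_module_pair free_alg L ..

lemmas free_eval_simps =
  lin_maps_add [OF free_eval_lin] lin_maps_smult [OF free_eval_lin]
  free.lin_maps_zero [OF free_eval_lin] free.lin_maps_uminus [OF free_eval_lin]
  free.lin_maps_minus [OF free_eval_lin] free_eval_mult free_eval_fgen
  fgen_closed

end

lemma (in complex_algebra) gen_ideal_alg_ideal:
  assumes "X \<subseteq> carrier L"
  shows "alg_ideal L (gen_ideal L X)"
proof -
  let ?F = "{I. submodule I complex_ring L \<and>
    (\<forall>a\<in>carrier L. \<forall>x\<in>I. a \<otimes> x \<in> I \<and> x \<otimes> a \<in> I) \<and> X \<subseteq> I}"
  \<comment> \<open>The family is nonempty, without which its intersection would not lie in the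
    carrier.\<close>
  have carrier: "carrier L \<in> ?F"
    using assms carrier_is_submodule by auto
  show ?thesis
  proof (intro alg_ideal.intro alg_ideal_axioms.intro complex_algebra_axioms)
    show "submodule (gen_ideal L X) complex_ring L"
    proof (rule complex_submoduleI)
      show "gen_ideal L X \<subseteq> carrier L"
        using carrier unfolding gen_ideal_def by blast
    qed (auto simp: gen_ideal_def submodule_zero submodule_add submodule_smult)
  qed (auto simp: gen_ideal_def)
qed

lemma gen_ideal_superset: "X \<subseteq> gen_ideal L X"
  by (auto simp: gen_ideal_def)

lemma gen_ideal_minimal: "\<lbrakk>alg_ideal L I; X \<subseteq> I\<rbrakk> \<Longrightarrow> gen_ideal L X \<subseteq> I"
  unfolding gen_ideal_def
  by (auto dest: alg_ideal.submodule alg_ideal.ideal_left alg_ideal.ideal_right)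

locale presentation =
  fixes R :: "(('x magma \<Rightarrow> complex) \<times> ('x magma \<Rightarrow> complex)) set"
  assumes rels_closed: "R \<subseteq> carrier free_alg \<times> carrier free_alg"
begin

abbreviation P where "P \<equiv> lie_present R"

definition cls :: "('x magma \<Rightarrow> complex) \<Rightarrow> ('x magma \<Rightarrow> complex) set" where
  "cls f = rel_ideal R +>\<^bsub>free_alg\<^esub> f"

lemma rel_ideal: "alg_ideal free_alg (rel_ideal R)"
proof -
  have "lie_identities \<subseteq> carrier (free_alg :: ('x magma \<Rightarrow> complex) calg)"
    unfolding lie_identities_def
    by (safe intro!: free_alg.M.a_closed free_alg.mult_closed)
  then show ?thesis
    unfolding rel_ideal_def using rels_closed
    by (intro free_alg.gen_ideal_alg_ideal) (use free_alg.M.minus_closed in fastforce)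
qed

sublocale rel: alg_ideal free_alg "rel_ideal R"
  by (rule rel_ideal)

lemma lie_identities_rel_ideal: "lie_identities \<subseteq> rel_ideal R"
  unfolding rel_ideal_def using gen_ideal_superset by fast

lemma present_lie: "lie_algebra P"
  unfolding lie_present_def
proof (rule rel.quot_lie_algebra, goal_cases)
  case (1 x)
  then have "x \<otimes>\<^bsub>free_alg\<^esub> x \<in> lie_identities"
    unfolding lie_identities_def by blast
  then show ?case using lie_identities_rel_ideal by blast
next
  case (2 x y z)
  then have "x \<otimes>\<^bsub>free_alg\<^esub> (y \<otimes>\<^bsub>free_alg\<^esub> z) \<oplus>\<^bsub>free_alg\<^esub> y \<otimes>\<^bsub>free_alg\<^esub> (z \<otimes>\<^bsub>free_alg\<^esub> x)
    \<oplus>\<^bsub>free_alg\<^esub> z \<otimes>\<^bsub>free_alg\<^esub> (x \<otimes>\<^bsub>free_alg\<^esub> y) \<in> lie_identities"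
    unfolding lie_identities_def by blast
  then show ?case using lie_identities_rel_ideal by blast
qed

sublocale P: lie_algebra P
  by (rule present_lie)

lemma cls_lin: "cls \<in> lin_maps free_alg P"
  using rel.coset_lin by (simp add: cls_def [abs_def] lie_present_def)

lemma cls_mult:
  "\<lbrakk>f \<in> carrier free_alg; g \<in> carrier free_alg\<rbrakk> \<Longrightarrow> cls (f \<otimes>\<^bsub>free_alg\<^esub> g) = cls f \<otimes>\<^bsub>P\<^esub> cls g"
  by (simp add: cls_def lie_present_def rel.coset_mult)

lemma pgen_cls: "pgen R x = cls (fgen x)"
  by (simp add: cls_def pgen_def)

lemma pgen_closed: "pgen R x \<in> carrier P"
  unfolding pgen_cls by (rule lin_maps_closed [OF cls_lin fgen_closed])

lemma carrier_present: "carrier P = cls ` carrier free_alg"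
  by (simp add: lie_present_def rel.quot_carrier cls_def)

lemma cls_rel: "(l, r) \<in> R \<Longrightarrow> cls l = cls r"
proof -
  assume lr: "(l, r) \<in> R"
  then have "l \<ominus>\<^bsub>free_alg\<^esub> r \<in> rel_ideal R"
    unfolding rel_ideal_def using gen_ideal_superset by fast
  then show ?thesis
    using lr rels_closed unfolding cls_def by (subst rel.coset_eq) auto
qed

interpretation pair: complex_module_pair free_alg P ..

lemmas cls_simps =
  lin_maps_add [OF cls_lin] lin_maps_smult [OF cls_lin]
  pair.lin_maps_zero [OF cls_lin] pair.lin_maps_uminus [OF cls_lin]
  pair.lin_maps_minus [OF cls_lin] cls_mult pgen_cls [symmetric] fgen_closed

text \<open>The kernel of the evaluation map is an ideal. It contains the Lie identities because
  \<open>L\<close> is a Lie algebra and the relators by hypothesis, hence the whole relation ideal,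
  and evaluation descends to the quotient.\<close>

lemma present_lift:
  assumes L: "lie_algebra L" and h: "\<And>x. h x \<in> carrier L"
    and rel: "\<And>l r. (l, r) \<in> R \<Longrightarrow> free_eval L h l = free_eval L h r"
  obtains g where "g \<in> lin_maps P L"
    "\<And>x y. \<lbrakk>x \<in> carrier P; y \<in> carrier P\<rbrakk> \<Longrightarrow> g (x \<otimes>\<^bsub>P\<^esub> y) = g x \<otimes>\<^bsub>L\<^esub> g y"
    "\<And>x. g (pgen R x) = h x"
proof -
  interpret L: lie_algebra L by fact
  interpret generator_map L h
    by unfold_locales (rule h)
  let ?e = "free_eval L h" and ?I = "{f \<in> carrier free_alg. free_eval L h f = \<zero>\<^bsub>L\<^esub>}"
  note e_closed = lin_maps_closed [OF free_eval_lin]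
  have "alg_ideal free_alg ?I"
  proof (intro alg_ideal.intro alg_ideal_axioms.intro free_algebra)
    show "submodule ?I complex_ring free_alg"
      by (rule free_alg.complex_submoduleI)
        (auto simp: free_eval_simps simp del: free_alg_sel)
  qed (auto simp: free_eval_simps e_closed simp del: free_alg_sel)
  moreover have "lie_identities \<subseteq> ?I"
    unfolding lie_identities_def
    by (auto simp: free_eval_simps e_closed L.bracket_self L.jacobi simp del: free_alg_sel)
  moreover have "{l \<ominus>\<^bsub>free_alg\<^esub> r | l r. (l, r) \<in> R} \<subseteq> ?I"
  proof clarify
    fix l r assume lr: "(l, r) \<in> R"
    then have "l \<in> carrier free_alg" "r \<in> carrier free_alg" using rels_closed by auto
    then show "l \<ominus>\<^bsub>free_alg\<^esub> r \<in> carrier free_alg \<and> free_eval L h (l \<ominus>\<^bsub>free_alg\<^esub> r) = \<zero>\<^bsub>L\<^esub>"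
      using rel [OF lr]
      by (simp add: free_eval_simps L.minus_eq_zero_iff e_closed del: free_alg_sel)
  qed
  ultimately have "rel_ideal R \<subseteq> ?I"
    unfolding rel_ideal_def by (intro gen_ideal_minimal) auto
  then obtain g where g: "g \<in> lin_maps P L" "\<And>f. f \<in> carrier free_alg \<Longrightarrow> g (cls f) = ?e f"
    using rel.quot_lift [OF L.complex_module_axioms free_eval_lin]
    unfolding lie_present_def cls_def by blast
  show ?thesis
  proof
    fix x y assume "x \<in> carrier P" "y \<in> carrier P"
    then obtain f f' where "f \<in> carrier free_alg" "x = cls f" "f' \<in> carrier free_alg" "y = cls f'"
      by (auto simp: carrier_present simp del: free_alg_sel)
    then show "g (x \<otimes>\<^bsub>P\<^esub> y) = g x \<otimes>\<^bsub>L\<^esub> g y"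
      by (simp add: cls_mult [symmetric] g(2) free_eval_mult del: free_alg_sel)
  next
    show "g (pgen R x) = h x" for x
      by (simp add: pgen_cls g(2) fgen_closed free_eval_fgen del: free_alg_sel)
  qed (rule g)
qed

text \<open>Under the hypothesis the span of the generators is closed under the product, first with
  a generator on the right and then with any element of the span. Induction on the magma word puts
  the class of every monomial into it.\<close>

lemma present_span:
  assumes "\<And>x y. pgen R x \<otimes>\<^bsub>P\<^esub> pgen R y \<in> lin_span P (range (pgen R))"
  shows "carrier P \<subseteq> lin_span P (range (pgen R))"
proof -
  let ?M = "lin_span P (range (pgen R))"
  have sub: "range (pgen R) \<subseteq> carrier P"
    using pgen_closed by auto
  have M: "submodule ?M complex_ring P"
    using sub by (rule P.submodule_lin_span)
  note M_carrier = subsetD [OF P.submodule_subset [OF M]]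
  have base: "x \<otimes>\<^bsub>P\<^esub> pgen R y \<in> ?M" if "x \<in> ?M" for x y
    using that sub
    by (induction rule: P.lin_span_induct)
      (auto simp: pgen_closed P.mult_add_left P.mult_smult_left assms
        P.submodule_zero [OF M] P.submodule_add [OF M] P.submodule_smult [OF M])
  have mult: "x \<otimes>\<^bsub>P\<^esub> y \<in> ?M" if x: "x \<in> ?M" and "y \<in> ?M" for x y
    using that(2) sub
    by (induction rule: P.lin_span_induct)
      (auto simp: pgen_closed P.mult_add_right P.mult_smult_right base x M_carrier
        P.submodule_zero [OF M] P.submodule_add [OF M] P.submodule_smult [OF M])
  have mono: "cls (monomial t) \<in> ?M" for t
  proof (induction t)
    case (Gen x)
    then show ?case
      using P.lin_span_superset [of "range (pgen R)"]
      by (auto simp: fgen_monomial [symmetric] pgen_cls [symmetric])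
  next
    case (Br u v)
    then show ?case
      by (simp add: monomial_Br cls_mult monomial_closed mult del: free_alg_sel)
  qed
  show ?thesis
  proof
    fix x assume "x \<in> carrier P"
    then obtain f where f: "f \<in> carrier free_alg" "x = cls f" by (auto simp: carrier_present)
    then have "f \<in> lin_span free_alg (range monomial)" using free_alg_span by blast
    moreover have "range monomial \<subseteq> carrier free_alg" using monomial_closed by blast
    ultimately have "cls f \<in> ?M"
      by (induction rule: free_alg.lin_span_induct)
        (auto simp: cls_simps mono P.submodule_zero [OF M] P.submodule_add [OF M]
          P.submodule_smult [OF M] simp del: free_alg_sel)
    with f show "x \<in> ?M" by simp
  qed
qed

end

section \<open>The Lie algebra \<open>\<gg>\<^sub>S\<close>\<close>

text \<open>
  The arrows of the action groupoid for the translations by \<open>2\<alpha>\<close> are pairs \<open>(\<alpha>, \<beta>)\<close>, read as arrows from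
  \<open>\<beta> - \<alpha>\<close> to \<open>\<beta> + \<alpha>\<close>; the inverse of \<open>(\<alpha>, \<beta>)\<close> is \<open>(-\<alpha>, \<beta>)\<close>, and the composite of \<open>(\<alpha>, \<beta>)\<close> and \<open>(\<mu>, \<nu>)\<close>
  is \<open>(\<alpha> + \<mu>, \<alpha> + \<nu>)\<close>, defined if \<open>\<alpha> + \<mu> = \<beta> - \<nu>\<close>. In the groupoid algebra, \<open>d\<^bsup>\<alpha>,\<beta>\<^esup>\<close> is
  \<open>(-\<alpha>, \<beta>) - (\<alpha>, \<beta>)\<close>. In this form the four terms of the bracket only differ by signs.
\<close>

lemma (in complex_module) gS_bracket_normal_form:
  fixes X :: "'s::ab_group_add \<Rightarrow> 's \<Rightarrow> 'v"
  assumes X: "\<And>\<alpha> \<beta>. X \<alpha> \<beta> \<in> carrier V" "\<And>\<alpha> \<beta>. X (- \<alpha>) \<beta> = \<ominus> X \<alpha> \<beta>"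
  shows "of_bool (\<alpha> + \<mu> = \<nu> - \<beta>) \<odot> X (\<alpha> + \<mu>) (- \<alpha> + \<nu>)
       \<ominus> of_bool (\<alpha> + \<mu> = \<beta> - \<nu>) \<odot> X (\<alpha> + \<mu>) (\<alpha> + \<nu>)
       \<ominus> of_bool (\<alpha> - \<mu> = \<nu> - \<beta>) \<odot> X (\<alpha> - \<mu>) (\<nu> - \<alpha>)
       \<oplus> of_bool (\<alpha> - \<mu> = \<beta> - \<nu>) \<odot> X (\<alpha> - \<mu>) (\<alpha> + \<nu>) =
    (- of_bool (- \<alpha> + - \<mu> = \<beta> - \<nu>)) \<odot> X (- \<alpha> + - \<mu>) (- \<alpha> + \<nu>)
       \<oplus> (- of_bool (\<alpha> + \<mu> = \<beta> - \<nu>)) \<odot> X (\<alpha> + \<mu>) (\<alpha> + \<nu>)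
       \<oplus> of_bool (- \<alpha> + \<mu> = \<beta> - \<nu>) \<odot> X (- \<alpha> + \<mu>) (- \<alpha> + \<nu>)
       \<oplus> of_bool (\<alpha> + - \<mu> = \<beta> - \<nu>) \<odot> X (\<alpha> + - \<mu>) (\<alpha> + \<nu>)"
proof -
  have "X (- \<alpha> + - \<mu>) (- \<alpha> + \<nu>) = \<ominus> X (\<alpha> + \<mu>) (- \<alpha> + \<nu>)"
    "X (- \<alpha> + \<mu>) (- \<alpha> + \<nu>) = \<ominus> X (\<alpha> - \<mu>) (\<nu> - \<alpha>)"
    using X(2) [of "\<alpha> + \<mu>"] X(2) [of "\<alpha> - \<mu>"] by (simp_all add: algebra_simps)
  moreover have "- \<alpha> + - \<mu> = \<beta> - \<nu> \<longleftrightarrow> \<alpha> + \<mu> = \<nu> - \<beta>" "- \<alpha> + \<mu> = \<beta> - \<nu> \<longleftrightarrow> \<alpha> - \<mu> = \<nu> - \<beta>"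
    by (auto simp: algebra_simps)
  ultimately show ?thesis
    using X(1) by (simp add: minus_eq_smult uminus_eq_smult)
qed

lemma gS_rels_presentation: "presentation gS_rels"
proof
  show "gS_rels \<subseteq> carrier free_alg \<times> carrier (free_alg :: (('s::ab_group_add \<times> 's) magma \<Rightarrow> complex) calg)"
    unfolding gS_rels_def
    by (rule subsetI, elim UnE CollectE exE conjE; simp add: fgen_closed del: free_alg_sel)
qed

interpretation gS: presentation gS_rels
  rewrites "lie_present gS_rels = gS"
  by (rule gS_rels_presentation) (simp add: gS_def)

lemma gS_d_closed [simp]: "gS_d \<alpha> \<beta> \<in> carrier gS"
  unfolding gS_d_def by (rule gS.pgen_closed)

lemma gS_d_uminus: "gS_d (- \<alpha>) \<beta> = \<ominus>\<^bsub>gS\<^esub> gS_d \<alpha> \<beta>"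
proof -
  have "(fgen (- \<alpha>, \<beta>), \<ominus>\<^bsub>free_alg\<^esub> fgen (\<alpha>, \<beta>)) \<in> gS_rels"
    unfolding gS_rels_def by blast
  from gS.cls_rel [OF this] show ?thesis
    by (simp add: gS_d_def gS.cls_simps del: free_alg_sel)
qed

text \<open>The terms run over two signs \<epsilon>, \<delta>: each is -\<epsilon>\<delta> times d
  with indices \<epsilon>\<alpha> + \<delta>\<mu> and \<epsilon>\<alpha> + \<nu>, present if
  \<epsilon>\<alpha> + \<delta>\<mu> = \<beta> - \<nu>. So an identity for one composable pair of
  arrows can be used for all four terms.\<close>

lemma gS_d_mult:
  "gS_d \<alpha> \<beta> \<otimes>\<^bsub>gS\<^esub> gS_d \<mu> \<nu> =
    (- of_bool (- \<alpha> + - \<mu> = \<beta> - \<nu>)) \<odot>\<^bsub>gS\<^esub> gS_d (- \<alpha> + - \<mu>) (- \<alpha> + \<nu>)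
    \<oplus>\<^bsub>gS\<^esub> (- of_bool (\<alpha> + \<mu> = \<beta> - \<nu>)) \<odot>\<^bsub>gS\<^esub> gS_d (\<alpha> + \<mu>) (\<alpha> + \<nu>)
    \<oplus>\<^bsub>gS\<^esub> of_bool (- \<alpha> + \<mu> = \<beta> - \<nu>) \<odot>\<^bsub>gS\<^esub> gS_d (- \<alpha> + \<mu>) (- \<alpha> + \<nu>)
    \<oplus>\<^bsub>gS\<^esub> of_bool (\<alpha> + - \<mu> = \<beta> - \<nu>) \<odot>\<^bsub>gS\<^esub> gS_d (\<alpha> + - \<mu>) (\<alpha> + \<nu>)"
proof -
  have "(fgen (\<alpha>, \<beta>) \<otimes>\<^bsub>free_alg\<^esub> fgen (\<mu>, \<nu>),
       of_bool (\<alpha> + \<mu> = \<nu> - \<beta>) \<odot>\<^bsub>free_alg\<^esub> fgen (\<alpha> + \<mu>, - \<alpha> + \<nu>)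
       \<ominus>\<^bsub>free_alg\<^esub> of_bool (\<alpha> + \<mu> = \<beta> - \<nu>) \<odot>\<^bsub>free_alg\<^esub> fgen (\<alpha> + \<mu>, \<alpha> + \<nu>)
       \<ominus>\<^bsub>free_alg\<^esub> of_bool (\<alpha> - \<mu> = \<nu> - \<beta>) \<odot>\<^bsub>free_alg\<^esub> fgen (\<alpha> - \<mu>, \<nu> - \<alpha>)
       \<oplus>\<^bsub>free_alg\<^esub> of_bool (\<alpha> - \<mu> = \<beta> - \<nu>) \<odot>\<^bsub>free_alg\<^esub> fgen (\<alpha> - \<mu>, \<alpha> + \<nu>)) \<in> gS_rels"
    unfolding gS_rels_def by blast
  from gS.cls_rel [OF this] show ?thesis
    unfolding gS.P.gS_bracket_normal_form [of gS_d, OF gS_d_closed gS_d_uminus, symmetric]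
    by (simp add: gS.cls_simps gS_d_def del: free_alg_sel)
qed

lemma gS_d_range: "range (pgen gS_rels) = range (\<lambda>(\<alpha>, \<beta>). gS_d \<alpha> \<beta>)"
  by (auto simp: gS_d_def image_def)

lemma gS_span: "carrier gS \<subseteq> lin_span gS (range (\<lambda>(\<alpha>, \<beta>). gS_d \<alpha> \<beta>))"
proof -
  let ?X = "range (\<lambda>(\<alpha>, \<beta>). gS_d \<alpha> \<beta>)"
  have X: "?X \<subseteq> carrier gS" by auto
  have "gS_d \<alpha> \<beta> \<in> lin_span gS ?X" for \<alpha> \<beta> :: 'a
    using gS.P.lin_span_superset [of ?X] by auto
  then have "gS_d \<alpha> \<beta> \<otimes>\<^bsub>gS\<^esub> gS_d \<mu> \<nu> \<in> lin_span gS ?X" for \<alpha> \<beta> \<mu> \<nu> :: 'a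
    unfolding gS_d_mult
    by (intro gS.P.submodule_add gS.P.submodule_smult gS.P.submodule_lin_span X)
  then show ?thesis
    using gS.present_span unfolding gS_d_range [symmetric] by (auto simp: gS_d_def)
qed

lemma gS_gens_closed: "range (\<lambda>(\<alpha>, \<beta>). gS_d \<alpha> \<beta>) \<subseteq> carrier gS"
  by auto

section \<open>A representation of the groupoid algebra by operators, and coordinates on
  \<open>gS\<close>\<close>

definition op_alg :: "(('p \<Rightarrow> complex) \<Rightarrow> 'p \<Rightarrow> complex) calg" where
  "op_alg = \<lparr>carrier = {T. (\<forall>F G. T (\<lambda>p. F p + G p) = (\<lambda>p. T F p + T G p)) \<and>
       (\<forall>r F. T (\<lambda>p. r * F p) = (\<lambda>p. r * T F p))},
     mult = (\<lambda>S T F p. S (T F) p - T (S F) p), one = (\<lambda>F p. 0), zero = (\<lambda>F p. 0),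
     add = (\<lambda>S T F p. S F p + T F p), smult = (\<lambda>r T F p. r * T F p)\<rparr>"

lemma op_alg_sel [simp]:
  "T \<in> carrier op_alg \<longleftrightarrow> (\<forall>F G. T (\<lambda>p. F p + G p) = (\<lambda>p. T F p + T G p)) \<and>
     (\<forall>r F. T (\<lambda>p. r * F p) = (\<lambda>p. r * T F p))"
  "S \<otimes>\<^bsub>op_alg\<^esub> T = (\<lambda>F p. S (T F) p - T (S F) p)"
  "\<zero>\<^bsub>op_alg\<^esub> = (\<lambda>F p. 0)"
  "S \<oplus>\<^bsub>op_alg\<^esub> T = (\<lambda>F p. S F p + T F p)"
  "r \<odot>\<^bsub>op_alg\<^esub> T = (\<lambda>F p. r * T F p)"
  by (simp_all add: op_alg_def)

lemma op_alg_diff: "T \<in> carrier op_alg \<Longrightarrow> T (\<lambda>p. F p - G p) = (\<lambda>p. T F p - T G p)"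
proof -
  assume T: "T \<in> carrier op_alg"
  then have add: "T (\<lambda>p. F p + G p) = (\<lambda>p. T F p + T G p)"
    and smult: "T (\<lambda>p. r * F p) = (\<lambda>p. r * T F p)" for F G r
    by auto
  show ?thesis
    using add [of F "\<lambda>p. (- 1) * G p"] smult [of "- 1" G] by simp
qed

lemma op_alg_lie: "lie_algebra (op_alg :: (('p \<Rightarrow> complex) \<Rightarrow> 'p \<Rightarrow> complex) calg)"
proof -
  have "complex_module (op_alg :: (('p \<Rightarrow> complex) \<Rightarrow> 'p \<Rightarrow> complex) calg)"
    by (rule complex_moduleI) (auto simp: fun_eq_iff algebra_simps)
  then have "complex_algebra (op_alg :: (('p \<Rightarrow> complex) \<Rightarrow> 'p \<Rightarrow> complex) calg)"
    by (rule complex_algebra.intro, intro complex_algebra_axioms.intro)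
      (auto simp: algebra_simps intro!: ext)
  then show ?thesis
    by (rule complex_algebra.lie_algebraI)
      (simp, simp only: op_alg_sel(2-4) op_alg_diff, simp add: fun_eq_iff algebra_simps)
qed

text \<open>
  The arrow \<open>(\<alpha>, \<beta>)\<close> as an operator on the functions on \<open>S \<times> S\<close>. The second coordinate keeps apart arrows
  with the same source and target, which exist if \<open>S\<close> has an element of order 2.
\<close>

definition shift_op :: "'s::ab_group_add \<Rightarrow> 's \<Rightarrow> ('s \<times> 's \<Rightarrow> complex) \<Rightarrow> 's \<times> 's \<Rightarrow> complex" where
  "shift_op \<alpha> \<beta> F = (\<lambda>(y, \<sigma>). of_bool (y = \<alpha> + \<beta>) * F (y - (\<alpha> + \<alpha>), \<sigma> - \<alpha>))"

lemma shift_op_closed: "shift_op \<alpha> \<beta> \<in> carrier op_alg"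
  by (auto simp: shift_op_def fun_eq_iff algebra_simps)

text \<open>The outer operator lives at first coordinate \<alpha> + \<beta> and reads its argument
  at \<beta> - \<alpha>, whereas the inner one lives at \<mu> + \<nu>. A nonzero composite requires
  these to agree, which is composability.\<close>

lemma shift_op_shift_op:
  "shift_op \<alpha> \<beta> (shift_op \<mu> \<nu> F) p = of_bool (\<alpha> + \<mu> = \<beta> - \<nu>) * shift_op (\<alpha> + \<mu>) (\<alpha> + \<nu>) F p"
proof -
  obtain y \<sigma> where p: "p = (y, \<sigma>)" by fastforce
  show ?thesis
  proof (cases "\<beta> = \<alpha> + \<mu> + \<nu>")
    case True
    then show ?thesis by (auto simp: p shift_op_def algebra_simps)
  next
    case False
    then have "\<alpha> + \<mu> \<noteq> \<beta> - \<nu>" "\<not> (y = \<alpha> + \<beta> \<and> y - (\<alpha> + \<alpha>) = \<mu> + \<nu>)"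
      by (auto simp: algebra_simps)
    then show ?thesis by (auto simp: p shift_op_def)
  qed
qed

text \<open>Inversion reverses products: the inverse of the composite of (\<alpha>, \<beta>) and
  (\<mu>, \<nu>) is the composite of (-\<mu>, \<nu>) and (-\<alpha>, \<beta>). The second indices
  agree because \<beta> = \<alpha> + \<mu> + \<nu>.\<close>

lemma shift_op_inverse:
  "of_bool (\<alpha> + \<mu> = \<beta> - \<nu>) * shift_op (- (\<alpha> + \<mu>)) (\<alpha> + \<nu>) F p =
   of_bool (- \<mu> + - \<alpha> = \<nu> - \<beta>) * shift_op (- \<mu> + - \<alpha>) (- \<mu> + \<beta>) F p"
proof -
  have "\<alpha> + \<mu> = \<beta> - \<nu> \<longleftrightarrow> \<beta> = \<alpha> + \<mu> + \<nu>" "- \<mu> + - \<alpha> = \<nu> - \<beta> \<longleftrightarrow> \<beta> = \<alpha> + \<mu> + \<nu>"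
    by (auto simp: algebra_simps)
  then show ?thesis by (auto simp: algebra_simps)
qed

definition d_op :: "'s::ab_group_add \<times> 's \<Rightarrow> ('s \<times> 's \<Rightarrow> complex) \<Rightarrow> 's \<times> 's \<Rightarrow> complex" where
  "d_op = (\<lambda>(\<alpha>, \<beta>) F p. shift_op (- \<alpha>) \<beta> F p - shift_op \<alpha> \<beta> F p)"

lemma d_op_closed: "d_op x \<in> carrier op_alg"
  using shift_op_closed [of "- fst x" "snd x"] shift_op_closed [of "fst x" "snd x"]
  by (auto simp: d_op_def split_beta fun_eq_iff algebra_simps)


lemma d_op_uminus: "d_op (- \<alpha>, \<beta>) = \<ominus>\<^bsub>op_alg\<^esub> d_op (\<alpha>, \<beta>)"
proof -
  interpret op: lie_algebra "op_alg :: (('a \<times> 'a \<Rightarrow> complex) \<Rightarrow> 'a \<times> 'a \<Rightarrow> complex) calg"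
    by (rule op_alg_lie)
  show ?thesis
    unfolding op.uminus_eq_smult [OF d_op_closed] by (simp add: d_op_def)
qed

text \<open>Elements that inversion maps to their negatives are closed under commutators.
  Concretely, the commutator expands into eight composites, and each term on the right is one
  composite subtracted from its inverse, which is the composite of the inverses in the opposite
  order.\<close>

lemma d_op_mult:
  "d_op (\<alpha>, \<beta>) \<otimes>\<^bsub>op_alg\<^esub> d_op (\<mu>, \<nu>) =
    (- of_bool (- \<alpha> + - \<mu> = \<beta> - \<nu>)) \<odot>\<^bsub>op_alg\<^esub> d_op (- \<alpha> + - \<mu>, - \<alpha> + \<nu>)
    \<oplus>\<^bsub>op_alg\<^esub> (- of_bool (\<alpha> + \<mu> = \<beta> - \<nu>)) \<odot>\<^bsub>op_alg\<^esub> d_op (\<alpha> + \<mu>, \<alpha> + \<nu>)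
    \<oplus>\<^bsub>op_alg\<^esub> of_bool (- \<alpha> + \<mu> = \<beta> - \<nu>) \<odot>\<^bsub>op_alg\<^esub> d_op (- \<alpha> + \<mu>, - \<alpha> + \<nu>)
    \<oplus>\<^bsub>op_alg\<^esub> of_bool (\<alpha> + - \<mu> = \<beta> - \<nu>) \<odot>\<^bsub>op_alg\<^esub> d_op (\<alpha> + - \<mu>, \<alpha> + \<nu>)"
    (is "_ = ?r")
proof (intro ext)
  fix F :: "'a \<times> 'a \<Rightarrow> complex" and p
  note diff = op_alg_diff [OF shift_op_closed]
  have comp: "d_op (\<alpha>, \<beta>) (d_op (\<mu>, \<nu>) F) p =
      shift_op (- \<alpha>) \<beta> (shift_op (- \<mu>) \<nu> F) p - shift_op (- \<alpha>) \<beta> (shift_op \<mu> \<nu> F) p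
      - shift_op \<alpha> \<beta> (shift_op (- \<mu>) \<nu> F) p + shift_op \<alpha> \<beta> (shift_op \<mu> \<nu> F) p" for \<alpha> \<beta> \<mu> \<nu>
    by (simp add: d_op_def diff [abs_def])
  have product: "of_bool (\<alpha> + \<mu> = \<beta> - \<nu>) * d_op (\<alpha> + \<mu>, \<alpha> + \<nu>) F p =
      shift_op (- \<mu>) \<nu> (shift_op (- \<alpha>) \<beta> F) p - shift_op \<alpha> \<beta> (shift_op \<mu> \<nu> F) p" for \<alpha> \<beta> \<mu> \<nu>
    unfolding shift_op_shift_op shift_op_inverse [symmetric] by (simp add: d_op_def algebra_simps)
  have "?r F p = - (of_bool (- \<alpha> + - \<mu> = \<beta> - \<nu>) * d_op (- \<alpha> + - \<mu>, - \<alpha> + \<nu>) F p)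
    - of_bool (\<alpha> + \<mu> = \<beta> - \<nu>) * d_op (\<alpha> + \<mu>, \<alpha> + \<nu>) F p
    + of_bool (- \<alpha> + \<mu> = \<beta> - \<nu>) * d_op (- \<alpha> + \<mu>, - \<alpha> + \<nu>) F p
    + of_bool (\<alpha> + - \<mu> = \<beta> - \<nu>) * d_op (\<alpha> + - \<mu>, \<alpha> + \<nu>) F p"
    by simp
  also have "\<dots> = d_op (\<alpha>, \<beta>) (d_op (\<mu>, \<nu>) F) p - d_op (\<mu>, \<nu>) (d_op (\<alpha>, \<beta>) F) p"
    unfolding product comp minus_minus by simp
  finally show "(d_op (\<alpha>, \<beta>) \<otimes>\<^bsub>op_alg\<^esub> d_op (\<mu>, \<nu>)) F p = ?r F p"
    by simp
qed

text \<open>A matrix entry, from the point (\<beta> - \<alpha>, 0) to the point (\<alpha> + \<beta>,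
  \<alpha>). The second coordinate of the target reveals \<alpha> itself, where the first
  coordinates alone would only give 2\<alpha>.\<close>

definition op_coeff :: "(('s::ab_group_add \<times> 's \<Rightarrow> complex) \<Rightarrow> 's \<times> 's \<Rightarrow> complex) \<Rightarrow> 's \<times> 's \<Rightarrow> complex" where
  "op_coeff T = (\<lambda>(\<alpha>, \<beta>). T (\<lambda>q. of_bool (q = (\<beta> - \<alpha>, 0))) (\<alpha> + \<beta>, \<alpha>))"

lemma op_coeff_shift_op: "op_coeff (shift_op \<mu> \<nu>) = (\<lambda>p. of_bool (p = (\<mu>, \<nu>)))"
  by (auto simp: op_coeff_def shift_op_def fun_eq_iff algebra_simps)

text \<open>The generators are odd in \<alpha>, hence no basis. Rather than choosing one of \<alpha>
  and -\<alpha>, the coordinates are antisymmetrised; for 2\<alpha> = 0 the two terms cancel, as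
  they must since d vanishes there.\<close>

lemma gS_coordinates:
  obtains c :: "(('s::ab_group_add \<times> 's) magma \<Rightarrow> complex) set \<Rightarrow> 's \<times> 's \<Rightarrow> complex" where
    "\<And>x. x \<in> carrier gS \<Longrightarrow> finite {p. c x p \<noteq> 0}"
    "\<And>x y. \<lbrakk>x \<in> carrier gS; y \<in> carrier gS\<rbrakk> \<Longrightarrow> c (x \<oplus>\<^bsub>gS\<^esub> y) = (\<lambda>p. c x p + c y p)"
    "\<And>r x. x \<in> carrier gS \<Longrightarrow> c (r \<odot>\<^bsub>gS\<^esub> x) = (\<lambda>p. r * c x p)"
    "\<And>\<alpha> \<beta>. c (gS_d \<alpha> \<beta>) = (\<lambda>p. 1 / 2 * of_bool (p = (\<alpha>, \<beta>)) + - 1 / 2 * of_bool (p = (- \<alpha>, \<beta>)))"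
proof -
  interpret op: lie_algebra "op_alg :: (('s \<times> 's \<Rightarrow> complex) \<Rightarrow> 's \<times> 's \<Rightarrow> complex) calg"
    by (rule op_alg_lie)
  interpret generator_map "op_alg :: (('s \<times> 's \<Rightarrow> complex) \<Rightarrow> 's \<times> 's \<Rightarrow> complex) calg" d_op
    by unfold_locales (rule d_op_closed)
  have rel1: "free_eval op_alg d_op (fgen (- \<alpha>, \<beta>)) = free_eval op_alg d_op (\<ominus>\<^bsub>free_alg\<^esub> fgen (\<alpha>, \<beta>))"
    for \<alpha> \<beta> :: 's
    by (simp add: free_eval_simps d_op_uminus del: free_alg_sel op_alg_sel)
  have rel2: "free_eval op_alg d_op (fgen (\<alpha>, \<beta>) \<otimes>\<^bsub>free_alg\<^esub> fgen (\<mu>, \<nu>)) =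
       free_eval op_alg d_op (of_bool (\<alpha> + \<mu> = \<nu> - \<beta>) \<odot>\<^bsub>free_alg\<^esub> fgen (\<alpha> + \<mu>, - \<alpha> + \<nu>)
       \<ominus>\<^bsub>free_alg\<^esub> of_bool (\<alpha> + \<mu> = \<beta> - \<nu>) \<odot>\<^bsub>free_alg\<^esub> fgen (\<alpha> + \<mu>, \<alpha> + \<nu>)
       \<ominus>\<^bsub>free_alg\<^esub> of_bool (\<alpha> - \<mu> = \<nu> - \<beta>) \<odot>\<^bsub>free_alg\<^esub> fgen (\<alpha> - \<mu>, \<nu> - \<alpha>)
       \<oplus>\<^bsub>free_alg\<^esub> of_bool (\<alpha> - \<mu> = \<beta> - \<nu>) \<odot>\<^bsub>free_alg\<^esub> fgen (\<alpha> - \<mu>, \<alpha> + \<nu>))"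
    for \<alpha> \<beta> \<mu> \<nu> :: 's
    using d_op_mult [of \<alpha> \<beta> \<mu> \<nu>]
    unfolding op.gS_bracket_normal_form [of "\<lambda>\<alpha> \<beta>. d_op (\<alpha>, \<beta>)", OF d_op_closed d_op_uminus, symmetric]
    by (simp add: free_eval_simps del: free_alg_sel op_alg_sel)
  have "free_eval op_alg d_op l = free_eval op_alg d_op r" if "(l, r) \<in> gS_rels" for l r :: "('s \<times> 's) magma \<Rightarrow> complex"
    using that unfolding gS_rels_def by (elim UnE CollectE exE conjE Pair_inject) (simp_all only: rel1 rel2)
  then obtain \<phi> where \<phi>: "\<phi> \<in> lin_maps gS (op_alg :: (('s \<times> 's \<Rightarrow> complex) \<Rightarrow> 's \<times> 's \<Rightarrow> complex) calg)"
    "\<And>x. \<phi> (pgen gS_rels x) = d_op x"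
    using gS.present_lift [OF op_alg_lie, of d_op, OF d_op_closed] by metis
  \<comment> \<open>\<open>d_op\<close> is the inverse arrow minus the arrow. The sign restores the
    order, and the factor 1/2 makes the two halves add up to the given value of an odd family in
    \<open>gS_lin_lift\<close>.\<close>
  define c where "c x p = - 1 / 2 * op_coeff (\<phi> x) p" for x p
  have c_add: "c (x \<oplus>\<^bsub>gS\<^esub> y) = (\<lambda>p. c x p + c y p)" if "x \<in> carrier gS" "y \<in> carrier gS" for x y
    using lin_maps_add [OF \<phi>(1) that] by (auto simp: c_def op_coeff_def fun_eq_iff field_simps)
  have c_smult: "c (r \<odot>\<^bsub>gS\<^esub> x) = (\<lambda>p. r * c x p)" if "x \<in> carrier gS" for r x
    using lin_maps_smult [OF \<phi>(1) that] by (auto simp: c_def op_coeff_def fun_eq_iff field_simps)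
  have "op_coeff (d_op (\<alpha>, \<beta>)) p = op_coeff (shift_op (- \<alpha>) \<beta>) p - op_coeff (shift_op \<alpha> \<beta>) p"
    for \<alpha> \<beta> :: 's and p
    by (simp add: op_coeff_def d_op_def split_beta)
  then have c_d: "c (gS_d \<alpha> \<beta>) = (\<lambda>p. 1 / 2 * of_bool (p = (\<alpha>, \<beta>)) + - 1 / 2 * of_bool (p = (- \<alpha>, \<beta>)))"
    for \<alpha> \<beta>
    by (simp add: c_def [abs_def] \<phi>(2) gS_d_def op_coeff_shift_op fun_eq_iff)
  have "finite {p. c x p \<noteq> 0}" if "x \<in> carrier gS" for x
  proof -
    have "x \<in> lin_span gS (range (\<lambda>(\<alpha>, \<beta>). gS_d \<alpha> \<beta>))"
      using that gS_span by blast
    then show ?thesis using gS_gens_closed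
    proof (induction rule: gS.P.lin_span_induct)
      case zero
      show ?case using c_smult [of "\<zero>\<^bsub>gS\<^esub>" 0] by simp
    next
      case (add x y)
      then show ?case
        by (intro finite_subset [of "{p. c (x \<oplus>\<^bsub>gS\<^esub> y) p \<noteq> 0}" "{p. c x p \<noteq> 0} \<union> {p. c y p \<noteq> 0}"])
          (auto simp: c_add)
    next
      case (smult r x)
      then show ?case
        by (intro finite_subset [of "{p. c (r \<odot>\<^bsub>gS\<^esub> x) p \<noteq> 0}" "{p. c x p \<noteq> 0}"])
          (auto simp: c_smult)
    next
      case (base x)
      then obtain \<alpha> \<beta> where "x = gS_d \<alpha> \<beta>" by auto
      then show ?case
        by (intro finite_subset [of "{p. c x p \<noteq> 0}" "{(\<alpha>, \<beta>), (- \<alpha>, \<beta>)}"])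
          (auto simp: c_d)
    qed
  qed
  then show ?thesis using that c_add c_smult c_d by blast
qed

text \<open>Oddness in the first index is thus the only linear relation to be respected. The
  bilinear form, the translations by S and \<pi> are all built from this.\<close>

lemma gS_lin_lift:
  assumes "complex_module V" and X: "\<And>\<alpha> \<beta>. X \<alpha> \<beta> \<in> carrier V" "\<And>\<alpha> \<beta>. X (- \<alpha>) \<beta> = \<ominus>\<^bsub>V\<^esub> X \<alpha> \<beta>"
  obtains \<phi> where "\<phi> \<in> lin_maps gS V" "\<And>\<alpha> \<beta>. \<phi> (gS_d \<alpha> \<beta>) = X \<alpha> \<beta>"
proof -
  interpret V: complex_module V by fact
  obtain c :: "(('b \<times> 'b) magma \<Rightarrow> complex) set \<Rightarrow> 'b \<times> 'b \<Rightarrow> complex" where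
    c: "\<And>x. x \<in> carrier gS \<Longrightarrow> finite {p. c x p \<noteq> 0}"
    "\<And>x y. \<lbrakk>x \<in> carrier gS; y \<in> carrier gS\<rbrakk> \<Longrightarrow> c (x \<oplus>\<^bsub>gS\<^esub> y) = (\<lambda>p. c x p + c y p)"
    "\<And>r x. x \<in> carrier gS \<Longrightarrow> c (r \<odot>\<^bsub>gS\<^esub> x) = (\<lambda>p. r * c x p)"
    "\<And>\<alpha> \<beta>. c (gS_d \<alpha> \<beta>) = (\<lambda>p. 1 / 2 * of_bool (p = (\<alpha>, \<beta>)) + - 1 / 2 * of_bool (p = (- \<alpha>, \<beta>)))"
    using gS_coordinates by blast
  let ?X = "\<lambda>(\<alpha>, \<beta>). X \<alpha> \<beta>"
  have X': "?X p \<in> carrier V" for p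
    using X(1) by (simp add: split_beta)
  have fin: "finite {p. of_bool (p = q) \<noteq> (0 :: complex)}" "finite {p. r * of_bool (p = q) \<noteq> (0 :: complex)}"
    for q :: "'b \<times> 'b" and r
    by (auto intro: finite_subset [of _ "{q}"])
  show ?thesis
  proof
    show "(\<lambda>x. lin_ext V ?X (c x)) \<in> lin_maps gS V"
      using X' c(1) by (auto simp: lin_maps_def V.lin_ext_closed V.lin_ext_add V.lin_ext_smult c(2,3))
    show "lin_ext V ?X (c (gS_d \<alpha> \<beta>)) = X \<alpha> \<beta>" for \<alpha> \<beta>
    proof -
      have "lin_ext V ?X (c (gS_d \<alpha> \<beta>)) = (1 / 2) \<odot>\<^bsub>V\<^esub> X \<alpha> \<beta> \<oplus>\<^bsub>V\<^esub> (- 1 / 2) \<odot>\<^bsub>V\<^esub> X (- \<alpha>) \<beta>"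
        unfolding c(4) V.lin_ext_add [OF X' fin(2) fin(2)] V.lin_ext_smult [OF X' fin(1)]
          V.lin_ext_of_bool [of ?X, OF X'] by simp
      also have "\<dots> = X \<alpha> \<beta>"
        using X(1) by (simp add: X(2) V.uminus_eq_smult V.smult_add_left [symmetric])
      finally show ?thesis .
    qed
  qed
qed

lemma gS_induct [consumes 1, case_names zero add smult d]:
  assumes "x \<in> carrier gS" "P \<zero>\<^bsub>gS\<^esub>"
    and "\<And>x y. \<lbrakk>x \<in> carrier gS; y \<in> carrier gS; P x; P y\<rbrakk> \<Longrightarrow> P (x \<oplus>\<^bsub>gS\<^esub> y)"
    and "\<And>r x. \<lbrakk>x \<in> carrier gS; P x\<rbrakk> \<Longrightarrow> P (r \<odot>\<^bsub>gS\<^esub> x)"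
    and "\<And>\<alpha> \<beta>. P (gS_d \<alpha> \<beta>)"
  shows "P x"
proof -
  have "x \<in> lin_span gS (range (\<lambda>(\<alpha>, \<beta>). gS_d \<alpha> \<beta>))" using assms(1) gS_span by blast
  then show ?thesis using gS_gens_closed
    by (induction rule: gS.P.lin_span_induct) (use assms in auto)
qed

section \<open>The bilinear form on \<open>\<gg>\<^sub>S\<close>\<close>

text \<open>A target for \<open>gS_lin_lift\<close> when bilinear maps are wanted: a linear map into
  functions of the other argument.\<close>

definition fun_module :: "('i \<Rightarrow> complex) calg" where
  "fun_module = \<lparr>carrier = UNIV, mult = (\<lambda>f g i. 0), one = (\<lambda>i. 0), zero = (\<lambda>i. 0),
     add = (\<lambda>f g i. f i + g i), smult = (\<lambda>r f i. r * f i)\<rparr>"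

lemma fun_module_sel [simp]:
  "carrier fun_module = UNIV" "\<zero>\<^bsub>fun_module\<^esub> = (\<lambda>i. 0)"
  "f \<oplus>\<^bsub>fun_module\<^esub> g = (\<lambda>i. f i + g i)" "r \<odot>\<^bsub>fun_module\<^esub> f = (\<lambda>i. r * f i)"
  by (simp_all add: fun_module_def)

lemma fun_module: "complex_module fun_module"
  by (rule complex_moduleI) (auto simp: algebra_simps)

lemma fun_module_uminus [simp]: "\<ominus>\<^bsub>fun_module\<^esub> f = (\<lambda>i. - f i)"
  using complex_module.uminus_eq_smult [OF fun_module, of f] by simp

context
  fixes \<chi> :: "'s::ab_group_add \<Rightarrow> complex"
begin

text \<open>
  The trace of the product of two arrows, for the trace \<open>\<chi>(\<alpha>) \<delta>\<^bsub>2\<alpha>,0\<^esub>\<close> of the arrow \<open>(\<alpha>, \<beta>)\<close>. The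
  form on \<open>\<gg>\<^sub>S\<close> is half of the trace form.
\<close>

definition arrow_form :: "'s \<Rightarrow> 's \<Rightarrow> 's \<Rightarrow> 's \<Rightarrow> complex" where
  "arrow_form \<alpha> \<beta> \<mu> \<nu> =
    \<chi> (\<alpha> + \<mu>) * of_bool ((\<alpha> + \<mu>) + (\<alpha> + \<mu>) = 0) * of_bool (\<alpha> + \<mu> = \<beta> - \<nu>)"

text \<open>The trace of a product of two generators has four terms, which are equal in pairs by
  \<open>arrow_form_inverse\<close>. Halving it leaves one term of each pair.\<close>

definition d_form :: "'s \<Rightarrow> 's \<Rightarrow> 's \<Rightarrow> 's \<Rightarrow> complex" where
  "d_form \<alpha> \<beta> \<mu> \<nu> = arrow_form \<alpha> \<beta> \<mu> \<nu> - arrow_form \<alpha> \<beta> (- \<mu>) \<nu>"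

lemma two_torsion_iff: "x + x = 0 \<longleftrightarrow> - x = (x :: 's)"
  by (metis add.inverse_unique add.right_inverse)

text \<open>Nonzero values occur only if 2(\<alpha> + \<mu>) = 0, and then \<alpha> + \<mu> is its
  own negative.\<close>

lemma arrow_form_inverse: "arrow_form (- \<alpha>) \<beta> (- \<mu>) \<nu> = arrow_form \<alpha> \<beta> \<mu> \<nu>"
proof -
  have "- \<alpha> + - \<mu> = - (\<alpha> + \<mu>)" "- (\<alpha> + \<mu>) + - (\<alpha> + \<mu>) = - ((\<alpha> + \<mu>) + (\<alpha> + \<mu>))" by simp_all
  then show ?thesis
    unfolding arrow_form_def
    by (cases "(\<alpha> + \<mu>) + (\<alpha> + \<mu>) = 0") (simp_all only: two_torsion_iff neg_equal_0_iff_equal of_bool_eq mult_zero_left mult_zero_right simp_thms)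
qed

lemma arrow_form_commute: "arrow_form \<mu> \<nu> \<alpha> \<beta> = arrow_form \<alpha> \<beta> \<mu> \<nu>"
proof -
  have "\<alpha> + \<mu> = \<nu> - \<beta> \<longleftrightarrow> \<alpha> + \<mu> = \<beta> - \<nu>" if "- (\<alpha> + \<mu>) = \<alpha> + \<mu>"
    using that by (metis minus_diff_eq)
  then show ?thesis
    unfolding arrow_form_def by (auto simp: two_torsion_iff add.commute)
qed

text \<open>Both sides are the trace of the triple product of (\<alpha>, \<beta>), (\<mu>, \<nu>)
  and (\<rho>, \<sigma>), bracketed in the two ways.\<close>

lemma arrow_form_assoc:
  "of_bool (\<alpha> + \<mu> = \<beta> - \<nu>) * arrow_form (\<alpha> + \<mu>) (\<alpha> + \<nu>) \<rho> \<sigma> =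
   of_bool (\<mu> + \<rho> = \<nu> - \<sigma>) * arrow_form \<alpha> \<beta> (\<mu> + \<rho>) (\<mu> + \<sigma>)"
proof -
  have "\<alpha> + \<mu> = \<beta> - \<nu> \<longleftrightarrow> \<beta> = \<alpha> + \<mu> + \<nu>" "\<mu> + \<rho> = \<nu> - \<sigma> \<longleftrightarrow> \<nu> = \<mu> + \<rho> + \<sigma>"
    "\<alpha> + \<mu> + \<rho> = \<alpha> + \<nu> - \<sigma> \<longleftrightarrow> \<nu> = \<mu> + \<rho> + \<sigma>"
    by (auto simp: algebra_simps)
  moreover have "\<alpha> + (\<mu> + \<rho>) = \<beta> - (\<mu> + \<sigma>) \<longleftrightarrow> \<beta> = \<alpha> + \<mu> + \<nu>" if "\<nu> = \<mu> + \<rho> + \<sigma>"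
    using that by (auto simp: algebra_simps)
  ultimately show ?thesis
    unfolding arrow_form_def by (auto simp: add.assoc)
qed

lemma d_form_uminus_right: "d_form \<alpha> \<beta> (- \<mu>) \<nu> = - d_form \<alpha> \<beta> \<mu> \<nu>"
  by (simp add: d_form_def)

lemma d_form_commute: "d_form \<mu> \<nu> \<alpha> \<beta> = d_form \<alpha> \<beta> \<mu> \<nu>"
  using arrow_form_inverse [of "- \<mu>" \<nu> \<alpha> \<beta>]
  by (simp add: d_form_def arrow_form_commute [of \<mu>] arrow_form_commute [of "- \<mu>"])

lemma d_form_uminus_left: "d_form (- \<alpha>) \<beta> \<mu> \<nu> = - d_form \<alpha> \<beta> \<mu> \<nu>"
  using d_form_uminus_right [of \<mu> \<nu> \<alpha> \<beta>] by (simp add: d_form_commute [of \<mu>])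

text \<open>On the left, \<open>arrow_form_assoc\<close> moves the middle arrow to the other side.
  On the right, the sign change inside \<open>d_form\<close> is moved to its first argument. Both
  become the same eight traces of triple products.\<close>

lemma d_form_invariant:
  "- of_bool (- \<alpha> + - \<mu> = \<beta> - \<nu>) * d_form (- \<alpha> + - \<mu>) (- \<alpha> + \<nu>) \<rho> \<sigma>
    + - of_bool (\<alpha> + \<mu> = \<beta> - \<nu>) * d_form (\<alpha> + \<mu>) (\<alpha> + \<nu>) \<rho> \<sigma>
    + of_bool (- \<alpha> + \<mu> = \<beta> - \<nu>) * d_form (- \<alpha> + \<mu>) (- \<alpha> + \<nu>) \<rho> \<sigma>
    + of_bool (\<alpha> + - \<mu> = \<beta> - \<nu>) * d_form (\<alpha> + - \<mu>) (\<alpha> + \<nu>) \<rho> \<sigma> =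
   - of_bool (- \<mu> + - \<rho> = \<nu> - \<sigma>) * d_form \<alpha> \<beta> (- \<mu> + - \<rho>) (- \<mu> + \<sigma>)
    + - of_bool (\<mu> + \<rho> = \<nu> - \<sigma>) * d_form \<alpha> \<beta> (\<mu> + \<rho>) (\<mu> + \<sigma>)
    + of_bool (- \<mu> + \<rho> = \<nu> - \<sigma>) * d_form \<alpha> \<beta> (- \<mu> + \<rho>) (- \<mu> + \<sigma>)
    + of_bool (\<mu> + - \<rho> = \<nu> - \<sigma>) * d_form \<alpha> \<beta> (\<mu> + - \<rho>) (\<mu> + \<sigma>)"
proof -
  have l: "of_bool (\<alpha> + \<mu> = \<beta> - \<nu>) * d_form (\<alpha> + \<mu>) (\<alpha> + \<nu>) \<rho> \<sigma> =
      of_bool (\<mu> + \<rho> = \<nu> - \<sigma>) * arrow_form \<alpha> \<beta> (\<mu> + \<rho>) (\<mu> + \<sigma>)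
      - of_bool (\<mu> + - \<rho> = \<nu> - \<sigma>) * arrow_form \<alpha> \<beta> (\<mu> + - \<rho>) (\<mu> + \<sigma>)" for \<alpha> \<mu>
    unfolding d_form_def right_diff_distrib arrow_form_assoc ..
  have r: "d_form \<alpha> \<beta> \<mu> \<nu> = arrow_form \<alpha> \<beta> \<mu> \<nu> - arrow_form (- \<alpha>) \<beta> \<mu> \<nu>" for \<mu> \<nu>
    using arrow_form_inverse [of "- \<alpha>" \<beta> \<mu> \<nu>] by (simp add: d_form_def)
  show ?thesis
    unfolding mult_minus_left l by (simp add: r algebra_simps)
qed

text \<open>\<open>gS_lin_lift\<close> is used once per argument, with the oddness of
  \<open>d_form\<close> in the corresponding index. Symmetry and invariance are multilinear and thus
  follow from their validity on generators.\<close>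

lemma gS_form_exists: "\<exists>B. is_gS_form \<chi> B"
proof -
  obtain \<psi> :: "_ \<Rightarrow> 's \<times> 's \<Rightarrow> complex" where \<psi>: "\<psi> \<in> lin_maps gS fun_module"
    "\<And>\<alpha> \<beta>. \<psi> (gS_d \<alpha> \<beta>) = (\<lambda>(\<mu>, \<nu>). d_form \<mu> \<nu> \<alpha> \<beta>)"
  proof (rule gS_lin_lift [OF fun_module, of "\<lambda>\<alpha> \<beta> (\<mu>, \<nu>). d_form \<mu> \<nu> \<alpha> \<beta>"])
    show "(\<lambda>(\<mu>, \<nu>). d_form \<mu> \<nu> (- \<alpha>) \<beta>) = \<ominus>\<^bsub>fun_module\<^esub> (\<lambda>(\<mu>, \<nu>). d_form \<mu> \<nu> \<alpha> \<beta>)" for \<alpha> \<beta>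
      by (simp add: d_form_uminus_right fun_eq_iff)
  qed auto
  have \<psi>_add: "\<psi> (x \<oplus>\<^bsub>gS\<^esub> y) p = \<psi> x p + \<psi> y p" if "x \<in> carrier gS" "y \<in> carrier gS" for x y p
    using lin_maps_add [OF \<psi>(1) that] by simp
  have \<psi>_smult: "\<psi> (r \<odot>\<^bsub>gS\<^esub> x) p = r * \<psi> x p" if "x \<in> carrier gS" for x r p
    using lin_maps_smult [OF \<psi>(1) that] by simp
  have \<psi>_zero: "\<psi> \<zero>\<^bsub>gS\<^esub> p = 0" for p
    using \<psi>_smult [of "\<zero>\<^bsub>gS\<^esub>" 0] by simp
  have \<psi>_uminus: "\<psi> x (- \<alpha>, \<beta>) = - \<psi> x (\<alpha>, \<beta>)" if "x \<in> carrier gS" for x \<alpha> \<beta>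
    using that
    by (induction rule: gS_induct) (simp_all add: \<psi>_zero \<psi>_add \<psi>_smult \<psi>(2) d_form_uminus_left)
  \<comment> \<open>Oddness of \<open>\<psi> y\<close> in \<alpha> is only known for y in the
    carrier. The value 0 elsewhere makes the family odd as functions of all y.\<close>
  obtain B :: "_ \<Rightarrow> _ \<Rightarrow> complex" where B: "B \<in> lin_maps gS fun_module"
    "\<And>\<alpha> \<beta>. B (gS_d \<alpha> (\<beta> :: 's)) = (\<lambda>y. if y \<in> carrier gS then \<psi> y (\<alpha>, \<beta>) else 0)"
  proof (rule gS_lin_lift [OF fun_module, of "\<lambda>\<alpha> \<beta> y. if y \<in> carrier gS then \<psi> y (\<alpha>, \<beta>) else 0"])
    show "(\<lambda>y. if y \<in> carrier gS then \<psi> y (- \<alpha>, \<beta>) else 0) =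
      \<ominus>\<^bsub>fun_module\<^esub> (\<lambda>y. if y \<in> carrier gS then \<psi> y (\<alpha>, \<beta>) else 0)" for \<alpha> \<beta>
      by (auto simp: \<psi>_uminus fun_eq_iff)
  qed auto
  have B_add: "B (x \<oplus>\<^bsub>gS\<^esub> y) z = B x z + B y z" if "x \<in> carrier gS" "y \<in> carrier gS" for x y z
    using lin_maps_add [OF B(1) that] by simp
  have B_smult: "B (r \<odot>\<^bsub>gS\<^esub> x) z = r * B x z" if "x \<in> carrier gS" for x r z
    using lin_maps_smult [OF B(1) that] by simp
  have B_zero: "B \<zero>\<^bsub>gS\<^esub> z = 0" for z
    using B_smult [of "\<zero>\<^bsub>gS\<^esub>" 0] by simp
  have B_zero_right: "B x \<zero>\<^bsub>gS\<^esub> = 0" if "x \<in> carrier gS" for x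
    using that by (induction rule: gS_induct) (simp_all add: B_zero B_add B_smult B(2) \<psi>_zero)
  have B_add_right: "B x (y \<oplus>\<^bsub>gS\<^esub> z) = B x y + B x z"
    if "x \<in> carrier gS" "y \<in> carrier gS" "z \<in> carrier gS" for x y z
    using that(1)
    by (induction rule: gS_induct)
      (use that(2,3) in \<open>simp_all add: B_zero B_add B_smult B(2) \<psi>_add algebra_simps\<close>)
  have B_smult_right: "B x (r \<odot>\<^bsub>gS\<^esub> y) = r * B x y"
    if "x \<in> carrier gS" "y \<in> carrier gS" for x y r
    using that(1)
    by (induction rule: gS_induct)
      (use that(2) in \<open>simp_all add: B_zero B_add B_smult B(2) \<psi>_smult algebra_simps\<close>)
  note B_simps = B_zero B_add B_smult B_zero_right B_add_right B_smult_right
  have B_d: "B (gS_d \<alpha> \<beta>) (gS_d \<mu> \<nu>) = d_form \<alpha> \<beta> \<mu> \<nu>" for \<alpha> \<beta> \<mu> \<nu>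
    by (simp add: B(2) \<psi>(2))
  have sym: "B x y = B y x" if "x \<in> carrier gS" "y \<in> carrier gS" for x y
    using that(1)
  proof (induction rule: gS_induct)
    case (d \<alpha> \<beta>)
    show ?case
      using that(2)
      by (induction rule: gS_induct) (simp_all add: B_simps B_d d_form_commute [of \<alpha>])
  qed (use that(2) in \<open>simp_all add: B_simps\<close>)
  note mult_simps = gS.P.mult_add_left gS.P.mult_add_right gS.P.mult_smult_left gS.P.mult_smult_right
  have inv: "B (x \<otimes>\<^bsub>gS\<^esub> y) z = B x (y \<otimes>\<^bsub>gS\<^esub> z)"
    if "x \<in> carrier gS" "y \<in> carrier gS" "z \<in> carrier gS" for x y z
    using that(1)
  proof (induction rule: gS_induct)
    case (d \<alpha> \<beta>)
    show ?case
      using that(2)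
    proof (induction rule: gS_induct)
      case (d \<mu> \<nu>)
      show ?case
        using that(3)
      proof (induction rule: gS_induct)
        case (d \<rho> \<sigma>)
        show ?case
          using d_form_invariant [of \<alpha> \<mu> \<beta> \<nu> \<rho> \<sigma>]
          by (simp add: gS_d_mult B_simps B_d del: minus_add_distrib add_uminus_conv_diff uminus_add_conv_diff)
      qed (simp_all add: B_simps mult_simps)
    qed (use that(3) in \<open>simp_all add: B_simps mult_simps\<close>)
  qed (use that(2,3) in \<open>simp_all add: B_simps mult_simps\<close>)
  have "sym_inv_form gS B"
    unfolding sym_inv_form_def by (intro conjI ballI allI B_add B_smult sym inv)
  then have "is_gS_form \<chi> B"
    unfolding is_gS_form_def by (simp add: B_d d_form_def arrow_form_def)
  then show ?thesis by (rule exI [of "is_gS_form \<chi>"])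
qed

lemma gS_form: "is_gS_form \<chi> (gS_form \<chi>)"
  unfolding gS_form_def using gS_form_exists by (rule someI_ex)

end

section \<open>Affine Lie algebras\<close>

locale affine = lie_algebra L for L :: "'v calg" (structure) and B +
  assumes form: "sym_inv_form L B"
begin

abbreviation A where "A \<equiv> affine_alg L B"

text \<open>The central coordinate is included so that products of such elements are again of this
  form, which keeps iterated brackets computable.\<close>

definition single :: "'v \<Rightarrow> int \<Rightarrow> complex \<Rightarrow> (int \<Rightarrow> 'v) \<times> complex" where
  "single a n z = ((\<lambda>p. if p = n then a else \<zero>), z)"

lemma
  assumes "x \<in> carrier L" "y \<in> carrier L"
  shows form_add_left: "z \<in> carrier L \<Longrightarrow> B (x \<oplus> y) z = B x z + B y z"
    and form_smult_left: "B (r \<odot> x) y = r * B x y"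
    and form_commute: "B x y = B y x"
    and form_invariant: "z \<in> carrier L \<Longrightarrow> B (x \<otimes> y) z = B x (y \<otimes> z)"
  using form assms unfolding sym_inv_form_def by blast+

lemma form_add_right:
  "\<lbrakk>x \<in> carrier L; y \<in> carrier L; z \<in> carrier L\<rbrakk> \<Longrightarrow> B x (y \<oplus> z) = B x y + B x z"
  using form_commute [of x "y \<oplus> z"] form_add_left [of y z x] form_commute [of x y] form_commute [of x z]
  by simp

lemma form_smult_right: "\<lbrakk>x \<in> carrier L; y \<in> carrier L\<rbrakk> \<Longrightarrow> B x (r \<odot> y) = r * B x y"
  using form_commute [of x "r \<odot> y"] form_smult_left [of y x r] form_commute [of x y] by simp

lemma form_zero_left: "x \<in> carrier L \<Longrightarrow> B \<zero> x = 0"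
  using form_smult_left [of \<zero> x 0] by simp

lemma form_zero_right: "x \<in> carrier L \<Longrightarrow> B x \<zero> = 0"
  using form_smult_right [of x \<zero> 0] by simp

lemma affine_sel:
  "(f, y) \<in> carrier A \<longleftrightarrow> (\<forall>n. f n \<in> carrier L) \<and> finite {n. f n \<noteq> \<zero>}"
  "\<zero>\<^bsub>A\<^esub> = ((\<lambda>n. \<zero>), 0)"
  "(f, y) \<oplus>\<^bsub>A\<^esub> (g, z) = ((\<lambda>n. f n \<oplus> g n), y + z)"
  "r \<odot>\<^bsub>A\<^esub> (f, y) = ((\<lambda>n. r \<odot> f n), r * y)"
  by (auto simp: affine_alg_def)

lemma affine_add_closed:
  assumes "(f, y) \<in> carrier A" "(g, z) \<in> carrier A"
  shows "finite {n. f n \<oplus> g n \<noteq> \<zero>}"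
  by (rule finite_subset [of _ "{n. f n \<noteq> \<zero>} \<union> {n. g n \<noteq> \<zero>}"])
    (use assms in \<open>auto simp: affine_sel\<close>)

lemma affine_smult_closed:
  assumes "(f, y) \<in> carrier A"
  shows "finite {n. r \<odot> f n \<noteq> \<zero>}"
  by (rule finite_subset [of _ "{n. f n \<noteq> \<zero>}"]) (use assms in \<open>auto simp: affine_sel\<close>)

lemma affine_module: "complex_module A"
proof (rule complex_moduleI, goal_cases)
  case (1 x y)
  then show ?case
    using affine_add_closed by (cases x, cases y) (simp add: affine_sel)
next
  case (6 r x)
  then show ?case
    using affine_smult_closed by (cases x) (simp add: affine_sel)
qed (auto simp: affine_sel M.a_ac smult_add_left smult_add_right algebra_simps)

lemma affine_mult:
  assumes "(f, y) \<in> carrier A" "(g, z) \<in> carrier A" "finite S" "{m. f m \<noteq> \<zero>} \<subseteq> S"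
  shows "(f, y) \<otimes>\<^bsub>A\<^esub> (g, z) =
    ((\<lambda>p. \<Oplus>m\<in>S. f m \<otimes> g (p - m)), (\<Sum>m\<in>S. of_int m * B (f m) (g (- m))))"
proof -
  have fg: "f n \<in> carrier L" "g n \<in> carrier L" for n
    using assms(1,2) by (auto simp: affine_sel)
  have "(\<Oplus>m\<in>{m. f m \<noteq> \<zero>}. f m \<otimes> g (p - m)) = (\<Oplus>m\<in>S. f m \<otimes> g (p - m))" for p
    using assms(3,4) fg by (intro M.add.finprod_mono_neutral_cong_left) auto
  moreover have "(\<Sum>m | f m \<noteq> \<zero>. of_int m * B (f m) (g (- m))) = (\<Sum>m\<in>S. of_int m * B (f m) (g (- m)))"
    using assms(3,4) fg by (intro sum.mono_neutral_cong_left) (auto simp: form_zero_left)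
  ultimately show ?thesis
    by (simp add: affine_alg_def)
qed

lemma affine_mult_closed:
  assumes "x \<in> carrier A" "y \<in> carrier A"
  shows "x \<otimes>\<^bsub>A\<^esub> y \<in> carrier A"
proof -
  obtain f s g t where fg: "x = (f, s)" "y = (g, t)" by (metis surj_pair)
  let ?S = "{m. f m \<noteq> \<zero>}" and ?T = "{m. g m \<noteq> \<zero>}"
  have *: "f n \<in> carrier L" "g n \<in> carrier L" "finite ?S" "finite ?T" for n
    using assms by (auto simp: affine_sel fg)
  have vanish: "(\<Oplus>m\<in>?S. f m \<otimes> g (p - m)) = \<zero>" if "p \<notin> (\<lambda>(m, n). m + n) ` (?S \<times> ?T)" for p
  proof (rule M.add.finprod_one_eqI)
    fix m assume "m \<in> ?S"
    have "g (p - m) = \<zero>"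
    proof (rule ccontr)
      assume "g (p - m) \<noteq> \<zero>"
      with \<open>m \<in> ?S\<close> have "(\<lambda>(m, n). m + n) (m, p - m) \<in> (\<lambda>(m, n). m + n) ` (?S \<times> ?T)"
        by (intro imageI) simp
      with that show False by simp
    qed
    then show "f m \<otimes> g (p - m) = \<zero>" using * by simp
  qed
  have "finite {p. (\<Oplus>m\<in>?S. f m \<otimes> g (p - m)) \<noteq> \<zero>}"
  proof (rule finite_subset)
    show "{p. (\<Oplus>m\<in>?S. f m \<otimes> g (p - m)) \<noteq> \<zero>} \<subseteq> (\<lambda>(m, n). m + n) ` (?S \<times> ?T)"
      using vanish by blast
    show "finite ((\<lambda>(m, n). m + n) ` (?S \<times> ?T))"
      using * by simp
  qed
  then show ?thesis
    using *(1,2) affine_mult [OF assms [unfolded fg] *(3) subset_refl] by (simp add: affine_sel fg)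
qed

lemma affine_algebra: "complex_algebra A"
proof -
  interpret A: complex_module A by (rule affine_module)
  show ?thesis
  proof (rule complex_algebra.intro [OF affine_module], rule complex_algebra_axioms.intro)
    show "x \<otimes>\<^bsub>A\<^esub> y \<in> carrier A" if "x \<in> carrier A" "y \<in> carrier A" for x y
      using that by (rule affine_mult_closed)
  next
    fix x y z assume xyz: "x \<in> carrier A" "y \<in> carrier A" "z \<in> carrier A"
    obtain f s g t h u where fgh: "x = (f, s)" "y = (g, t)" "z = (h, u)" by (metis surj_pair)
    have c: "f n \<in> carrier L" "g n \<in> carrier L" "h n \<in> carrier L" for n
      using xyz by (auto simp: affine_sel fgh)
    let ?S = "{m. f m \<noteq> \<zero>} \<union> {m. g m \<noteq> \<zero>}"
    have S: "finite ?S" "{m. f m \<noteq> \<zero>} \<subseteq> ?S" "{m. g m \<noteq> \<zero>} \<subseteq> ?S" "{m. f m \<oplus> g m \<noteq> \<zero>} \<subseteq> ?S"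
      using xyz by (auto simp: affine_sel fgh)
    have sum: "(\<lambda>n. f n \<oplus> g n, s + t) \<in> carrier A" "(\<lambda>n. g n \<oplus> h n, t + u) \<in> carrier A"
      using xyz A.M.a_closed [of x y] A.M.a_closed [of y z] by (simp_all add: affine_sel(3) fgh)
    show "(x \<oplus>\<^bsub>A\<^esub> y) \<otimes>\<^bsub>A\<^esub> z = x \<otimes>\<^bsub>A\<^esub> z \<oplus>\<^bsub>A\<^esub> y \<otimes>\<^bsub>A\<^esub> z"
      using xyz S sum c unfolding fgh affine_sel(3)
      by (simp add: affine_mult [where S = ?S] affine_sel(3) mult_add_left form_add_left
          M.finsum_addf Pi_def sum.distrib distrib_left)
    show "x \<otimes>\<^bsub>A\<^esub> (y \<oplus>\<^bsub>A\<^esub> z) = x \<otimes>\<^bsub>A\<^esub> y \<oplus>\<^bsub>A\<^esub> x \<otimes>\<^bsub>A\<^esub> z"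
      using xyz S sum c unfolding fgh affine_sel(3)
      by (simp add: affine_mult [where S = ?S] affine_sel(3) mult_add_right form_add_right
          M.finsum_addf Pi_def sum.distrib distrib_left)
  next
    fix r x y assume xy: "x \<in> carrier A" "y \<in> carrier A"
    obtain f s g t where fg: "x = (f, s)" "y = (g, t)" by (metis surj_pair)
    have c: "f n \<in> carrier L" "g n \<in> carrier L" for n
      using xy by (auto simp: affine_sel fg)
    let ?S = "{m. f m \<noteq> \<zero>}"
    have S: "finite ?S" "{m. f m \<noteq> \<zero>} \<subseteq> ?S" "{m. r \<odot> f m \<noteq> \<zero>} \<subseteq> ?S"
      using xy by (auto simp: affine_sel fg)
    have sm: "(\<lambda>n. r \<odot> f n, r * s) \<in> carrier A" "(\<lambda>n. r \<odot> g n, r * t) \<in> carrier A"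
      using xy A.smult_closed' [of x r] A.smult_closed' [of y r] by (simp_all add: affine_sel(4) fg)
    show "(r \<odot>\<^bsub>A\<^esub> x) \<otimes>\<^bsub>A\<^esub> y = r \<odot>\<^bsub>A\<^esub> (x \<otimes>\<^bsub>A\<^esub> y)"
      using xy S sm c unfolding fg affine_sel(4)
      by (simp add: affine_mult [where S = ?S] affine_sel(4) mult_smult_left form_smult_left
          finsum_smult sum_distrib_left mult.left_commute)
    show "x \<otimes>\<^bsub>A\<^esub> (r \<odot>\<^bsub>A\<^esub> y) = r \<odot>\<^bsub>A\<^esub> (x \<otimes>\<^bsub>A\<^esub> y)"
      using xy S sm c unfolding fg affine_sel(4)
      by (simp add: affine_mult [where S = ?S] affine_sel(4) mult_smult_right form_smult_right
          finsum_smult sum_distrib_left mult.left_commute)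
  qed
qed

lemma single_closed: "a \<in> carrier L \<Longrightarrow> single a n z \<in> carrier A"
  by (auto simp: single_def affine_sel)

lemma single_mult:
  assumes "a \<in> carrier L" "b \<in> carrier L"
  shows "single a m y \<otimes>\<^bsub>A\<^esub> single b n z =
    single (a \<otimes> b) (m + n) (of_int m * of_bool (m + n = 0) * B a b)"
proof -
  have *: "single a m y \<in> carrier A" "single b n z \<in> carrier A"
    using assms by (auto intro: single_closed)
  have "p - m = n \<longleftrightarrow> p = m + n" "- m = n \<longleftrightarrow> m + n = 0" for p by auto
  then show ?thesis
    using * assms unfolding single_def
    by (subst affine_mult [of _ _ _ _ "{m}"]) (auto simp: form_zero_right fun_eq_iff)
qed

lemma single_add:
  assumes "a \<in> carrier L" "b \<in> carrier L"
  shows "single a n y \<oplus>\<^bsub>A\<^esub> single b n z = single (a \<oplus> b) n (y + z)"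
  by (auto simp: single_def affine_sel)

lemma single_smult: "r \<odot>\<^bsub>A\<^esub> single a n z = single (r \<odot> a) n (r * z)"
  by (auto simp: single_def affine_sel)

lemma single_zero: "single \<zero> n 0 = \<zero>\<^bsub>A\<^esub>"
  by (auto simp: single_def affine_sel)

lemma aff_mode_single: "aff_mode L a n = single a n 0"
  by (simp add: aff_mode_def single_def)

lemma aff_k_single: "aff_k L = single \<zero> n 1"
  by (simp add: aff_k_def single_def)

lemma single_eq:
  assumes "a \<in> carrier L"
  shows "single a n z = aff_mode L a n \<oplus>\<^bsub>A\<^esub> z \<odot>\<^bsub>A\<^esub> aff_k L"
  using assms by (auto simp: single_def aff_mode_def aff_k_def affine_sel)

lemma affine_span:
  assumes X: "X \<subseteq> carrier L" "carrier L \<subseteq> lin_span L X"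
  shows "carrier A \<subseteq> lin_span A (insert (aff_k L) {aff_mode L a n | a n. a \<in> X})"
proof -
  interpret A: complex_algebra A by (rule affine_algebra)
  let ?G = "insert (aff_k L) {aff_mode L a n | a n. a \<in> X}"
  have G: "?G \<subseteq> carrier A"
    using X(1) by (auto simp: aff_mode_single aff_k_single [of 0] intro!: single_closed)
  note M = A.submodule_lin_span [OF G]
  have mode: "aff_mode L a n \<in> lin_span A ?G" if "a \<in> carrier L" for a n
  proof -
    have "a \<in> lin_span L X" using that X by blast
    then show ?thesis using X(1)
    proof (induction rule: lin_span_induct)
      case zero
      show ?case
        using A.submodule_zero [OF M] by (simp add: aff_mode_single single_zero)
    next
      case (add x y)
      then show ?case
        using A.submodule_add [OF M, of "single x n 0" "single y n 0"]
        by (simp add: aff_mode_single single_add)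
    next
      case (smult r x)
      then show ?case
        using A.submodule_smult [OF M, of "single x n 0" r]
        by (simp add: aff_mode_single single_smult)
    next
      case (base x)
      then show ?case
        using A.lin_span_superset [of ?G] by blast
    qed
  qed
  have k: "z \<odot>\<^bsub>A\<^esub> aff_k L \<in> lin_span A ?G" for z
    using A.lin_span_superset [of ?G] by (intro A.submodule_smult [OF M]) blast
  have "(f, z) \<in> lin_span A ?G" if "finite S" "{n. f n \<noteq> \<zero>} \<subseteq> S" "\<And>n. f n \<in> carrier L" for f z S
    using that
  proof (induction S arbitrary: f z)
    case empty
    then have "(f, z) = z \<odot>\<^bsub>A\<^esub> aff_k L"
      by (auto simp: aff_k_def affine_sel)
    then show ?case using k by simp
  next
    case (insert n S)
    have 1: "(f(n := \<zero>), z) \<in> lin_span A ?G"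
      using insert.prems by (intro insert.IH) auto
    have 2: "(f, z) = (f(n := \<zero>), z) \<oplus>\<^bsub>A\<^esub> aff_mode L (f n) n"
      using insert.prems by (auto simp: aff_mode_def affine_sel)
    show ?case
      by (subst 2) (rule A.submodule_add [OF M 1 mode [OF insert.prems(2)]])
  qed
  then show ?thesis
    by (auto simp: affine_sel)
qed

lemma singles_closed: "{single a n z | a n z. a \<in> carrier L} \<subseteq> carrier A"
  by (auto intro: single_closed)

lemma affine_single_span: "carrier A \<subseteq> lin_span A {single a n z | a n z. a \<in> carrier L}"
proof -
  interpret A: complex_algebra A by (rule affine_algebra)
  let ?G = "{single a n z | a n z. a \<in> carrier L}"
  have "insert (aff_k L) {aff_mode L a n | a n. a \<in> carrier L} \<subseteq> ?G"
    by (auto simp: aff_mode_single aff_k_single [of 0])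
  then have "lin_span A (insert (aff_k L) {aff_mode L a n | a n. a \<in> carrier L}) \<subseteq> lin_span A ?G"
    using A.lin_span_superset [of ?G]
    by (intro A.lin_span_minimal A.submodule_lin_span singles_closed) blast
  moreover have "carrier A \<subseteq> lin_span A (insert (aff_k L) {aff_mode L a n | a n. a \<in> carrier L})"
    by (intro affine_span lin_span_superset) auto
  ultimately show ?thesis by blast
qed

lemma affine_lie: "lie_algebra A"
proof -
  interpret A: complex_algebra A by (rule affine_algebra)
  let ?G = "{single a n z | a n z. a \<in> carrier L}"
  show ?thesis
  proof (rule A.lie_algebraI_span [OF singles_closed affine_single_span])
    fix x y assume "x \<in> ?G" "y \<in> ?G"
    then obtain a m s b n t where ab: "x = single a m s" "a \<in> carrier L" "y = single b n t" "b \<in> carrier L"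
      by blast
    then have "of_int m * of_bool (m + n = 0) * B a b = - (of_int n * of_bool (n + m = 0) * B b a)"
      using form_commute [of a b] by (auto simp: add_eq_0_iff)
    then show "x \<otimes>\<^bsub>A\<^esub> y = \<ominus>\<^bsub>A\<^esub> (y \<otimes>\<^bsub>A\<^esub> x)"
      using ab mult_antisym [of a b]
      by (simp add: single_mult A.uminus_eq_smult single_closed single_smult add.commute [of n]
          uminus_eq_smult)
  next
    fix x y z assume "x \<in> ?G" "y \<in> ?G" "z \<in> ?G"
    then obtain a m s b n t c p u where abc: "x = single a m s" "a \<in> carrier L"
      "y = single b n t" "b \<in> carrier L" "z = single c p u" "c \<in> carrier L"
      by blast
    \<comment> \<open>By invariance and symmetry the form takes the same value \<open>r\<close> on
      all three cyclic rotations. The central terms therefore add up to (m + n + p) times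
      \<open>r\<close> where m + n + p = 0, and to 0 elsewhere.\<close>
    define q e r where "q = m + (n + p)" and "e = (of_bool (q = 0) :: complex)" and "r = B a (b \<otimes> c)"
    have B: "B b (c \<otimes> a) = r" "B c (a \<otimes> b) = r" "B a (b \<otimes> c) = r"
      using abc form_commute [of a "b \<otimes> c"] form_invariant [of b c a]
        form_commute [of c "a \<otimes> b"] form_invariant [of a b c] by (auto simp: r_def)
    have q: "m + (n + p) = q" "n + (p + m) = q" "p + (m + n) = q"
      by (auto simp: q_def)
    have "of_int m + of_int n + of_int p = (of_int q :: complex)"
      by (simp add: q_def)
    then have sum: "of_int m * e * r + of_int n * e * r + of_int p * e * r = 0"
      by (cases "q = 0") (simp_all add: e_def flip: distrib_right)
    have "x \<otimes>\<^bsub>A\<^esub> (y \<otimes>\<^bsub>A\<^esub> z) = single (a \<otimes> (b \<otimes> c)) q (of_int m * e * r)"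
      "y \<otimes>\<^bsub>A\<^esub> (z \<otimes>\<^bsub>A\<^esub> x) = single (b \<otimes> (c \<otimes> a)) q (of_int n * e * r)"
      "z \<otimes>\<^bsub>A\<^esub> (x \<otimes>\<^bsub>A\<^esub> y) = single (c \<otimes> (a \<otimes> b)) q (of_int p * e * r)"
      using abc(2,4,6) unfolding abc(1,3,5) by (simp_all only: single_mult mult_closed q B e_def)
    then show "x \<otimes>\<^bsub>A\<^esub> (y \<otimes>\<^bsub>A\<^esub> z) \<oplus>\<^bsub>A\<^esub> y \<otimes>\<^bsub>A\<^esub> (z \<otimes>\<^bsub>A\<^esub> x)
        \<oplus>\<^bsub>A\<^esub> z \<otimes>\<^bsub>A\<^esub> (x \<otimes>\<^bsub>A\<^esub> y) = \<zero>\<^bsub>A\<^esub>"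
      using abc(2,4,6) jacobi [of a b c] by (simp add: single_add sum single_zero)
  qed
qed

end

section \<open>Covariant algebras\<close>

locale covariant = lie_algebra K for K :: "'v calg" (structure) +
  fixes act :: "'g::group_add \<Rightarrow> 'v \<Rightarrow> 'v"
  assumes act_lin: "act g \<in> lin_maps K K"
    and act_mult: "\<lbrakk>x \<in> carrier K; y \<in> carrier K\<rbrakk> \<Longrightarrow> act g (x \<otimes> y) = act g x \<otimes> act g y"
    and act_0: "x \<in> carrier K \<Longrightarrow> act 0 x = x"
    and act_plus: "x \<in> carrier K \<Longrightarrow> act (g + h) x = act g (act h x)"
    and finite_support: "\<lbrakk>x \<in> carrier K; y \<in> carrier K\<rbrakk> \<Longrightarrow> finite {g. act g x \<otimes> y \<noteq> \<zero>}"
begin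

abbreviation cov where "cov \<equiv> cov_bracket K act"
abbreviation I where "I \<equiv> cov_ideal K act"
abbreviation K' where "K' \<equiv> K\<lparr>mult := cov\<rparr>"

lemma act_closed [simp]: "x \<in> carrier K \<Longrightarrow> act g x \<in> carrier K"
  by (rule lin_maps_closed [OF act_lin])

lemmas act_finsum = complex_module_pair.lin_maps_finsum [OF self_pair act_lin]

lemma act_inverse: "x \<in> carrier K \<Longrightarrow> act (- g) (act g x) = x"
  by (simp flip: act_plus add: act_0)

lemma act_eq_zero_iff: "x \<in> carrier K \<Longrightarrow> act g x = \<zero> \<longleftrightarrow> x = \<zero>"
  using act_inverse [of x g] complex_module_pair.lin_maps_zero [OF self_pair act_lin] by metis

lemma cov_superset:
  assumes "x \<in> carrier K" "y \<in> carrier K" "finite S" "{g. act g x \<otimes> y \<noteq> \<zero>} \<subseteq> S"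
  shows "cov x y = (\<Oplus>g\<in>S. act g x \<otimes> y)"
  unfolding cov_bracket_def using assms by (intro finsum_superset) auto

lemma cov_closed [simp]: "\<lbrakk>x \<in> carrier K; y \<in> carrier K\<rbrakk> \<Longrightarrow> cov x y \<in> carrier K"
  unfolding cov_bracket_def by (intro M.finsum_closed) auto

lemma cov_lin_right:
  assumes x: "x \<in> carrier K"
  shows "cov x \<in> lin_maps K K"
proof -
  have "cov x (y \<oplus> z) = cov x y \<oplus> cov x z" if "y \<in> carrier K" "z \<in> carrier K" for y z
  proof -
    let ?S = "{g. act g x \<otimes> y \<noteq> \<zero>} \<union> {g. act g x \<otimes> z \<noteq> \<zero>}"
    have "finite ?S" using that x finite_support by auto
    moreover have "{g. act g x \<otimes> (y \<oplus> z) \<noteq> \<zero>} \<subseteq> ?S"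
      using that x by (auto simp: mult_add_right)
    ultimately show ?thesis
      using that x by (simp add: cov_superset [where S = ?S] mult_add_right M.finsum_addf Pi_def)
  qed
  moreover have "cov x (r \<odot> y) = r \<odot> cov x y" if "y \<in> carrier K" for r y
  proof -
    let ?S = "{g. act g x \<otimes> y \<noteq> \<zero>}"
    have "finite ?S" using that x finite_support by auto
    moreover have "{g. act g x \<otimes> (r \<odot> y) \<noteq> \<zero>} \<subseteq> ?S"
      using that x by (auto simp: mult_smult_right)
    ultimately show ?thesis
      using that x by (simp add: cov_superset [where S = ?S] mult_smult_right finsum_smult)
  qed
  ultimately show ?thesis
    using x by (auto simp: lin_maps_def)
qed

lemma cov_lin_left:
  assumes y: "y \<in> carrier K"
  shows "(\<lambda>x. cov x y) \<in> lin_maps K K"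
proof -
  have "cov (x \<oplus> z) y = cov x y \<oplus> cov z y" if "x \<in> carrier K" "z \<in> carrier K" for x z
  proof -
    let ?S = "{g. act g x \<otimes> y \<noteq> \<zero>} \<union> {g. act g z \<otimes> y \<noteq> \<zero>}"
    have "finite ?S" using that y finite_support by auto
    moreover have "{g. act g (x \<oplus> z) \<otimes> y \<noteq> \<zero>} \<subseteq> ?S"
      using that y by (auto simp: mult_add_left lin_maps_add [OF act_lin])
    ultimately show ?thesis
      using that y by (simp add: cov_superset [where S = ?S] mult_add_left M.finsum_addf Pi_def
          lin_maps_add [OF act_lin])
  qed
  moreover have "cov (r \<odot> x) y = r \<odot> cov x y" if "x \<in> carrier K" for r x
  proof -
    let ?S = "{g. act g x \<otimes> y \<noteq> \<zero>}"
    have "finite ?S" using that y finite_support by auto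
    moreover have "{g. act g (r \<odot> x) \<otimes> y \<noteq> \<zero>} \<subseteq> ?S"
      using that y by (auto simp: mult_smult_left lin_maps_smult [OF act_lin])
    ultimately show ?thesis
      using that y by (simp add: cov_superset [where S = ?S] mult_smult_left finsum_smult
          lin_maps_smult [OF act_lin])
  qed
  ultimately show ?thesis
    using y by (auto simp: lin_maps_def)
qed

text \<open>The sum over the group is reindexed by a right translation. So the bracket vanishes
  exactly, not just modulo the ideal, when its left argument is a generator of the ideal.\<close>

lemma cov_act_left:
  assumes "x \<in> carrier K" "y \<in> carrier K"
  shows "cov (act h x) y = cov x y"
proof -
  let ?S = "{g. act g x \<otimes> y \<noteq> \<zero>}"
  have eq: "act g (act h x) = act (g + h) x" for g
    using assms by (simp add: act_plus)
  have "{g. act g (act h x) \<otimes> y \<noteq> \<zero>} \<subseteq> (\<lambda>g. g - h) ` ?S"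
    by (force simp: eq image_iff)
  then have "cov (act h x) y = (\<Oplus>g\<in>(\<lambda>g. g - h) ` ?S. act g (act h x) \<otimes> y)"
    using assms finite_support [OF assms] by (intro cov_superset) auto
  also have "\<dots> = (\<Oplus>g\<in>?S. act (g - h) (act h x) \<otimes> y)"
    using assms by (subst M.add.finprod_reindex) (auto simp: inj_on_def)
  also have "\<dots> = cov x y"
    unfolding eq cov_bracket_def by simp
  finally show ?thesis .
qed

text \<open>A left translation of the index, together with \<open>act h\<close> being an
  automorphism. Hence \<open>cov x\<close> commutes with the action, and so preserves the
  ideal.\<close>

lemma cov_act_right:
  assumes "x \<in> carrier K" "y \<in> carrier K"
  shows "cov x (act h y) = act h (cov x y)"
proof -
  let ?S = "{g. act g x \<otimes> y \<noteq> \<zero>}"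
  have eq: "act g x \<otimes> act h y = act h (act (- h + g) x \<otimes> y)" for g
    using assms by (simp add: act_mult add.assoc flip: act_plus)
  have "{g. act g x \<otimes> act h y \<noteq> \<zero>} \<subseteq> (\<lambda>g. h + g) ` ?S"
  proof
    fix g assume "g \<in> {g. act g x \<otimes> act h y \<noteq> \<zero>}"
    then have "- h + g \<in> ?S"
      using assms by (simp add: eq act_eq_zero_iff)
    then show "g \<in> (\<lambda>g. h + g) ` ?S"
      by (rule rev_image_eqI) (simp add: add.assoc [symmetric])
  qed
  then have "cov x (act h y) = (\<Oplus>g\<in>(\<lambda>g. h + g) ` ?S. act g x \<otimes> act h y)"
    using assms finite_support [OF assms] by (intro cov_superset) auto
  also have "\<dots> = (\<Oplus>g\<in>?S. act (h + g) x \<otimes> act h y)"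
    using assms by (subst M.add.finprod_reindex) (auto simp: inj_on_def)
  also have "\<dots> = (\<Oplus>g\<in>?S. act h (act g x \<otimes> y))"
    unfolding eq by (simp add: add.assoc [symmetric])
  also have "\<dots> = act h (cov x y)"
    using assms unfolding cov_bracket_def by (intro act_finsum [symmetric]) auto
  finally show ?thesis .
qed

text \<open>Bracketing with \<open>act g x\<close> is a derivation of the original bracket for every
  g, and so is their sum \<open>cov x\<close>; this is \<open>step\<close>. As \<open>cov x\<close>
  also commutes with the action, it can be applied to each summand
  \<open>act h y \<otimes> z\<close> of \<open>cov y z\<close>.\<close>

lemma cov_Leibniz:
  assumes x: "x \<in> carrier K" and y: "y \<in> carrier K" and z: "z \<in> carrier K"
  shows "cov x (cov y z) = cov (cov x y) z \<oplus> cov y (cov x z)"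
proof -
  note assms = x y z
  have step: "cov x (y \<otimes> z) = cov x y \<otimes> z \<oplus> y \<otimes> cov x z" if y: "y \<in> carrier K" for y
  proof -
    let ?S = "{g. act g x \<otimes> (y \<otimes> z) \<noteq> \<zero>} \<union> {g. act g x \<otimes> y \<noteq> \<zero>} \<union> {g. act g x \<otimes> z \<noteq> \<zero>}"
    have S: "finite ?S"
      using assms y finite_support by auto
    have deriv: "a \<otimes> (y \<otimes> z) = (a \<otimes> y) \<otimes> z \<oplus> y \<otimes> (a \<otimes> z)" if a: "a \<in> carrier K" for a
    proof -
      have "a \<otimes> (y \<otimes> z) \<oplus> (y \<otimes> (z \<otimes> a) \<oplus> z \<otimes> (a \<otimes> y)) = \<zero>"
        using jacobi [OF a y z] a y z by (simp add: M.a_assoc)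
      then have "a \<otimes> (y \<otimes> z) = \<ominus> (y \<otimes> (z \<otimes> a) \<oplus> z \<otimes> (a \<otimes> y))"
        using a y z by (intro M.minus_equality [symmetric]) auto
      also have "\<dots> = z \<otimes> (\<ominus> (a \<otimes> y)) \<oplus> y \<otimes> (\<ominus> (z \<otimes> a))"
        using a y z by (simp add: M.minus_add mult_uminus_right M.a_comm)
      also have "z \<otimes> (\<ominus> (a \<otimes> y)) = (a \<otimes> y) \<otimes> z"
        using a y z mult_antisym [of "a \<otimes> y" z] by (simp add: mult_uminus_right)
      also have "\<ominus> (z \<otimes> a) = a \<otimes> z"
        using a z mult_antisym [of a z] by simp
      finally show ?thesis .
    qed
    have "cov x (y \<otimes> z) = (\<Oplus>g\<in>?S. act g x \<otimes> (y \<otimes> z))"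
      using assms y S by (intro cov_superset) auto
    also have "\<dots> = (\<Oplus>g\<in>?S. (act g x \<otimes> y) \<otimes> z \<oplus> y \<otimes> (act g x \<otimes> z))"
      using x by (simp add: deriv)
    also have "\<dots> = (\<Oplus>g\<in>?S. (act g x \<otimes> y) \<otimes> z) \<oplus> (\<Oplus>g\<in>?S. y \<otimes> (act g x \<otimes> z))"
      using assms y by (intro M.finsum_addf) auto
    also have "\<dots> = (\<Oplus>g\<in>?S. act g x \<otimes> y) \<otimes> z \<oplus> y \<otimes> (\<Oplus>g\<in>?S. act g x \<otimes> z)"
      using assms y by (simp add: mult_finsum_left mult_finsum_right)
    also have "(\<Oplus>g\<in>?S. act g x \<otimes> y) = cov x y"
      using x y S by (intro cov_superset [symmetric]) auto
    also have "(\<Oplus>g\<in>?S. act g x \<otimes> z) = cov x z"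
      using x z S by (intro cov_superset [symmetric]) auto
    finally show ?thesis .
  qed
  let ?H = "{h. act h y \<otimes> z \<noteq> \<zero>} \<union> {h. act h (cov x y) \<otimes> z \<noteq> \<zero>} \<union> {h. act h y \<otimes> cov x z \<noteq> \<zero>}"
  have H: "finite ?H"
    using assms finite_support by auto
  have "cov y z = (\<Oplus>h\<in>?H. act h y \<otimes> z)"
    using y z H by (intro cov_superset) auto
  then have "cov x (cov y z) = cov x (\<Oplus>h\<in>?H. act h y \<otimes> z)"
    by (rule arg_cong)
  also have "\<dots> = (\<Oplus>h\<in>?H. cov x (act h y \<otimes> z))"
    using assms by (intro complex_module_pair.lin_maps_finsum [OF self_pair cov_lin_right]) auto
  also have "\<dots> = (\<Oplus>h\<in>?H. act h (cov x y) \<otimes> z \<oplus> act h y \<otimes> cov x z)"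
    using x y by (simp only: step cov_act_right act_closed)
  also have "\<dots> = (\<Oplus>h\<in>?H. act h (cov x y) \<otimes> z) \<oplus> (\<Oplus>h\<in>?H. act h y \<otimes> cov x z)"
    using assms by (intro M.finsum_addf) auto
  also have "(\<Oplus>h\<in>?H. act h (cov x y) \<otimes> z) = cov (cov x y) z"
    using x y z H by (intro cov_superset [symmetric]) auto
  also have "(\<Oplus>h\<in>?H. act h y \<otimes> cov x z) = cov y (cov x z)"
    using x y z H by (intro cov_superset [symmetric]) auto
  finally show ?thesis .
qed

lemma generators_closed: "{a \<ominus> act g a | a g. a \<in> carrier K} \<subseteq> carrier K"
  by auto

lemma cov_ideal_submodule: "submodule I complex_ring K"
  unfolding cov_ideal_def by (rule submodule_lin_span [OF generators_closed])

lemma minus_act_mem: "a \<in> carrier K \<Longrightarrow> a \<ominus> act g a \<in> I"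
  unfolding cov_ideal_def by (rule subsetD [OF lin_span_superset]) blast

lemma cov_ideal_induct [consumes 1, case_names zero add smult minus]:
  assumes "x \<in> I" "P \<zero>"
    and "\<And>x y. \<lbrakk>x \<in> carrier K; y \<in> carrier K; P x; P y\<rbrakk> \<Longrightarrow> P (x \<oplus> y)"
    and "\<And>r x. \<lbrakk>x \<in> carrier K; P x\<rbrakk> \<Longrightarrow> P (r \<odot> x)"
    and "\<And>a g. a \<in> carrier K \<Longrightarrow> P (a \<ominus> act g a)"
  shows "P x"
  using assms(1) [unfolded cov_ideal_def] generators_closed
  by (induction rule: lin_span_induct) (use assms in auto)

lemma cov_simps:
  "\<lbrakk>x \<in> carrier K; y \<in> carrier K; z \<in> carrier K\<rbrakk> \<Longrightarrow> cov x (y \<oplus> z) = cov x y \<oplus> cov x z"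
  "\<lbrakk>x \<in> carrier K; y \<in> carrier K; z \<in> carrier K\<rbrakk> \<Longrightarrow> cov (x \<oplus> y) z = cov x z \<oplus> cov y z"
  "\<lbrakk>x \<in> carrier K; y \<in> carrier K\<rbrakk> \<Longrightarrow> cov x (r \<odot> y) = r \<odot> cov x y"
  "\<lbrakk>x \<in> carrier K; y \<in> carrier K\<rbrakk> \<Longrightarrow> cov (r \<odot> x) y = r \<odot> cov x y"
  "\<lbrakk>x \<in> carrier K; y \<in> carrier K; z \<in> carrier K\<rbrakk> \<Longrightarrow> cov x (y \<ominus> z) = cov x y \<ominus> cov x z"
  "\<lbrakk>x \<in> carrier K; y \<in> carrier K; z \<in> carrier K\<rbrakk> \<Longrightarrow> cov (x \<ominus> y) z = cov x z \<ominus> cov y z"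
  "x \<in> carrier K \<Longrightarrow> cov x \<zero> = \<zero>"
  "x \<in> carrier K \<Longrightarrow> cov \<zero> x = \<zero>"
  using lin_maps_add [OF cov_lin_right] lin_maps_add [OF cov_lin_left] lin_maps_smult [OF cov_lin_right]
    lin_maps_smult [OF cov_lin_left] complex_module_pair.lin_maps_minus [OF self_pair cov_lin_right]
    complex_module_pair.lin_maps_minus [OF self_pair cov_lin_left]
    complex_module_pair.lin_maps_zero [OF self_pair cov_lin_right]
    complex_module_pair.lin_maps_zero [OF self_pair cov_lin_left] by simp_all

lemma cov_algebra: "complex_algebra K'"
proof (rule complex_algebra.intro)
  show "complex_module K'"
    by (rule complex_moduleI) (auto simp: M.a_ac smult_add_left smult_add_right)
  show "complex_algebra_axioms K'"
    by (rule complex_algebra_axioms.intro) (simp_all add: cov_simps)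
qed

lemma cov_alg_ideal: "alg_ideal K' I"
proof (intro alg_ideal.intro alg_ideal_axioms.intro cov_algebra)
  note sub = cov_ideal_submodule
  show "submodule I complex_ring K'"
    using sub unfolding submodule_def submodule_axioms_def by simp
  show "a \<otimes>\<^bsub>K'\<^esub> x \<in> I" if "a \<in> carrier K'" "x \<in> I" for a x
    using that(2)
  proof (induction rule: cov_ideal_induct)
    case (minus b g)
    then show ?case
      using that(1) by (simp add: cov_simps cov_act_right minus_act_mem)
  qed (use that(1) submodule_zero [OF sub] submodule_add [OF sub] submodule_smult [OF sub]
    in \<open>simp_all add: cov_simps\<close>)
  show "x \<otimes>\<^bsub>K'\<^esub> a \<in> I" if "a \<in> carrier K'" "x \<in> I" for a x
    using that(2)
  proof (induction rule: cov_ideal_induct)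
    case (minus b g)
    then show ?case
      using that(1) submodule_zero [OF sub]
      by (simp add: cov_simps cov_act_left minus_eq_zero_iff [THEN iffD2])
  qed (use that(1) submodule_zero [OF sub] submodule_add [OF sub] submodule_smult [OF sub]
    in \<open>simp_all add: cov_simps\<close>)
qed

sublocale cov_ideal: alg_ideal K' I
  by (rule cov_alg_ideal)

abbreviation Q where "Q \<equiv> cov_alg K act"

lemma cov_alg_eq: "quot_alg K' I = Q"
  by (simp add: cov_alg_def)

lemma coset_K': "I +>\<^bsub>K'\<^esub> a = I +> a"
  by (simp add: a_r_coset_def)

lemma lin_maps_K': "lin_maps K' W = lin_maps K W"
  by (simp add: lin_maps_def)

lemmas Q_carrier = cov_ideal.quot_carrier [unfolded cov_alg_eq coset_K', simplified]
lemmas Q_lin = cov_ideal.coset_lin [unfolded cov_alg_eq coset_K' lin_maps_K']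
lemmas Q_mult = cov_ideal.coset_mult [unfolded cov_alg_eq coset_K', simplified]
lemmas Q_lift = cov_ideal.quot_lift [unfolded cov_alg_eq coset_K' lin_maps_K', simplified]
lemmas Q_algebra = cov_ideal.quot_algebra [unfolded cov_alg_eq]
lemmas Q_eq = coset_eq_iff [OF cov_ideal_submodule]

lemma Q_act: "a \<in> carrier K \<Longrightarrow> I +> act g a = I +> a"
  by (rule sym) (simp add: Q_eq minus_act_mem)

text \<open>The summand \<open>act g x \<otimes> y\<close> is \<open>act g\<close> applied to minus
  \<open>act (- g) y \<otimes> x\<close>. The quotient forgets the outer \<open>act g\<close>, and g
  is replaced by -g in the sum.\<close>

lemma Q_antisym:
  assumes x: "x \<in> carrier K" and y: "y \<in> carrier K"
  shows "I +> cov x y = \<ominus>\<^bsub>Q\<^esub> (I +> cov y x)"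
proof -
  interpret Q: complex_algebra Q by (rule Q_algebra)
  interpret pair: complex_module_pair K Q ..
  let ?S = "{g. act g y \<otimes> x \<noteq> \<zero>}"
  have eq: "act g x \<otimes> y = act g (\<ominus> (act (- g) y \<otimes> x))" for g
  proof -
    have "act g x \<otimes> y = act g (x \<otimes> act (- g) y)"
      using x y by (simp add: act_mult act_0 flip: act_plus)
    also have "x \<otimes> act (- g) y = \<ominus> (act (- g) y \<otimes> x)"
      using x y by (intro mult_antisym) auto
    finally show ?thesis .
  qed
  have "{g. act g x \<otimes> y \<noteq> \<zero>} \<subseteq> uminus ` ?S"
  proof
    fix g assume "g \<in> {g. act g x \<otimes> y \<noteq> \<zero>}"
    then have "- g \<in> ?S"
      using x y by (auto simp: eq act_eq_zero_iff)
    then show "g \<in> uminus ` ?S"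
      by (rule rev_image_eqI) simp
  qed
  then have "cov x y = (\<Oplus>g\<in>uminus ` ?S. act g x \<otimes> y)"
    using finite_support [OF y x] x y by (intro cov_superset) auto
  also have "\<dots> = (\<Oplus>g\<in>?S. act (- g) x \<otimes> y)"
    using x y by (subst M.add.finprod_reindex) (auto simp: inj_on_def)
  also have "\<dots> = (\<Oplus>g\<in>?S. act (- g) (\<ominus> (act g y \<otimes> x)))"
    unfolding eq by simp
  finally have "I +> cov x y = (\<Oplus>\<^bsub>Q\<^esub>g\<in>?S. I +> act (- g) (\<ominus> (act g y \<otimes> x)))"
    using x y by (simp add: pair.lin_maps_finsum [OF Q_lin])
  also have "\<dots> = (\<Oplus>\<^bsub>Q\<^esub>g\<in>?S. I +> (\<ominus> (act g y \<otimes> x)))"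
    using x y by (simp add: Q_act)
  also have "\<dots> = I +> (\<Oplus>g\<in>?S. \<ominus> (act g y \<otimes> x))"
    using x y by (simp add: pair.lin_maps_finsum [OF Q_lin])
  also have "(\<Oplus>g\<in>?S. \<ominus> (act g y \<otimes> x)) = (- 1) \<odot> cov y x"
    unfolding cov_bracket_def using x y finite_support [OF y x]
    by (subst finsum_smult) (auto simp: uminus_eq_smult)
  finally show ?thesis
    using x y by (simp add: pair.lin_maps_uminus [OF Q_lin, symmetric] uminus_eq_smult)
qed

theorem cov_alg_lie: "lie_algebra Q"
proof -
  interpret Q: complex_algebra Q by (rule Q_algebra)
  interpret pair: complex_module_pair K Q ..
  have anti: "X \<otimes>\<^bsub>Q\<^esub> Y = \<ominus>\<^bsub>Q\<^esub> (Y \<otimes>\<^bsub>Q\<^esub> X)" if XY: "X \<in> carrier Q" "Y \<in> carrier Q" for X Y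
  proof -
    obtain x y where "x \<in> carrier K" "X = I +> x" "y \<in> carrier K" "Y = I +> y"
      using XY by (auto simp: Q_carrier)
    then show ?thesis
      using Q_antisym [of x y] by (simp only: Q_mult)
  qed
  have Leibniz: "X \<otimes>\<^bsub>Q\<^esub> (Y \<otimes>\<^bsub>Q\<^esub> Z) = (X \<otimes>\<^bsub>Q\<^esub> Y) \<otimes>\<^bsub>Q\<^esub> Z \<oplus>\<^bsub>Q\<^esub> Y \<otimes>\<^bsub>Q\<^esub> (X \<otimes>\<^bsub>Q\<^esub> Z)"
    if XYZ: "X \<in> carrier Q" "Y \<in> carrier Q" "Z \<in> carrier Q" for X Y Z
  proof -
    obtain x y z where "x \<in> carrier K" "X = I +> x" "y \<in> carrier K" "Y = I +> y"
      "z \<in> carrier K" "Z = I +> z"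
      using XYZ by (auto simp: Q_carrier)
    then show ?thesis
      using cov_Leibniz [of x y z] by (simp add: Q_mult lin_maps_add [OF Q_lin, symmetric])
  qed
  show ?thesis
  proof (rule Q.lie_algebraI)
    show "X \<otimes>\<^bsub>Q\<^esub> X = \<zero>\<^bsub>Q\<^esub>" if "X \<in> carrier Q" for X
      using Q.self_eq_uminus [OF _ anti] that by blast
    fix X Y Z assume XYZ: "X \<in> carrier Q" "Y \<in> carrier Q" "Z \<in> carrier Q"
    \<comment> \<open>By skew-symmetry, the two remaining cyclic terms are the negatives of the two
      summands of the Leibniz identity.\<close>
    have "Y \<otimes>\<^bsub>Q\<^esub> (Z \<otimes>\<^bsub>Q\<^esub> X) = \<ominus>\<^bsub>Q\<^esub> (Y \<otimes>\<^bsub>Q\<^esub> (X \<otimes>\<^bsub>Q\<^esub> Z))"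
      using XYZ anti [of Z X] by (simp add: Q.mult_uminus_right)
    moreover have "Z \<otimes>\<^bsub>Q\<^esub> (X \<otimes>\<^bsub>Q\<^esub> Y) = \<ominus>\<^bsub>Q\<^esub> ((X \<otimes>\<^bsub>Q\<^esub> Y) \<otimes>\<^bsub>Q\<^esub> Z)"
      using XYZ by (intro anti) auto
    moreover have "(a \<oplus>\<^bsub>Q\<^esub> b) \<oplus>\<^bsub>Q\<^esub> \<ominus>\<^bsub>Q\<^esub> b \<oplus>\<^bsub>Q\<^esub> \<ominus>\<^bsub>Q\<^esub> a = \<zero>\<^bsub>Q\<^esub>"
      if "a \<in> carrier Q" "b \<in> carrier Q" for a b
      using that by (simp add: Q.M.a_assoc Q.M.r_neg Q.M.r_neg2)
    ultimately show "X \<otimes>\<^bsub>Q\<^esub> (Y \<otimes>\<^bsub>Q\<^esub> Z) \<oplus>\<^bsub>Q\<^esub> Y \<otimes>\<^bsub>Q\<^esub> (Z \<otimes>\<^bsub>Q\<^esub> X) \<oplus>\<^bsub>Q\<^esub> Z \<otimes>\<^bsub>Q\<^esub> (X \<otimes>\<^bsub>Q\<^esub> Y) = \<zero>\<^bsub>Q\<^esub>"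
      using XYZ by (simp only: Leibniz [of X Y Z] Q.mult_closed)
  qed
qed

end

section \<open>The action of \<open>S\<close> on the affine Lie algebra of \<open>\<gg>\<^sub>S\<close>\<close>

locale character =
  fixes \<chi> :: "'s::ab_group_add \<Rightarrow> complex"
  assumes chi_nonzero [simp]: "\<chi> \<alpha> \<noteq> 0"
    and chi_add: "\<chi> (\<alpha> + \<beta>) = \<chi> \<alpha> * \<chi> \<beta>"
    and chi_inj: "inj \<chi>"
begin

lemma chi_0 [simp]: "\<chi> 0 = 1"
  using chi_add [of 0 0] chi_nonzero [of 0] by simp

lemma chi_uminus: "\<chi> (- \<alpha>) = inverse (\<chi> \<alpha>)"
  using chi_add [of \<alpha> "- \<alpha>"] by (simp add: inverse_unique)

lemma chi_diff: "\<chi> (\<alpha> - \<beta>) = \<chi> \<alpha> / \<chi> \<beta>"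
  using chi_add [of \<alpha> "- \<beta>"] by (simp add: chi_uminus divide_inverse)

lemma chi_zmult: "\<chi> (m \<cdot> \<alpha>) = \<chi> \<alpha> powi m"
proof -
  have "\<chi> ((((+) \<alpha>) ^^ k) 0) = \<chi> \<alpha> ^ k" for k
    by (induction k) (simp_all add: chi_add)
  then show ?thesis
    by (auto simp: zmult_def power_int_def chi_uminus power_inverse)
qed

sublocale hat: affine gS "gS_form \<chi>"
  rewrites "affine_alg gS (gS_form \<chi>) = gS_hat \<chi>"
proof -
  show "affine gS (gS_form \<chi>)"
    using gS_form [of \<chi>] gS.present_lie
    by (intro affine.intro affine_axioms.intro) (simp_all add: is_gS_form_def)
qed (simp add: gS_hat_def)

sublocale hat_alg: lie_algebra "gS_hat \<chi>"
  by (rule hat.affine_lie)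

lemma gS_form_d:
  "gS_form \<chi> (gS_d \<alpha> \<beta>) (gS_d \<mu> \<nu>) =
     \<chi> (\<alpha> + \<mu>) * of_bool ((\<alpha> + \<mu>) + (\<alpha> + \<mu>) = 0) * of_bool (\<alpha> + \<mu> = \<beta> - \<nu>)
     - \<chi> (\<alpha> - \<mu>) * of_bool ((\<alpha> - \<mu>) + (\<alpha> - \<mu>) = 0) * of_bool (\<alpha> - \<mu> = \<beta> - \<nu>)"
  using gS_form [of \<chi>] unfolding is_gS_form_def by blast

definition hat_gens :: "((int \<Rightarrow> (('s \<times> 's) magma \<Rightarrow> complex) set) \<times> complex) set" where
  "hat_gens = insert (aff_k gS) {d_mode \<alpha> \<beta> n | \<alpha> \<beta> n. True}"

lemma d_mode_closed [simp]: "d_mode \<alpha> \<beta> n \<in> carrier (gS_hat \<chi>)"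
  by (simp add: hat.aff_mode_single hat.single_closed)

lemma aff_k_closed [simp]: "aff_k gS \<in> carrier (gS_hat \<chi>)"
  by (simp add: hat.aff_k_single [of 0] hat.single_closed)

lemma hat_gens_closed: "hat_gens \<subseteq> carrier (gS_hat \<chi>)"
  by (auto simp: hat_gens_def)

lemma hat_span: "carrier (gS_hat \<chi>) \<subseteq> lin_span (gS_hat \<chi>) hat_gens"
proof -
  have "insert (aff_k gS) {aff_mode gS a n | a n. a \<in> range (\<lambda>(\<alpha>, \<beta>). gS_d \<alpha> \<beta>)} = hat_gens"
    by (auto simp: hat_gens_def)
  then show ?thesis
    using hat.affine_span [OF gS_gens_closed gS_span] by simp
qed

lemma hat_induct [consumes 1, case_names zero add smult k d]:
  assumes "x \<in> carrier (gS_hat \<chi>)" "P \<zero>\<^bsub>gS_hat \<chi>\<^esub>"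
    and "\<And>x y. \<lbrakk>x \<in> carrier (gS_hat \<chi>); y \<in> carrier (gS_hat \<chi>); P x; P y\<rbrakk> \<Longrightarrow> P (x \<oplus>\<^bsub>gS_hat \<chi>\<^esub> y)"
    and "\<And>r x. \<lbrakk>x \<in> carrier (gS_hat \<chi>); P x\<rbrakk> \<Longrightarrow> P (r \<odot>\<^bsub>gS_hat \<chi>\<^esub> x)"
    and "P (aff_k gS)" and "\<And>\<alpha> \<beta> n. P (d_mode \<alpha> \<beta> n)"
  shows "P x"
proof -
  have "x \<in> lin_span (gS_hat \<chi>) hat_gens"
    using assms(1) hat_span by blast
  then show ?thesis
    using hat_gens_closed
    by (induction rule: hat_alg.lin_span_induct) (use assms in \<open>auto simp: hat_gens_def\<close>)
qed

text \<open>The conditions in the bracket and in the form involve the second indices only through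
  \<beta> - \<nu>, and the second index of each term of the bracket moves along with \<nu>.\<close>

lemma gS_shift:
  fixes \<gamma> :: 's
  obtains \<sigma> where "\<sigma> \<in> lin_maps gS gS" "\<And>\<alpha> \<beta>. \<sigma> (gS_d \<alpha> \<beta>) = gS_d \<alpha> (\<beta> + \<gamma>)"
    "\<And>x y. \<lbrakk>x \<in> carrier gS; y \<in> carrier gS\<rbrakk> \<Longrightarrow> \<sigma> (x \<otimes>\<^bsub>gS\<^esub> y) = \<sigma> x \<otimes>\<^bsub>gS\<^esub> \<sigma> y"
    "\<And>x y. \<lbrakk>x \<in> carrier gS; y \<in> carrier gS\<rbrakk> \<Longrightarrow> gS_form \<chi> (\<sigma> x) (\<sigma> y) = gS_form \<chi> x y"
proof -
  obtain \<sigma> where \<sigma>: "\<sigma> \<in> lin_maps gS gS" "\<And>\<alpha> \<beta>. \<sigma> (gS_d \<alpha> \<beta>) = gS_d \<alpha> (\<beta> + \<gamma>)"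
    using gS_lin_lift [OF gS.P.complex_module_axioms, of "\<lambda>\<alpha> \<beta>. gS_d \<alpha> (\<beta> + \<gamma>)"]
      gS_d_closed gS_d_uminus by metis
  interpret complex_module_pair gS gS ..
  note \<sigma>_simps = lin_maps_add [OF \<sigma>(1)] lin_maps_smult [OF \<sigma>(1)] lin_maps_zero [OF \<sigma>(1)]
    lin_maps_closed [OF \<sigma>(1)] \<sigma>(2)
  have mult: "\<sigma> (x \<otimes>\<^bsub>gS\<^esub> y) = \<sigma> x \<otimes>\<^bsub>gS\<^esub> \<sigma> y" if "x \<in> carrier gS" "y \<in> carrier gS" for x y
  proof (rule lin_map_multI_span [OF gS.P.complex_algebra gS.P.complex_algebra \<sigma>(1) gS_gens_closed gS_span])
    fix x y assume "x \<in> range (\<lambda>(\<alpha>, \<beta>). gS_d \<alpha> (\<beta> :: 's))" "y \<in> range (\<lambda>(\<alpha>, \<beta>). gS_d \<alpha> (\<beta> :: 's))"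
    then obtain \<alpha> \<beta> \<mu> \<nu> where "x = gS_d \<alpha> \<beta>" "y = gS_d \<mu> \<nu>" by auto
    then show "\<sigma> (x \<otimes>\<^bsub>gS\<^esub> y) = \<sigma> x \<otimes>\<^bsub>gS\<^esub> \<sigma> y"
      by (simp only: gS_d_mult \<sigma>_simps add.assoc add_diff_cancel_right gS.P.smult_closed'
          gS.P.M.a_closed gS_d_closed)
  qed (use that in auto)
  note form_simps = hat.form_add_left hat.form_smult_left hat.form_add_right hat.form_smult_right
    hat.form_zero_left hat.form_zero_right
  have form: "gS_form \<chi> (\<sigma> x) (\<sigma> y) = gS_form \<chi> x y" if "x \<in> carrier gS" "y \<in> carrier gS" for x y
    using that(1)
  proof (induction rule: gS_induct)
    case (d \<alpha> \<beta>)
    show ?case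
      using that(2)
    proof (induction rule: gS_induct)
      case (d \<mu> \<nu>)
      show ?case by (simp add: \<sigma>_simps gS_form_d)
    qed (simp_all add: \<sigma>_simps form_simps)
  qed (use that(2) in \<open>simp_all add: \<sigma>_simps form_simps\<close>)
  show ?thesis using that \<sigma> mult form by blast
qed

text \<open>The translation of \<open>gS\<close> is applied to every mode, with the weight
  \<chi>(\<gamma>)^n on the n-th. The weights are multiplicative in n, so brackets are
  respected.\<close>

lemma gS_act_exists:
  "\<exists>\<phi>. \<phi> \<in> lie_iso (gS_hat \<chi>) (gS_hat \<chi>) \<and> \<phi> (aff_k gS) = aff_k gS \<and>
    (\<forall>\<alpha> \<beta> n. \<phi> (d_mode \<alpha> \<beta> n) = \<chi> \<gamma> powi n \<odot>\<^bsub>gS_hat \<chi>\<^esub> d_mode \<alpha> (\<beta> + \<gamma>) n)"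
proof -
  interpret gg: complex_module_pair gS gS ..
  interpret hh: complex_module_pair "gS_hat \<chi>" "gS_hat \<chi>" ..
  have "\<exists>\<phi>. \<phi> \<in> lin_maps (gS_hat \<chi>) (gS_hat \<chi>) \<and>
    (\<forall>x\<in>carrier (gS_hat \<chi>). \<forall>y\<in>carrier (gS_hat \<chi>).
      \<phi> (x \<otimes>\<^bsub>gS_hat \<chi>\<^esub> y) = \<phi> x \<otimes>\<^bsub>gS_hat \<chi>\<^esub> \<phi> y) \<and> \<phi> (aff_k gS) = aff_k gS \<and>
    (\<forall>\<alpha> \<beta> n. \<phi> (d_mode \<alpha> \<beta> n) = \<chi> \<gamma> powi n \<odot>\<^bsub>gS_hat \<chi>\<^esub> d_mode \<alpha> (\<beta> + \<gamma>) n)" for \<gamma>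
  proof -
    obtain \<sigma> where \<sigma>: "\<sigma> \<in> lin_maps gS gS" "\<And>\<alpha> \<beta>. \<sigma> (gS_d \<alpha> \<beta>) = gS_d \<alpha> (\<beta> + \<gamma>)"
      "\<And>x y. \<lbrakk>x \<in> carrier gS; y \<in> carrier gS\<rbrakk> \<Longrightarrow> \<sigma> (x \<otimes>\<^bsub>gS\<^esub> y) = \<sigma> x \<otimes>\<^bsub>gS\<^esub> \<sigma> y"
      "\<And>x y. \<lbrakk>x \<in> carrier gS; y \<in> carrier gS\<rbrakk> \<Longrightarrow> gS_form \<chi> (\<sigma> x) (\<sigma> y) = gS_form \<chi> x y"
      using gS_shift [of \<gamma>] by blast
    note \<sigma>_simps = lin_maps_add [OF \<sigma>(1)] lin_maps_smult [OF \<sigma>(1)] gg.lin_maps_zero [OF \<sigma>(1)]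
      lin_maps_closed [OF \<sigma>(1)] \<sigma>(2)
    define \<phi> where "\<phi> x = ((\<lambda>n. \<chi> \<gamma> powi n \<odot>\<^bsub>gS\<^esub> \<sigma> (fst x n)), snd x)"
      for x :: "(int \<Rightarrow> (('s \<times> 's) magma \<Rightarrow> complex) set) \<times> complex"
    have closed: "\<phi> x \<in> carrier (gS_hat \<chi>)" if x: "x \<in> carrier (gS_hat \<chi>)" for x
    proof -
      obtain f z where f: "x = (f, z)" by (cases x)
      have "finite {n. \<chi> \<gamma> powi n \<odot>\<^bsub>gS\<^esub> \<sigma> (f n) \<noteq> \<zero>\<^bsub>gS\<^esub>}"
        by (rule finite_subset [of _ "{n. f n \<noteq> \<zero>\<^bsub>gS\<^esub>}"])
          (use x in \<open>auto simp: f hat.affine_sel \<sigma>_simps\<close>)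
      then show ?thesis
        using x by (simp add: f \<phi>_def hat.affine_sel \<sigma>_simps)
    qed
    have lin: "\<phi> \<in> lin_maps (gS_hat \<chi>) (gS_hat \<chi>)"
      unfolding lin_maps_def
      by (auto simp: closed) (auto simp: \<phi>_def hat.affine_sel \<sigma>_simps gS.P.smult_add_right mult.commute)
    have single: "\<phi> (hat.single a n z) = hat.single (\<chi> \<gamma> powi n \<odot>\<^bsub>gS\<^esub> \<sigma> a) n z" for a n z
      by (auto simp: \<phi>_def hat.single_def \<sigma>_simps fun_eq_iff)
    have mult: "\<phi> (x \<otimes>\<^bsub>gS_hat \<chi>\<^esub> y) = \<phi> x \<otimes>\<^bsub>gS_hat \<chi>\<^esub> \<phi> y"
      if "x \<in> carrier (gS_hat \<chi>)" "y \<in> carrier (gS_hat \<chi>)" for x y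
    proof (rule lin_map_multI_span [OF hat_alg.complex_algebra hat_alg.complex_algebra lin
          hat.singles_closed hat.affine_single_span])
      fix x y assume "x \<in> {hat.single a n z | a n z. a \<in> carrier gS}"
        "y \<in> {hat.single a n z | a n z. a \<in> carrier gS}"
      then obtain a m s b n t where ab: "x = hat.single a m s" "a \<in> carrier gS"
        "y = hat.single b n t" "b \<in> carrier gS" by blast
      let ?c = "\<sigma> a \<otimes>\<^bsub>gS\<^esub> \<sigma> b"
      have 1: "\<phi> (x \<otimes>\<^bsub>gS_hat \<chi>\<^esub> y) = hat.single (\<chi> \<gamma> powi (m + n) \<odot>\<^bsub>gS\<^esub> ?c) (m + n)
          (of_int m * of_bool (m + n = 0) * gS_form \<chi> a b)"
        using ab by (simp add: hat.single_mult single \<sigma>(3))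
      have 2: "\<phi> x \<otimes>\<^bsub>gS_hat \<chi>\<^esub> \<phi> y = hat.single ((\<chi> \<gamma> powi n * \<chi> \<gamma> powi m) \<odot>\<^bsub>gS\<^esub> ?c) (m + n)
          (of_int m * of_bool (m + n = 0) * (\<chi> \<gamma> powi n * \<chi> \<gamma> powi m * gS_form \<chi> a b))"
        using ab by (simp add: hat.single_mult single \<sigma>_simps \<sigma>(4) gS.P.mult_smult_left
            gS.P.mult_smult_right hat.form_smult_left hat.form_smult_right mult.assoc)
      \<comment> \<open>The central term needs no weight: it occurs only for m + n = 0, where the
        weight is 1.\<close>
      have "\<chi> \<gamma> powi n * \<chi> \<gamma> powi m = \<chi> \<gamma> powi (m + n)"
        by (simp add: power_int_add)
      then show "\<phi> (x \<otimes>\<^bsub>gS_hat \<chi>\<^esub> y) = \<phi> x \<otimes>\<^bsub>gS_hat \<chi>\<^esub> \<phi> y"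
        unfolding 1 2 by (cases "m + n = 0") simp_all
    qed (use that in auto)
    have "\<phi> (aff_k gS) = aff_k gS"
      by (simp add: hat.aff_k_single [of 0] single \<sigma>_simps)
    moreover have "\<phi> (d_mode \<alpha> \<beta> n) = \<chi> \<gamma> powi n \<odot>\<^bsub>gS_hat \<chi>\<^esub> d_mode \<alpha> (\<beta> + \<gamma>) n" for \<alpha> \<beta> n
      by (simp add: hat.aff_mode_single single \<sigma>_simps hat.single_smult)
    ultimately show ?thesis using lin mult by blast
  qed
  \<comment> \<open>The maps are chosen for all \<gamma> at once, because bijectivity of
    \<open>\<phi> \<gamma>\<close> is shown with \<open>\<phi> (- \<gamma>)\<close> as its
    inverse.\<close>
  then obtain \<phi> where \<phi>: "\<And>\<gamma>. \<phi> \<gamma> \<in> lin_maps (gS_hat \<chi>) (gS_hat \<chi>)"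
    "\<And>\<gamma> x y. \<lbrakk>x \<in> carrier (gS_hat \<chi>); y \<in> carrier (gS_hat \<chi>)\<rbrakk> \<Longrightarrow>
      \<phi> \<gamma> (x \<otimes>\<^bsub>gS_hat \<chi>\<^esub> y) = \<phi> \<gamma> x \<otimes>\<^bsub>gS_hat \<chi>\<^esub> \<phi> \<gamma> y"
    "\<And>\<gamma>. \<phi> \<gamma> (aff_k gS) = aff_k gS"
    "\<And>\<gamma> \<alpha> \<beta> n. \<phi> \<gamma> (d_mode \<alpha> \<beta> n) = \<chi> \<gamma> powi n \<odot>\<^bsub>gS_hat \<chi>\<^esub> d_mode \<alpha> (\<beta> + \<gamma>) n"
    by metis
  have inverse: "\<phi> (- \<gamma>) (\<phi> \<gamma> x) = x" if "x \<in> carrier (gS_hat \<chi>)" for \<gamma> x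
  proof (rule hh.lin_maps_eqI [OF lin_maps_comp [OF \<phi>(1) \<phi>(1)] lin_maps_id hat_gens_closed hat_span _ that])
    fix x assume "x \<in> hat_gens"
    then show "\<phi> (- \<gamma>) (\<phi> \<gamma> x) = x"
      by (auto simp: hat_gens_def \<phi>(3,4) lin_maps_smult [OF \<phi>(1)] chi_uminus power_int_inverse)
  qed
  have "\<phi> \<gamma> \<in> lie_iso (gS_hat \<chi>) (gS_hat \<chi>)" for \<gamma>
  proof -
    have "bij_betw (\<phi> \<gamma>) (carrier (gS_hat \<chi>)) (carrier (gS_hat \<chi>))"
      by (rule bij_betw_byWitness [where f' = "\<phi> (- \<gamma>)"])
        (use inverse [of _ \<gamma>] inverse [of _ "- \<gamma>"] lin_maps_closed [OF \<phi>(1)] in auto)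
    then show ?thesis
      using \<phi>(1,2) hat_alg.lie_algebra_axioms by (simp add: lie_iso_def)
  qed
  then show ?thesis using \<phi>(3,4) by blast
qed

lemma
  shows gS_act_iso: "gS_act \<chi> \<gamma> \<in> lie_iso (gS_hat \<chi>) (gS_hat \<chi>)"
    and gS_act_k: "gS_act \<chi> \<gamma> (aff_k gS) = aff_k gS"
    and gS_act_d: "gS_act \<chi> \<gamma> (d_mode \<alpha> \<beta> n) = \<chi> \<gamma> powi n \<odot>\<^bsub>gS_hat \<chi>\<^esub> d_mode \<alpha> (\<beta> + \<gamma>) n"
  using someI_ex [OF gS_act_exists [of \<gamma>], folded gS_act_def] by blast+

lemma gS_act_lin: "gS_act \<chi> \<gamma> \<in> lin_maps (gS_hat \<chi>) (gS_hat \<chi>)"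
  using gS_act_iso [of \<gamma>] by (simp add: lie_iso_def)

lemma aff_k_mult:
  assumes "x \<in> carrier (gS_hat \<chi>)"
  shows "aff_k gS \<otimes>\<^bsub>gS_hat \<chi>\<^esub> x = \<zero>\<^bsub>gS_hat \<chi>\<^esub>"
  using assms
proof (induction rule: hat_induct)
  case k
  then show ?case by (rule hat_alg.bracket_self [OF aff_k_closed])
next
  case (d \<alpha> \<beta> n)
  then show ?case
    by (simp add: hat.aff_k_single [of 0] hat.aff_mode_single hat.single_mult hat.single_zero)
qed (simp_all add: hat_alg.mult_add_right hat_alg.mult_smult_right)

lemma mult_aff_k:
  assumes "x \<in> carrier (gS_hat \<chi>)"
  shows "x \<otimes>\<^bsub>gS_hat \<chi>\<^esub> aff_k gS = \<zero>\<^bsub>gS_hat \<chi>\<^esub>"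
  using hat_alg.mult_antisym [OF assms aff_k_closed] aff_k_mult [OF assms]
  by (simp add: hat_alg.uminus_eq_smult)

lemma gS_act_finite:
  assumes "x \<in> carrier (gS_hat \<chi>)" "y \<in> carrier (gS_hat \<chi>)"
  shows "finite {\<gamma>. gS_act \<chi> \<gamma> x \<otimes>\<^bsub>gS_hat \<chi>\<^esub> y \<noteq> \<zero>\<^bsub>gS_hat \<chi>\<^esub>}"
proof -
  let ?S = "\<lambda>x y. {\<gamma>. gS_act \<chi> \<gamma> x \<otimes>\<^bsub>gS_hat \<chi>\<^esub> y \<noteq> \<zero>\<^bsub>gS_hat \<chi>\<^esub>}"
  interpret hh: complex_module_pair "gS_hat \<chi>" "gS_hat \<chi>" ..
  note act_simps = lin_maps_add [OF gS_act_lin] lin_maps_smult [OF gS_act_lin]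
    hh.lin_maps_zero [OF gS_act_lin] lin_maps_closed [OF gS_act_lin] gS_act_k gS_act_d
  show ?thesis
    using assms(1)
  proof (induction rule: hat_induct)
    case zero
    then show ?case using assms(2) by (simp add: act_simps)
  next
    case (add x z)
    then have "?S (x \<oplus>\<^bsub>gS_hat \<chi>\<^esub> z) y \<subseteq> ?S x y \<union> ?S z y"
      using assms(2) by (auto simp: act_simps hat_alg.mult_add_left)
    then show ?case using add by (meson finite_Un finite_subset)
  next
    case (smult r x)
    then have "?S (r \<odot>\<^bsub>gS_hat \<chi>\<^esub> x) y \<subseteq> ?S x y"
      using assms(2) by (auto simp: act_simps hat_alg.mult_smult_left)
    then show ?case using smult by (meson finite_subset)
  next
    case k
    then show ?case using assms(2) by (simp add: act_simps aff_k_mult)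
  next
    case (d \<alpha> \<beta> m)
    show ?case
      using assms(2)
    proof (induction rule: hat_induct)
      case zero
      then show ?case by (simp add: act_simps)
    next
      case (add y z)
      then have "?S (d_mode \<alpha> \<beta> m) (y \<oplus>\<^bsub>gS_hat \<chi>\<^esub> z) \<subseteq> ?S (d_mode \<alpha> \<beta> m) y \<union> ?S (d_mode \<alpha> \<beta> m) z"
        by (auto simp: act_simps hat_alg.mult_add_right)
      then show ?case using add by (meson finite_Un finite_subset)
    next
      case (smult r y)
      then have "?S (d_mode \<alpha> \<beta> m) (r \<odot>\<^bsub>gS_hat \<chi>\<^esub> y) \<subseteq> ?S (d_mode \<alpha> \<beta> m) y"
        by (auto simp: act_simps hat_alg.mult_smult_right)
      then show ?case using smult by (meson finite_subset)
    next
      case k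
      then show ?case by (simp add: act_simps mult_aff_k)
    next
      case (d \<mu> \<nu> n)
      \<comment> \<open>The solutions \<gamma> of the four composability conditions with \<beta> +
        \<gamma> in place of \<beta>. The central term obeys two of the same conditions.\<close>
      let ?F = "{\<nu> - \<beta> - \<alpha> - \<mu>, \<nu> - \<beta> + \<alpha> + \<mu>, \<nu> - \<beta> - \<alpha> + \<mu>, \<nu> - \<beta> + \<alpha> - \<mu>}"
      have "?S (d_mode \<alpha> \<beta> m) (d_mode \<mu> \<nu> n) \<subseteq> ?F"
      proof (rule subsetI, rule ccontr)
        fix \<gamma> assume "\<gamma> \<in> ?S (d_mode \<alpha> \<beta> m) (d_mode \<mu> \<nu> n)" "\<gamma> \<notin> ?F"
        then have "- \<alpha> + - \<mu> \<noteq> (\<beta> + \<gamma>) - \<nu>" "\<alpha> + \<mu> \<noteq> (\<beta> + \<gamma>) - \<nu>"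
          "- \<alpha> + \<mu> \<noteq> (\<beta> + \<gamma>) - \<nu>" "\<alpha> + - \<mu> \<noteq> (\<beta> + \<gamma>) - \<nu>"
          by (auto simp: algebra_simps)
        then have "d_mode \<alpha> (\<beta> + \<gamma>) m \<otimes>\<^bsub>gS_hat \<chi>\<^esub> d_mode \<mu> \<nu> n = \<zero>\<^bsub>gS_hat \<chi>\<^esub>"
          by (simp add: hat.aff_mode_single hat.single_mult gS_d_mult gS_form_d hat.single_zero)
        then show False
          using \<open>\<gamma> \<in> ?S (d_mode \<alpha> \<beta> m) (d_mode \<mu> \<nu> n)\<close> by (simp add: act_simps hat_alg.mult_smult_left)
      qed
      then show ?case by (rule finite_subset) simp
    qed
  qed
qed

sublocale cov: covariant "gS_hat \<chi>" "gS_act \<chi>"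
proof
  interpret hh: complex_module_pair "gS_hat \<chi>" "gS_hat \<chi>" ..
  show "gS_act \<chi> \<gamma> \<in> lin_maps (gS_hat \<chi>) (gS_hat \<chi>)" for \<gamma>
    by (rule gS_act_lin)
  show "gS_act \<chi> \<gamma> (x \<otimes>\<^bsub>gS_hat \<chi>\<^esub> y) = gS_act \<chi> \<gamma> x \<otimes>\<^bsub>gS_hat \<chi>\<^esub> gS_act \<chi> \<gamma> y"
    if "x \<in> carrier (gS_hat \<chi>)" "y \<in> carrier (gS_hat \<chi>)" for x y \<gamma>
    using gS_act_iso [of \<gamma>] that by (simp add: lie_iso_def)
  show "gS_act \<chi> 0 x = x" if "x \<in> carrier (gS_hat \<chi>)" for x
  proof (rule hh.lin_maps_eqI [OF gS_act_lin lin_maps_id hat_gens_closed hat_span _ that])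
    show "gS_act \<chi> 0 x = x" if "x \<in> hat_gens" for x
      using that by (auto simp: hat_gens_def gS_act_k gS_act_d)
  qed
  show "gS_act \<chi> (\<gamma> + \<delta>) x = gS_act \<chi> \<gamma> (gS_act \<chi> \<delta> x)" if "x \<in> carrier (gS_hat \<chi>)" for \<gamma> \<delta> x
  proof (rule hh.lin_maps_eqI [OF gS_act_lin lin_maps_comp [OF gS_act_lin gS_act_lin]
        hat_gens_closed hat_span _ that])
    show "gS_act \<chi> (\<gamma> + \<delta>) x = gS_act \<chi> \<gamma> (gS_act \<chi> \<delta> x)" if "x \<in> hat_gens" for x
      using that by (auto simp: hat_gens_def gS_act_k gS_act_d lin_maps_smult [OF gS_act_lin]
          chi_add power_int_mult_distrib ac_simps)
  qed
  show "finite {\<gamma>. gS_act \<chi> \<gamma> x \<otimes>\<^bsub>gS_hat \<chi>\<^esub> y \<noteq> \<zero>\<^bsub>gS_hat \<chi>\<^esub>}"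
    if "x \<in> carrier (gS_hat \<chi>)" "y \<in> carrier (gS_hat \<chi>)" for x y
    using that by (rule gS_act_finite)
qed

end

section \<open>The covariant algebra and \<open>D\<^sub>S\<close>\<close>

context complex_module
begin

lemma finsum_smult_left:
  assumes "finite F" "x \<in> carrier V"
  shows "(\<Oplus>i\<in>F. f i \<odot> x) = (\<Sum>i\<in>F. f i) \<odot> x"
  using assms by (induction F) (simp_all add: smult_add_left Pi_def)

lemma collect_third:
  assumes "x \<in> carrier V" "y \<in> carrier V" "z \<in> carrier V"
  shows "(x \<oplus> p \<odot> z) \<oplus> (y \<oplus> q \<odot> z) \<oplus> r \<odot> z = x \<oplus> y \<oplus> (p + q + r) \<odot> z"
  using assms by (simp add: smult_add_left M.a_ac)

lemma collect_five:
  assumes "x \<in> carrier V" "y \<in> carrier V" "z \<in> carrier V"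
  shows "w \<odot> (p \<odot> x \<oplus> q \<odot> x \<oplus> r \<odot> y \<oplus> s \<odot> y \<oplus> c \<odot> z) =
    (w * p + w * q) \<odot> x \<oplus> (w * r + w * s) \<odot> y \<oplus> (w * c) \<odot> z"
proof -
  have "p \<odot> x \<oplus> q \<odot> x \<oplus> r \<odot> y \<oplus> s \<odot> y \<oplus> c \<odot> z = (p + q) \<odot> x \<oplus> (r + s) \<odot> y \<oplus> c \<odot> z"
    using assms by (simp add: smult_add_left M.a_assoc)
  then show ?thesis
    using assms by (simp add: smult_add_right distrib_left)
qed

end

lemma sum_of_bool_eq:
  "\<lbrakk>finite F; x \<in> F\<rbrakk> \<Longrightarrow> (\<Sum>g\<in>F. of_bool (g = x) * f g) = (f x :: complex)"
  by (simp add: sum.delta of_bool_def if_distrib [of "\<lambda>c. c * _"] cong: if_cong)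

context character
begin

text \<open>The coefficient of the central element in the zeroth mode of \<open>D_tilde\<close>,
  that is, in its coefficient of x^-1.\<close>

definition kappa :: "'s \<Rightarrow> complex" where
  "kappa \<alpha> = (if \<alpha> + \<alpha> \<noteq> 0 then 1 / (\<chi> \<alpha> - \<chi> (- \<alpha>)) else 0)"

lemma kappa_uminus: "kappa (- \<alpha>) = - kappa \<alpha>"
proof -
  have "- \<alpha> + - \<alpha> = 0 \<longleftrightarrow> \<alpha> + \<alpha> = 0"
    by (metis add.inverse_distrib_swap neg_equal_0_iff_equal)
  moreover have "1 / (\<chi> (- \<alpha>) - \<chi> \<alpha>) = - (1 / (\<chi> \<alpha> - \<chi> (- \<alpha>)))"
    by (metis minus_diff_eq minus_divide_right)
  ultimately show ?thesis
    by (simp add: kappa_def)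
qed

text \<open>The place where injectivity of \<chi> enters: the condition 2s = 0 of the form on
  \<open>gS\<close> and of \<open>kappa\<close> becomes the condition q = 1 or q = -1 that singles
  out the special cases of \<open>qint\<close>.\<close>

lemma chi_square_eq_1_iff: "\<chi> s * \<chi> s = 1 \<longleftrightarrow> s + s = 0"
  using chi_add [of s s] chi_inj by (metis chi_0 injD)

text \<open>
  The bracket of two modes of \<open>d\<^bsup>\<alpha>,0\<^esup>\<close> sees the central element only for \<open>2s = 0\<close>, the shift
  by \<open>kappa\<close> contributes only for \<open>2s \<noteq> 0\<close>; together they make up the \<open>q\<close>-integers.
\<close>

lemma qint_kappa:
  "(\<chi> s powi m - \<chi> s powi (- m)) * kappa s - qint (\<chi> s) m =
     - (of_int m * (\<chi> s powi (- m) * \<chi> s * of_bool (s + s = 0)))"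
proof (cases "s + s = 0")
  case True
  then have "\<chi> s * \<chi> s = 1" by (simp add: chi_square_eq_1_iff)
  then have "\<chi> s = 1 \<or> \<chi> s = - 1"
    by (metis square_eq_1_iff)
  then show ?thesis
    using True by (auto simp: kappa_def qint_def power_int_diff power_int_minus_left)
next
  case False
  then have "\<chi> s * \<chi> s \<noteq> 1" by (simp add: chi_square_eq_1_iff)
  then have "\<chi> s \<noteq> 1" "\<chi> s \<noteq> - 1" by auto
  then show ?thesis
    using False by (simp add: kappa_def qint_def chi_uminus)
qed

lemma DS_rels_presentation: "presentation (DS_rels \<chi>)"
proof
  show "DS_rels \<chi> \<subseteq> carrier free_alg \<times> carrier free_alg"
    unfolding DS_rels_def
    by (rule subsetI, elim UnE CollectE exE conjE; simp add: fgen_closed del: free_alg_sel)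
qed

sublocale DS: presentation "DS_rels \<chi>"
  rewrites "lie_present (DS_rels \<chi>) = DS \<chi>"
  by (rule DS_rels_presentation) (simp add: DS_def)

lemma DS_c_closed [simp]: "DS_c \<chi> \<in> carrier (DS \<chi>)"
  unfolding DS_c_def by (rule DS.pgen_closed)

lemma DS_D_closed [simp]: "DS_D \<chi> \<alpha> n \<in> carrier (DS \<chi>)"
  unfolding DS_D_def by (rule DS.pgen_closed)

lemma DS_c_mult: "DS_c \<chi> \<otimes>\<^bsub>DS \<chi>\<^esub> pgen (DS_rels \<chi>) x = \<zero>\<^bsub>DS \<chi>\<^esub>"
proof -
  have "(fgen C \<otimes>\<^bsub>free_alg\<^esub> fgen x, \<zero>\<^bsub>free_alg\<^esub>) \<in> DS_rels \<chi>"
    unfolding DS_rels_def by blast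
  from DS.cls_rel [OF this] show ?thesis
    by (simp add: DS_c_def DS.cls_simps del: free_alg_sel)
qed

lemma DS_D_uminus: "DS_D \<chi> (- \<alpha>) n = \<ominus>\<^bsub>DS \<chi>\<^esub> DS_D \<chi> \<alpha> n"
proof -
  have "(fgen (D (- \<alpha>) n), \<ominus>\<^bsub>free_alg\<^esub> fgen (D \<alpha> n)) \<in> DS_rels \<chi>"
    unfolding DS_rels_def by blast
  from DS.cls_rel [OF this] show ?thesis
    by (simp add: DS_D_def DS.cls_simps del: free_alg_sel)
qed

lemma DS_D_mult:
  "DS_D \<chi> \<alpha> n \<otimes>\<^bsub>DS \<chi>\<^esub> DS_D \<chi> \<beta> m =
     (\<chi> (m \<cdot> \<alpha> - n \<cdot> \<beta>) - \<chi> (n \<cdot> \<beta> - m \<cdot> \<alpha>)) \<odot>\<^bsub>DS \<chi>\<^esub> DS_D \<chi> (\<alpha> + \<beta>) (m + n)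
     \<ominus>\<^bsub>DS \<chi>\<^esub> (\<chi> (m \<cdot> \<alpha> + n \<cdot> \<beta>) - \<chi> (- (m \<cdot> \<alpha>) - n \<cdot> \<beta>)) \<odot>\<^bsub>DS \<chi>\<^esub> DS_D \<chi> (\<alpha> - \<beta>) (m + n)
     \<oplus>\<^bsub>DS \<chi>\<^esub> ((qint (\<chi> (\<alpha> + \<beta>)) m - qint (\<chi> (\<alpha> - \<beta>)) m) * of_bool (m + n = 0)) \<odot>\<^bsub>DS \<chi>\<^esub> DS_c \<chi>"
proof -
  have "(fgen (D \<alpha> n) \<otimes>\<^bsub>free_alg\<^esub> fgen (D \<beta> m),
       (\<chi> (m \<cdot> \<alpha> - n \<cdot> \<beta>) - \<chi> (n \<cdot> \<beta> - m \<cdot> \<alpha>)) \<odot>\<^bsub>free_alg\<^esub> fgen (D (\<alpha> + \<beta>) (m + n))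
       \<ominus>\<^bsub>free_alg\<^esub> (\<chi> (m \<cdot> \<alpha> + n \<cdot> \<beta>) - \<chi> (- (m \<cdot> \<alpha>) - n \<cdot> \<beta>)) \<odot>\<^bsub>free_alg\<^esub> fgen (D (\<alpha> - \<beta>) (m + n))
       \<oplus>\<^bsub>free_alg\<^esub> ((qint (\<chi> (\<alpha> + \<beta>)) m - qint (\<chi> (\<alpha> - \<beta>)) m) * of_bool (m + n = 0))
          \<odot>\<^bsub>free_alg\<^esub> fgen C) \<in> DS_rels \<chi>"
    unfolding DS_rels_def by blast
  from DS.cls_rel [OF this] show ?thesis
    by (simp add: DS_D_def DS_c_def DS.cls_simps del: free_alg_sel)
qed

lemma DS_span: "carrier (DS \<chi>) \<subseteq> lin_span (DS \<chi>) (range (pgen (DS_rels \<chi>)))"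
proof (rule DS.present_span)
  fix x y
  let ?M = "lin_span (DS \<chi>) (range (pgen (DS_rels \<chi>)))"
  have M: "submodule ?M complex_ring (DS \<chi>)"
    by (rule DS.P.submodule_lin_span) (use DS.pgen_closed in auto)
  have gen: "pgen (DS_rels \<chi>) z \<in> ?M" for z
    by (rule subsetD [OF DS.P.lin_span_superset]) simp
  show "pgen (DS_rels \<chi>) x \<otimes>\<^bsub>DS \<chi>\<^esub> pgen (DS_rels \<chi>) y \<in> ?M"
  proof (cases x)
    case C
    then show ?thesis
      using DS_c_mult [of y] DS.P.submodule_zero [OF M] by (simp add: DS_c_def)
  next
    case x: (D \<alpha> n)
    show ?thesis
    proof (cases y)
      case C
      then have "pgen (DS_rels \<chi>) x \<otimes>\<^bsub>DS \<chi>\<^esub> pgen (DS_rels \<chi>) y = \<zero>\<^bsub>DS \<chi>\<^esub>"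
        using DS.P.mult_antisym [OF DS.pgen_closed DS.pgen_closed, of x y] DS_c_mult [of x]
        by (simp add: DS_c_def DS.P.uminus_eq_smult)
      then show ?thesis
        using DS.P.submodule_zero [OF M] by simp
    next
      case y: (D \<beta> m)
      show ?thesis
        unfolding x y DS_D_def [symmetric] DS_D_mult
        unfolding DS_D_def DS_c_def
        by (intro DS.P.submodule_add [OF M] DS.P.submodule_minus [OF M] DS.P.submodule_smult [OF M] gen)
    qed
  qed
qed

section \<open>Brackets in the covariant algebra\<close>

abbreviation cov_quot where "cov_quot \<equiv> cov_alg (gS_hat \<chi>) (gS_act \<chi>)"

definition orbit :: "(int \<Rightarrow> (('s \<times> 's) magma \<Rightarrow> complex) set) \<times> complex \<Rightarrow>
    ((int \<Rightarrow> (('s \<times> 's) magma \<Rightarrow> complex) set) \<times> complex) set" where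
  "orbit x = cov_ideal (gS_hat \<chi>) (gS_act \<chi>) +>\<^bsub>gS_hat \<chi>\<^esub> x"

text \<open>Second index 0 suffices: up to a scalar, \<open>d_mode \<alpha> \<beta> n\<close> is the
  translate of \<open>d_mode \<alpha> 0 n\<close> by \<beta>.\<close>

definition u :: "'s \<Rightarrow> int \<Rightarrow> ((int \<Rightarrow> (('s \<times> 's) magma \<Rightarrow> complex) set) \<times> complex) set" where
  "u \<alpha> n = orbit (d_mode \<alpha> 0 n)"

definition kk :: "((int \<Rightarrow> (('s \<times> 's) magma \<Rightarrow> complex) set) \<times> complex) set" where
  "kk = orbit (aff_k gS)"

sublocale Q: lie_algebra cov_quot
  by (rule cov.cov_alg_lie)

sublocale hat_Q: complex_module_pair "gS_hat \<chi>" cov_quot ..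

lemma orbit_lin: "orbit \<in> lin_maps (gS_hat \<chi>) cov_quot"
  using cov.Q_lin by (simp add: orbit_def [abs_def])

lemmas orbit_closed = lin_maps_closed [OF orbit_lin]

lemma orbit_mult:
  "\<lbrakk>x \<in> carrier (gS_hat \<chi>); y \<in> carrier (gS_hat \<chi>)\<rbrakk> \<Longrightarrow>
    orbit x \<otimes>\<^bsub>cov_quot\<^esub> orbit y = orbit (cov_bracket (gS_hat \<chi>) (gS_act \<chi>) x y)"
  by (simp add: orbit_def cov.Q_mult)

lemma orbit_act: "x \<in> carrier (gS_hat \<chi>) \<Longrightarrow> orbit (gS_act \<chi> \<gamma> x) = orbit x"
  by (simp add: orbit_def cov.Q_act)

lemma cov_quot_carrier: "carrier cov_quot = orbit ` carrier (gS_hat \<chi>)"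
  by (auto simp: orbit_def cov.Q_carrier)

lemma u_closed [simp]: "u \<alpha> n \<in> carrier cov_quot"
  by (simp add: u_def orbit_closed)

lemma kk_closed [simp]: "kk \<in> carrier cov_quot"
  by (simp add: kk_def orbit_closed)

text \<open>The action of \<beta> multiplies by \<chi>(\<beta>)^n when it moves the second index
  from 0 to \<beta>; the quotient identifies an element with its translate, so the inverse scalar
  appears.\<close>

lemma orbit_d_mode: "orbit (d_mode \<alpha> \<beta> n) = (\<chi> \<beta> powi (- n)) \<odot>\<^bsub>cov_quot\<^esub> u \<alpha> n"
proof -
  have "u \<alpha> n = \<chi> \<beta> powi n \<odot>\<^bsub>cov_quot\<^esub> orbit (d_mode \<alpha> \<beta> n)"
    using orbit_act [of "d_mode \<alpha> 0 n" \<beta>] by (simp add: u_def gS_act_d lin_maps_smult [OF orbit_lin])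
  then have "\<chi> \<beta> powi (- n) \<odot>\<^bsub>cov_quot\<^esub> u \<alpha> n =
      (\<chi> \<beta> powi (- n) * \<chi> \<beta> powi n) \<odot>\<^bsub>cov_quot\<^esub> orbit (d_mode \<alpha> \<beta> n)"
    by (simp add: orbit_closed)
  also have "\<chi> \<beta> powi (- n) * \<chi> \<beta> powi n = 1"
    by (simp flip: power_int_add)
  finally show ?thesis
    by (simp add: orbit_closed)
qed

definition orbit_mode where "orbit_mode n x = orbit (aff_mode gS x n)"

lemma orbit_mode_lin: "orbit_mode n \<in> lin_maps gS cov_quot"
proof -
  have "orbit_mode n (x \<oplus>\<^bsub>gS\<^esub> y) = orbit_mode n x \<oplus>\<^bsub>cov_quot\<^esub> orbit_mode n y"
    if "x \<in> carrier gS" "y \<in> carrier gS" for x y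
    using that hat.single_add [of x y n 0 0]
    by (simp add: orbit_mode_def hat.aff_mode_single hat.single_closed flip: lin_maps_add [OF orbit_lin])
  moreover have "orbit_mode n (r \<odot>\<^bsub>gS\<^esub> x) = r \<odot>\<^bsub>cov_quot\<^esub> orbit_mode n x"
    if "x \<in> carrier gS" for r x
    using that hat.single_smult [of r x n 0]
    by (simp add: orbit_mode_def hat.aff_mode_single hat.single_closed flip: lin_maps_smult [OF orbit_lin])
  ultimately show ?thesis
    by (auto simp: lin_maps_def orbit_mode_def hat.aff_mode_single hat.single_closed orbit_closed)
qed

lemma orbit_mode_d: "orbit_mode n (gS_d \<alpha> \<beta>) = (\<chi> \<beta> powi (- n)) \<odot>\<^bsub>cov_quot\<^esub> u \<alpha> n"
  by (simp add: orbit_mode_def orbit_d_mode)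

lemma u_uminus: "u (- \<alpha>) n = (- 1) \<odot>\<^bsub>cov_quot\<^esub> u \<alpha> n"
proof -
  interpret complex_module_pair gS cov_quot ..
  show ?thesis
    using lin_maps_uminus [OF orbit_mode_lin [of n], of "gS_d \<alpha> 0"]
    by (simp add: orbit_mode_def Q.uminus_eq_smult flip: gS_d_uminus)
      (simp add: u_def Q.uminus_eq_smult orbit_closed)
qed

lemma kk_mult: "x \<in> carrier cov_quot \<Longrightarrow> kk \<otimes>\<^bsub>cov_quot\<^esub> x = \<zero>\<^bsub>cov_quot\<^esub>"
  by (auto simp: cov_quot_carrier kk_def orbit_mult cov_bracket_def gS_act_k aff_k_mult
      hat_Q.lin_maps_zero [OF orbit_lin])

lemma mult_kk: "x \<in> carrier cov_quot \<Longrightarrow> x \<otimes>\<^bsub>cov_quot\<^esub> kk = \<zero>\<^bsub>cov_quot\<^esub>"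
  using Q.mult_antisym [of x kk] by (simp add: kk_mult Q.uminus_eq_smult)

text \<open>One summand of the covariant bracket. The powers of \<chi>(\<alpha>) come from moving
  the second indices \<alpha> and -\<alpha> of the bracket back to 0. The values s, -s, t, -t of g
  may coincide, so the conditions are kept as indicators instead of a case distinction.\<close>

lemma orbit_product:
  fixes \<alpha> \<mu> :: 's and n m :: int
  defines "s \<equiv> \<alpha> + \<mu>" and "t \<equiv> \<alpha> - \<mu>" and "N \<equiv> m + n"
  shows "orbit (gS_act \<chi> g (d_mode \<alpha> 0 n) \<otimes>\<^bsub>gS_hat \<chi>\<^esub> d_mode \<mu> 0 m) =
    (of_bool (g = - s) * (\<chi> g powi n * \<chi> \<alpha> powi N)
      + of_bool (g = s) * - (\<chi> g powi n * \<chi> \<alpha> powi (- N))) \<odot>\<^bsub>cov_quot\<^esub> u s N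
    \<oplus>\<^bsub>cov_quot\<^esub> (of_bool (g = - t) * - (\<chi> g powi n * \<chi> \<alpha> powi N)
      + of_bool (g = t) * (\<chi> g powi n * \<chi> \<alpha> powi (- N))) \<odot>\<^bsub>cov_quot\<^esub> u t N
    \<oplus>\<^bsub>cov_quot\<^esub> (of_bool (g = s) * (\<chi> g powi n * (of_int n * of_bool (N = 0) * (\<chi> s * of_bool (s + s = 0))))
      + of_bool (g = t) * - (\<chi> g powi n * (of_int n * of_bool (N = 0) * (\<chi> t * of_bool (t + t = 0)))))
      \<odot>\<^bsub>cov_quot\<^esub> kk"
proof -
  interpret gQ: complex_module_pair gS cov_quot ..
  let ?d = "gS_d \<alpha> g \<otimes>\<^bsub>gS\<^esub> gS_d \<mu> 0"
  let ?c = "of_int n * of_bool (N = 0) * gS_form \<chi> (gS_d \<alpha> g) (gS_d \<mu> 0)"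
  have d: "?d \<in> carrier gS" by simp
  have N: "n + m = N" by (simp add: N_def)
  have "d_mode \<alpha> g n \<otimes>\<^bsub>gS_hat \<chi>\<^esub> d_mode \<mu> 0 m =
      aff_mode gS ?d N \<oplus>\<^bsub>gS_hat \<chi>\<^esub> ?c \<odot>\<^bsub>gS_hat \<chi>\<^esub> aff_k gS"
    unfolding hat.single_eq [OF d, symmetric] by (simp add: hat.aff_mode_single hat.single_mult N)
  then have "gS_act \<chi> g (d_mode \<alpha> 0 n) \<otimes>\<^bsub>gS_hat \<chi>\<^esub> d_mode \<mu> 0 m =
      \<chi> g powi n \<odot>\<^bsub>gS_hat \<chi>\<^esub> (aff_mode gS ?d N \<oplus>\<^bsub>gS_hat \<chi>\<^esub> ?c \<odot>\<^bsub>gS_hat \<chi>\<^esub> aff_k gS)"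
    by (simp add: gS_act_d hat_alg.mult_smult_left)
  then have orb: "orbit (gS_act \<chi> g (d_mode \<alpha> 0 n) \<otimes>\<^bsub>gS_hat \<chi>\<^esub> d_mode \<mu> 0 m) =
      \<chi> g powi n \<odot>\<^bsub>cov_quot\<^esub> (orbit_mode N ?d \<oplus>\<^bsub>cov_quot\<^esub> ?c \<odot>\<^bsub>cov_quot\<^esub> kk)"
    by (simp add: lin_maps_smult [OF orbit_lin] lin_maps_add [OF orbit_lin] orbit_mode_def kk_def
        hat.aff_mode_single hat.single_closed)
  have cond: "- \<alpha> + - \<mu> = g - 0 \<longleftrightarrow> g = - s" "\<alpha> + \<mu> = g - 0 \<longleftrightarrow> g = s"
    "- \<alpha> + \<mu> = g - 0 \<longleftrightarrow> g = - t" "\<alpha> + - \<mu> = g - 0 \<longleftrightarrow> g = t"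
    by (auto simp: s_def t_def)
  have arg: "- \<alpha> + - \<mu> = - s" "\<alpha> + \<mu> = s" "- \<alpha> + \<mu> = - t" "\<alpha> + - \<mu> = t"
    by (auto simp: s_def t_def)
  have pow: "\<chi> (- \<alpha>) powi (- N) = \<chi> \<alpha> powi N"
    by (simp add: chi_uminus power_int_inverse power_int_minus)
  have "orbit_mode N ?d =
      (of_bool (g = - s) * \<chi> \<alpha> powi N) \<odot>\<^bsub>cov_quot\<^esub> u s N
      \<oplus>\<^bsub>cov_quot\<^esub> (of_bool (g = s) * - (\<chi> \<alpha> powi (- N))) \<odot>\<^bsub>cov_quot\<^esub> u s N
      \<oplus>\<^bsub>cov_quot\<^esub> (of_bool (g = - t) * - (\<chi> \<alpha> powi N)) \<odot>\<^bsub>cov_quot\<^esub> u t N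
      \<oplus>\<^bsub>cov_quot\<^esub> (of_bool (g = t) * (\<chi> \<alpha> powi (- N))) \<odot>\<^bsub>cov_quot\<^esub> u t N"
    unfolding gS_d_mult cond unfolding arg
    by (simp add: lin_maps_add [OF orbit_mode_lin] lin_maps_smult [OF orbit_mode_lin] orbit_mode_d
        u_uminus pow del: power_int_minus)
  moreover have "gS_form \<chi> (gS_d \<alpha> g) (gS_d \<mu> 0) =
      of_bool (g = s) * (\<chi> s * of_bool (s + s = 0)) - of_bool (g = t) * (\<chi> t * of_bool (t + t = 0))"
    unfolding gS_form_d by (auto simp: s_def [symmetric] t_def [symmetric])
  ultimately show ?thesis
    unfolding orb
    by (simp only: Q.collect_five u_closed kk_closed) (simp add: algebra_simps)
qed

lemma u_mult:
  "u \<alpha> n \<otimes>\<^bsub>cov_quot\<^esub> u \<mu> m =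
    (\<chi> (m \<cdot> \<alpha> - n \<cdot> \<mu>) - \<chi> (n \<cdot> \<mu> - m \<cdot> \<alpha>)) \<odot>\<^bsub>cov_quot\<^esub> u (\<alpha> + \<mu>) (m + n)
    \<oplus>\<^bsub>cov_quot\<^esub> (- (\<chi> (m \<cdot> \<alpha> + n \<cdot> \<mu>) - \<chi> (- (m \<cdot> \<alpha>) - n \<cdot> \<mu>))) \<odot>\<^bsub>cov_quot\<^esub> u (\<alpha> - \<mu>) (m + n)
    \<oplus>\<^bsub>cov_quot\<^esub> (of_int n * of_bool (m + n = 0) *
        (\<chi> (\<alpha> + \<mu>) powi n * \<chi> (\<alpha> + \<mu>) * of_bool ((\<alpha> + \<mu>) + (\<alpha> + \<mu>) = 0)
         - \<chi> (\<alpha> - \<mu>) powi n * \<chi> (\<alpha> - \<mu>) * of_bool ((\<alpha> - \<mu>) + (\<alpha> - \<mu>) = 0))) \<odot>\<^bsub>cov_quot\<^esub> kk"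
proof -
  let ?x = "d_mode \<alpha> 0 n" and ?y = "d_mode \<mu> 0 m"
  define s t N where "s = \<alpha> + \<mu>" and "t = \<alpha> - \<mu>" and "N = m + n"
  \<comment> \<open>The four special values are added to the support, so that every indicator sum
    picks up its value, even where the summand as a whole happens to vanish.\<close>
  define F where "F = {g. gS_act \<chi> g ?x \<otimes>\<^bsub>gS_hat \<chi>\<^esub> ?y \<noteq> \<zero>\<^bsub>gS_hat \<chi>\<^esub>} \<union> {s, - s, t, - t}"
  have F: "finite F" "s \<in> F" "- s \<in> F" "t \<in> F" "- t \<in> F"
    using gS_act_finite [of ?x ?y] by (auto simp: F_def)
  let ?a = "\<lambda>g. of_bool (g = - s) * (\<chi> g powi n * \<chi> \<alpha> powi N)
      + of_bool (g = s) * - (\<chi> g powi n * \<chi> \<alpha> powi (- N))"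
  let ?b = "\<lambda>g. of_bool (g = - t) * - (\<chi> g powi n * \<chi> \<alpha> powi N)
      + of_bool (g = t) * (\<chi> g powi n * \<chi> \<alpha> powi (- N))"
  let ?c = "\<lambda>g. of_bool (g = s) * (\<chi> g powi n * (of_int n * of_bool (N = 0) * (\<chi> s * of_bool (s + s = 0))))
      + of_bool (g = t) * - (\<chi> g powi n * (of_int n * of_bool (N = 0) * (\<chi> t * of_bool (t + t = 0))))"
  have "u \<alpha> n \<otimes>\<^bsub>cov_quot\<^esub> u \<mu> m = orbit (cov_bracket (gS_hat \<chi>) (gS_act \<chi>) ?x ?y)"
    by (simp add: u_def orbit_mult)
  also have "cov_bracket (gS_hat \<chi>) (gS_act \<chi>) ?x ?y =
      (\<Oplus>\<^bsub>gS_hat \<chi>\<^esub>g\<in>F. gS_act \<chi> g ?x \<otimes>\<^bsub>gS_hat \<chi>\<^esub> ?y)"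
    using F(1) by (intro cov.cov_superset) (auto simp: F_def)
  also have "orbit \<dots> = (\<Oplus>\<^bsub>cov_quot\<^esub>g\<in>F. orbit (gS_act \<chi> g ?x \<otimes>\<^bsub>gS_hat \<chi>\<^esub> ?y))"
    by (intro hat_Q.lin_maps_finsum [OF orbit_lin]) simp
  also have "\<dots> = (\<Oplus>\<^bsub>cov_quot\<^esub>g\<in>F. ?a g \<odot>\<^bsub>cov_quot\<^esub> u s N \<oplus>\<^bsub>cov_quot\<^esub> ?b g \<odot>\<^bsub>cov_quot\<^esub> u t N
      \<oplus>\<^bsub>cov_quot\<^esub> ?c g \<odot>\<^bsub>cov_quot\<^esub> kk)"
    unfolding orbit_product s_def t_def N_def ..
  also have "\<dots> = (\<Sum>g\<in>F. ?a g) \<odot>\<^bsub>cov_quot\<^esub> u s N \<oplus>\<^bsub>cov_quot\<^esub> (\<Sum>g\<in>F. ?b g) \<odot>\<^bsub>cov_quot\<^esub> u t N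
      \<oplus>\<^bsub>cov_quot\<^esub> (\<Sum>g\<in>F. ?c g) \<odot>\<^bsub>cov_quot\<^esub> kk"
    using F(1) by (simp only: Q.M.finsum_addf Q.finsum_smult_left Pi_I Q.smult_closed' Q.M.a_closed
        u_closed kk_closed)
  also have "(\<Sum>g\<in>F. ?a g) = \<chi> (- s) powi n * \<chi> \<alpha> powi N - \<chi> s powi n * \<chi> \<alpha> powi (- N)"
    unfolding sum.distrib sum_of_bool_eq [OF F(1,2)] sum_of_bool_eq [OF F(1,3)] by simp
  \<comment> \<open>With N = m + n, the exponent of \<chi>(\<alpha>) in the first product is N - n =
    m and that of \<chi>(\<mu>) is -n.\<close>
  also have "\<dots> = \<chi> (m \<cdot> \<alpha> - n \<cdot> \<mu>) - \<chi> (n \<cdot> \<mu> - m \<cdot> \<alpha>)"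
    by (simp add: s_def N_def chi_add chi_uminus chi_diff chi_zmult power_int_add
        power_int_mult_distrib power_int_inverse power_int_minus power_int_diff field_simps)
  also have "(\<Sum>g\<in>F. ?b g) = - (\<chi> (- t) powi n * \<chi> \<alpha> powi N - \<chi> t powi n * \<chi> \<alpha> powi (- N))"
    unfolding sum.distrib sum_of_bool_eq [OF F(1,4)] sum_of_bool_eq [OF F(1,5)] by simp
  also have "\<dots> = - (\<chi> (m \<cdot> \<alpha> + n \<cdot> \<mu>) - \<chi> (- (m \<cdot> \<alpha>) - n \<cdot> \<mu>))"
    by (simp add: t_def N_def chi_add chi_uminus chi_diff chi_zmult power_int_add
        power_int_mult_distrib power_int_divide_distrib power_int_inverse power_int_minus
        power_int_diff field_simps)
  also have "(\<Sum>g\<in>F. ?c g) = of_int n * of_bool (N = 0) *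
      (\<chi> s powi n * \<chi> s * of_bool (s + s = 0) - \<chi> t powi n * \<chi> t * of_bool (t + t = 0))"
    unfolding sum.distrib sum_of_bool_eq [OF F(1,2)] sum_of_bool_eq [OF F(1,4)]
    by (simp add: algebra_simps)
  finally show ?thesis
    unfolding s_def t_def N_def .
qed

text \<open>Obtained by inverting the prescription for \<pi>. The central element goes to
  -\<open>kk\<close> because \<open>DS_rels\<close> evaluates the q-integers at the mode of the
  second factor and the affine cocycle uses the mode of the first. The shift \<open>kappa\<close>
  enters with a plus sign since it is subtracted from the mode of \<open>D_tilde\<close> and then
  multiplied by the image of the central element.\<close>

definition DS_image :: "'s Dgen \<Rightarrow> ((int \<Rightarrow> (('s \<times> 's) magma \<Rightarrow> complex) set) \<times> complex) set" where
  "DS_image x = (case x of C \<Rightarrow> (- 1) \<odot>\<^bsub>cov_quot\<^esub> kk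
     | D \<alpha> n \<Rightarrow> u \<alpha> n \<oplus>\<^bsub>cov_quot\<^esub> (of_bool (n = 0) * kappa \<alpha>) \<odot>\<^bsub>cov_quot\<^esub> kk)"

lemma DS_image_closed: "DS_image x \<in> carrier cov_quot"
  by (cases x) (simp_all add: DS_image_def)

lemma DS_image_D_mult:
  "DS_image (D \<alpha> n) \<otimes>\<^bsub>cov_quot\<^esub> DS_image (D \<beta> m) =
     (\<chi> (m \<cdot> \<alpha> - n \<cdot> \<beta>) - \<chi> (n \<cdot> \<beta> - m \<cdot> \<alpha>)) \<odot>\<^bsub>cov_quot\<^esub> DS_image (D (\<alpha> + \<beta>) (m + n))
     \<ominus>\<^bsub>cov_quot\<^esub> (\<chi> (m \<cdot> \<alpha> + n \<cdot> \<beta>) - \<chi> (- (m \<cdot> \<alpha>) - n \<cdot> \<beta>)) \<odot>\<^bsub>cov_quot\<^esub> DS_image (D (\<alpha> - \<beta>) (m + n))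
     \<oplus>\<^bsub>cov_quot\<^esub> ((qint (\<chi> (\<alpha> + \<beta>)) m - qint (\<chi> (\<alpha> - \<beta>)) m) * of_bool (m + n = 0))
        \<odot>\<^bsub>cov_quot\<^esub> DS_image C"
proof -
  define s t N where "s = \<alpha> + \<beta>" and "t = \<alpha> - \<beta>" and "N = m + n"
  define a where "a = \<chi> (m \<cdot> \<alpha> - n \<cdot> \<beta>) - \<chi> (n \<cdot> \<beta> - m \<cdot> \<alpha>)"
  define b where "b = \<chi> (m \<cdot> \<alpha> + n \<cdot> \<beta>) - \<chi> (- (m \<cdot> \<alpha>) - n \<cdot> \<beta>)"
  let ?e = "of_bool (N = 0) :: complex"
  let ?c = "\<lambda>s. \<chi> s powi n * \<chi> s * of_bool (s + s = 0)"
  \<comment> \<open>The comparison of the coefficients of \<open>kk\<close>, the only point where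
    the relation is not already contained in \<open>u_mult\<close>. It splits into a part for s and
    a part for t, each an instance of \<open>qint_kappa\<close>.\<close>
  have coeff: "of_int n * ?e * (?c s - ?c t) =
      a * (?e * kappa s) + - b * (?e * kappa t) + (qint (\<chi> s) m - qint (\<chi> t) m) * ?e * - 1"
  proof (cases "N = 0")
    case True
    then have n: "n = - m" by (simp add: N_def)
    \<comment> \<open>For n = -m the arguments m\<alpha> - n\<beta> and m\<alpha> + n\<beta> are ms
      and mt.\<close>
    have "a = \<chi> s powi m - \<chi> s powi (- m)" "b = \<chi> t powi m - \<chi> t powi (- m)"
      by (simp_all add: a_def b_def s_def t_def n chi_add chi_diff chi_uminus chi_zmult
          power_int_mult_distrib power_int_divide_distrib power_int_minus field_simps)
    then have 1: "a * kappa s - qint (\<chi> s) m = - (of_int m * ?c s)"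
      and 2: "b * kappa t - qint (\<chi> t) m = - (of_int m * ?c t)"
      using qint_kappa [of s m] qint_kappa [of t m] by (simp_all only: n)
    have "of_int n * (?c s - ?c t) = a * kappa s - qint (\<chi> s) m - (b * kappa t - qint (\<chi> t) m)"
      unfolding 1 2 by (simp only: n of_int_minus right_diff_distrib mult_minus_left)
    then show ?thesis
      using True by (simp only: of_bool_eq simp_thms mult_1 mult_1_right) (simp add: algebra_simps)
  qed simp
  have "DS_image (D \<alpha> n) \<otimes>\<^bsub>cov_quot\<^esub> DS_image (D \<beta> m) = u \<alpha> n \<otimes>\<^bsub>cov_quot\<^esub> u \<beta> m"
    by (simp add: DS_image_def Q.mult_add_left Q.mult_add_right Q.mult_smult_left Q.mult_smult_right
        kk_mult mult_kk)
  also have "\<dots> = a \<odot>\<^bsub>cov_quot\<^esub> u s N \<oplus>\<^bsub>cov_quot\<^esub> (- b) \<odot>\<^bsub>cov_quot\<^esub> u t N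
      \<oplus>\<^bsub>cov_quot\<^esub> (of_int n * ?e * (?c s - ?c t)) \<odot>\<^bsub>cov_quot\<^esub> kk"
    unfolding u_mult a_def b_def s_def t_def N_def ..
  also have "\<dots> = (a \<odot>\<^bsub>cov_quot\<^esub> u s N \<oplus>\<^bsub>cov_quot\<^esub> (a * (?e * kappa s)) \<odot>\<^bsub>cov_quot\<^esub> kk)
      \<oplus>\<^bsub>cov_quot\<^esub> ((- b) \<odot>\<^bsub>cov_quot\<^esub> u t N \<oplus>\<^bsub>cov_quot\<^esub> (- b * (?e * kappa t)) \<odot>\<^bsub>cov_quot\<^esub> kk)
      \<oplus>\<^bsub>cov_quot\<^esub> ((qint (\<chi> s) m - qint (\<chi> t) m) * ?e * - 1) \<odot>\<^bsub>cov_quot\<^esub> kk"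
    unfolding coeff by (rule Q.collect_third [symmetric]) simp_all
  also have "\<dots> = a \<odot>\<^bsub>cov_quot\<^esub> DS_image (D s N) \<ominus>\<^bsub>cov_quot\<^esub> b \<odot>\<^bsub>cov_quot\<^esub> DS_image (D t N)
      \<oplus>\<^bsub>cov_quot\<^esub> ((qint (\<chi> s) m - qint (\<chi> t) m) * ?e) \<odot>\<^bsub>cov_quot\<^esub> DS_image C"
    by (simp add: DS_image_def Q.minus_eq_smult Q.smult_add_right del: of_bool_eq_0_iff)
  finally show ?thesis
    unfolding a_def b_def s_def t_def N_def .
qed

lemma DS_hom:
  obtains \<psi> where "\<psi> \<in> lin_maps (DS \<chi>) cov_quot"
    "\<And>x y. \<lbrakk>x \<in> carrier (DS \<chi>); y \<in> carrier (DS \<chi>)\<rbrakk> \<Longrightarrow>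
      \<psi> (x \<otimes>\<^bsub>DS \<chi>\<^esub> y) = \<psi> x \<otimes>\<^bsub>cov_quot\<^esub> \<psi> y"
    "\<And>x. \<psi> (pgen (DS_rels \<chi>) x) = DS_image x"
proof -
  interpret generator_map cov_quot DS_image
    by unfold_locales (rule DS_image_closed)
  have "free_eval cov_quot DS_image l = free_eval cov_quot DS_image r" if "(l, r) \<in> DS_rels \<chi>" for l r
    using that unfolding DS_rels_def
  proof (elim UnE CollectE exE conjE Pair_inject)
    fix x assume "l = fgen C \<otimes>\<^bsub>free_alg\<^esub> fgen x" "r = \<zero>\<^bsub>free_alg\<^esub>"
    then show ?thesis
      by (simp add: free_eval_simps DS_image_def [of C] Q.mult_smult_left kk_mult del: free_alg_sel)
  next
    fix \<alpha> n assume "l = fgen (D (- \<alpha>) n)" "r = \<ominus>\<^bsub>free_alg\<^esub> fgen (D \<alpha> n)"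
    then show ?thesis
      by (simp add: free_eval_simps Q.uminus_eq_smult del: free_alg_sel)
        (simp add: DS_image_def u_uminus kappa_uminus Q.smult_add_right)
  next
    fix \<alpha> \<beta> m n
    assume "l = fgen (D \<alpha> n) \<otimes>\<^bsub>free_alg\<^esub> fgen (D \<beta> m)"
      "r = (\<chi> (m \<cdot> \<alpha> - n \<cdot> \<beta>) - \<chi> (n \<cdot> \<beta> - m \<cdot> \<alpha>)) \<odot>\<^bsub>free_alg\<^esub> fgen (D (\<alpha> + \<beta>) (m + n))
       \<ominus>\<^bsub>free_alg\<^esub> (\<chi> (m \<cdot> \<alpha> + n \<cdot> \<beta>) - \<chi> (- (m \<cdot> \<alpha>) - n \<cdot> \<beta>)) \<odot>\<^bsub>free_alg\<^esub> fgen (D (\<alpha> - \<beta>) (m + n))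
       \<oplus>\<^bsub>free_alg\<^esub> ((qint (\<chi> (\<alpha> + \<beta>)) m - qint (\<chi> (\<alpha> - \<beta>)) m) * of_bool (m + n = 0))
          \<odot>\<^bsub>free_alg\<^esub> fgen C"
    then show ?thesis
      using DS_image_D_mult [of \<alpha> n \<beta> m] by (simp add: free_eval_simps del: free_alg_sel)
  qed
  then show ?thesis
    using DS.present_lift [OF Q.lie_algebra_axioms, of DS_image] DS_image_closed that by blast
qed

section \<open>The map \<pi> and its inverse\<close>

definition D_shifted :: "'s \<Rightarrow> int \<Rightarrow> ('s Dgen magma \<Rightarrow> complex) set" where
  "D_shifted \<alpha> n = DS_D \<chi> \<alpha> n \<oplus>\<^bsub>DS \<chi>\<^esub> (of_bool (n = 0) * kappa \<alpha>) \<odot>\<^bsub>DS \<chi>\<^esub> DS_c \<chi>"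

lemma D_shifted_closed [simp]: "D_shifted \<alpha> n \<in> carrier (DS \<chi>)"
  by (simp add: D_shifted_def)

text \<open>Mode n is the coefficient of x^(-n-1). Dilation contributes \<chi>(\<beta>)^(-n-1) and
  the prefactor of the field raises the exponent by one, which gives the same scalar as in
  \<open>orbit_d_mode\<close>.\<close>

lemma D_field_mode: "D_field \<chi> \<alpha> \<beta> (- n - 1) = \<chi> \<beta> powi (- n) \<odot>\<^bsub>DS \<chi>\<^esub> D_shifted \<alpha> n"
proof -
  have "D_tilde \<chi> \<alpha> (- n - 1) = D_shifted \<alpha> n"
    by (auto simp: D_tilde_def modes_def D_shifted_def kappa_def)
  moreover have "\<chi> \<beta> * \<chi> \<beta> powi (- n - 1) = \<chi> \<beta> powi (- n)"
    by (simp add: power_int_diff)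
  ultimately show ?thesis
    by (simp add: D_field_def dilate_def)
qed

lemma D_shifted_uminus: "D_shifted (- \<alpha>) n = \<ominus>\<^bsub>DS \<chi>\<^esub> D_shifted \<alpha> n"
  by (simp add: D_shifted_def DS_D_uminus kappa_uminus DS.P.uminus_eq_smult DS.P.smult_add_right)

abbreviation is_pi where
  "is_pi \<pi> \<equiv> \<pi> \<in> lin_maps (gS_hat \<chi>) (DS \<chi>) \<and> \<pi> (aff_k gS) = \<ominus>\<^bsub>DS \<chi>\<^esub> DS_c \<chi> \<and>
     (\<forall>\<alpha> \<beta> k. \<pi> (modes (d_mode \<alpha> \<beta>) k) = D_field \<chi> \<alpha> \<beta> k)"

lemma is_pi_exists: "\<exists>\<pi>. is_pi \<pi>"
proof -
  \<comment> \<open>One linear map on \<open>gS\<close> for each mode; \<open>gS_lin_lift\<close>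
    applies because \<open>D_shifted\<close> is odd in \<alpha>.\<close>
  have "\<exists>\<phi>. \<phi> \<in> lin_maps gS (DS \<chi>) \<and>
      (\<forall>\<alpha> \<beta>. \<phi> (gS_d \<alpha> \<beta>) = \<chi> \<beta> powi (- n) \<odot>\<^bsub>DS \<chi>\<^esub> D_shifted \<alpha> n)" for n
  proof (rule gS_lin_lift [OF DS.P.complex_module_axioms, of "\<lambda>\<alpha> \<beta>. \<chi> \<beta> powi (- n) \<odot>\<^bsub>DS \<chi>\<^esub> D_shifted \<alpha> n"])
    show "\<chi> \<beta> powi (- n) \<odot>\<^bsub>DS \<chi>\<^esub> D_shifted (- \<alpha>) n =
        \<ominus>\<^bsub>DS \<chi>\<^esub> (\<chi> \<beta> powi (- n) \<odot>\<^bsub>DS \<chi>\<^esub> D_shifted \<alpha> n)" for \<alpha> \<beta>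
      by (simp add: D_shifted_uminus DS.P.uminus_eq_smult)
  qed auto
  then obtain \<phi> where \<phi>: "\<And>n. \<phi> n \<in> lin_maps gS (DS \<chi>)"
    "\<And>n \<alpha> \<beta>. \<phi> n (gS_d \<alpha> \<beta>) = \<chi> \<beta> powi (- n) \<odot>\<^bsub>DS \<chi>\<^esub> D_shifted \<alpha> n"
    by metis
  interpret gD: complex_module_pair gS "DS \<chi>" ..
  define S where "S f = (\<Oplus>\<^bsub>DS \<chi>\<^esub>n\<in>{n. f n \<noteq> \<zero>\<^bsub>gS\<^esub>}. \<phi> n (f n))"
    for f :: "int \<Rightarrow> (('s \<times> 's) magma \<Rightarrow> complex) set"
  note \<phi>_closed = lin_maps_closed [OF \<phi>(1)]
  have S: "S f = (\<Oplus>\<^bsub>DS \<chi>\<^esub>n\<in>F. \<phi> n (f n))"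
    if "finite F" "{n. f n \<noteq> \<zero>\<^bsub>gS\<^esub>} \<subseteq> F" "\<And>n. f n \<in> carrier gS" for f F
    unfolding S_def using that gD.lin_maps_zero [OF \<phi>(1)] \<phi>_closed
    by (intro DS.P.M.add.finprod_mono_neutral_cong_left) auto
  have S_closed: "S f \<in> carrier (DS \<chi>)" if "\<And>n. f n \<in> carrier gS" for f
    unfolding S_def using that \<phi>_closed by (intro DS.P.M.finsum_closed) auto
  have S_add: "S (\<lambda>n. f n \<oplus>\<^bsub>gS\<^esub> g n) = S f \<oplus>\<^bsub>DS \<chi>\<^esub> S g"
    if fin: "finite {n. f n \<noteq> \<zero>\<^bsub>gS\<^esub>}" "finite {n. g n \<noteq> \<zero>\<^bsub>gS\<^esub>}"
      and c: "\<And>n. f n \<in> carrier gS" "\<And>n. g n \<in> carrier gS" for f g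
  proof -
    let ?F = "{n. f n \<noteq> \<zero>\<^bsub>gS\<^esub>} \<union> {n. g n \<noteq> \<zero>\<^bsub>gS\<^esub>}"
    have F: "finite ?F" using fin by simp
    have "S (\<lambda>n. f n \<oplus>\<^bsub>gS\<^esub> g n) = (\<Oplus>\<^bsub>DS \<chi>\<^esub>n\<in>?F. \<phi> n (f n \<oplus>\<^bsub>gS\<^esub> g n))"
      using c by (intro S [OF F]) auto
    also have "\<dots> = (\<Oplus>\<^bsub>DS \<chi>\<^esub>n\<in>?F. \<phi> n (f n) \<oplus>\<^bsub>DS \<chi>\<^esub> \<phi> n (g n))"
      using c by (simp only: lin_maps_add [OF \<phi>(1)])
    also have "\<dots> = (\<Oplus>\<^bsub>DS \<chi>\<^esub>n\<in>?F. \<phi> n (f n)) \<oplus>\<^bsub>DS \<chi>\<^esub> (\<Oplus>\<^bsub>DS \<chi>\<^esub>n\<in>?F. \<phi> n (g n))"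
      using c \<phi>_closed by (intro DS.P.M.finsum_addf) auto
    also have "(\<Oplus>\<^bsub>DS \<chi>\<^esub>n\<in>?F. \<phi> n (f n)) = S f"
      using c by (intro S [OF F, symmetric]) auto
    also have "(\<Oplus>\<^bsub>DS \<chi>\<^esub>n\<in>?F. \<phi> n (g n)) = S g"
      using c by (intro S [OF F, symmetric]) auto
    finally show ?thesis .
  qed
  have S_smult: "S (\<lambda>n. r \<odot>\<^bsub>gS\<^esub> f n) = r \<odot>\<^bsub>DS \<chi>\<^esub> S f"
    if F: "finite {n. f n \<noteq> \<zero>\<^bsub>gS\<^esub>}" and c: "\<And>n. f n \<in> carrier gS" for r f
  proof -
    have "S (\<lambda>n. r \<odot>\<^bsub>gS\<^esub> f n) = (\<Oplus>\<^bsub>DS \<chi>\<^esub>n\<in>{n. f n \<noteq> \<zero>\<^bsub>gS\<^esub>}. \<phi> n (r \<odot>\<^bsub>gS\<^esub> f n))"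
      using c by (intro S [OF F]) auto
    also have "\<dots> = (\<Oplus>\<^bsub>DS \<chi>\<^esub>n\<in>{n. f n \<noteq> \<zero>\<^bsub>gS\<^esub>}. r \<odot>\<^bsub>DS \<chi>\<^esub> \<phi> n (f n))"
      using c by (simp only: lin_maps_smult [OF \<phi>(1)])
    also have "\<dots> = r \<odot>\<^bsub>DS \<chi>\<^esub> S f"
      unfolding S_def using c \<phi>_closed F by (intro DS.P.finsum_smult [symmetric]) auto
    finally show ?thesis .
  qed
  \<comment> \<open>The modes are summed over the finite support; the sign on the central coordinate
    sends \<open>aff_k gS\<close> to minus \<open>DS_c\<close>.\<close>
  let ?\<pi> = "\<lambda>(f, z). S f \<oplus>\<^bsub>DS \<chi>\<^esub> (- z) \<odot>\<^bsub>DS \<chi>\<^esub> DS_c \<chi>"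
  have "?\<pi> \<in> lin_maps (gS_hat \<chi>) (DS \<chi>)"
  proof -
    have add: "?\<pi> (x \<oplus>\<^bsub>gS_hat \<chi>\<^esub> y) = ?\<pi> x \<oplus>\<^bsub>DS \<chi>\<^esub> ?\<pi> y"
      if xy: "x \<in> carrier (gS_hat \<chi>)" "y \<in> carrier (gS_hat \<chi>)" for x y
    proof -
      obtain f y' g z where fg: "x = (f, y')" "y = (g, z)" by (metis surj_pair)
      then have c: "finite {n. f n \<noteq> \<zero>\<^bsub>gS\<^esub>}" "finite {n. g n \<noteq> \<zero>\<^bsub>gS\<^esub>}"
          "\<And>n. f n \<in> carrier gS" "\<And>n. g n \<in> carrier gS"
        using xy by (auto simp: hat.affine_sel)
      have "?\<pi> (x \<oplus>\<^bsub>gS_hat \<chi>\<^esub> y) = S (\<lambda>n. f n \<oplus>\<^bsub>gS\<^esub> g n) \<oplus>\<^bsub>DS \<chi>\<^esub> (- (y' + z)) \<odot>\<^bsub>DS \<chi>\<^esub> DS_c \<chi>"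
        by (simp only: fg hat.affine_sel(3) split_conv)
      also have "S (\<lambda>n. f n \<oplus>\<^bsub>gS\<^esub> g n) = S f \<oplus>\<^bsub>DS \<chi>\<^esub> S g"
        by (rule S_add [OF c])
      also have "(- (y' + z)) \<odot>\<^bsub>DS \<chi>\<^esub> DS_c \<chi> =
          (- y') \<odot>\<^bsub>DS \<chi>\<^esub> DS_c \<chi> \<oplus>\<^bsub>DS \<chi>\<^esub> (- z) \<odot>\<^bsub>DS \<chi>\<^esub> DS_c \<chi>"
        by (simp flip: DS.P.smult_add_left)
      finally show ?thesis
        using S_closed [OF c(3)] S_closed [OF c(4)] by (simp add: fg DS.P.M.a_ac)
    qed
    have smult: "?\<pi> (r \<odot>\<^bsub>gS_hat \<chi>\<^esub> x) = r \<odot>\<^bsub>DS \<chi>\<^esub> ?\<pi> x" if x: "x \<in> carrier (gS_hat \<chi>)" for r x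
    proof -
      obtain f z where f: "x = (f, z)" by (metis surj_pair)
      show ?thesis
        using x by (simp add: f hat.affine_sel S_smult S_closed DS.P.smult_add_right)
    qed
    have closed: "?\<pi> x \<in> carrier (DS \<chi>)" if "x \<in> carrier (gS_hat \<chi>)" for x
      using that by (cases x) (simp add: hat.affine_sel S_closed)
    show ?thesis
      unfolding lin_maps_def by (intro CollectI conjI Pi_I ballI allI add smult closed)
  qed
  moreover have "?\<pi> (aff_k gS) = \<ominus>\<^bsub>DS \<chi>\<^esub> DS_c \<chi>"
    by (simp add: aff_k_def S_def DS.P.uminus_eq_smult)
  moreover have "?\<pi> (modes (d_mode \<alpha> \<beta>) k) = D_field \<chi> \<alpha> \<beta> k" for \<alpha> \<beta> k
  proof -
    let ?n = "- k - 1"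
    have "S (\<lambda>p. if p = ?n then gS_d \<alpha> \<beta> else \<zero>\<^bsub>gS\<^esub>) =
        (\<Oplus>\<^bsub>DS \<chi>\<^esub>n\<in>{?n}. \<phi> n (if n = ?n then gS_d \<alpha> \<beta> else \<zero>\<^bsub>gS\<^esub>))"
      by (intro S) auto
    also have "\<dots> = \<phi> ?n (gS_d \<alpha> \<beta>)"
      using \<phi>_closed by (subst DS.P.M.finsum_insert) auto
    also have "\<dots> = D_field \<chi> \<alpha> \<beta> k"
      using D_field_mode [of \<alpha> \<beta> ?n] by (simp add: \<phi>(2))
    finally show ?thesis
      using \<phi>(2) [of ?n \<alpha> \<beta>] D_field_mode [of \<alpha> \<beta> ?n] by (simp add: modes_def aff_mode_def)
  qed
  ultimately show ?thesis by blast
qed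

text \<open>Only the values on \<open>hat_gens\<close> matter, so every \<pi> with the prescribed
  ones can be treated. It descends to the quotient, where the homomorphism of \<open>DS_hom\<close>
  is its two-sided inverse.\<close>

lemma is_pi_iso:
  assumes "is_pi \<pi>"
  shows "\<exists>\<phi>\<in>lie_iso cov_quot (DS \<chi>). \<forall>a\<in>carrier (gS_hat \<chi>). \<phi> (orbit a) = \<pi> a"
proof -
  have \<pi>: "\<pi> \<in> lin_maps (gS_hat \<chi>) (DS \<chi>)" "\<pi> (aff_k gS) = \<ominus>\<^bsub>DS \<chi>\<^esub> DS_c \<chi>"
    using assms by auto
  have \<pi>_d: "\<pi> (d_mode \<alpha> \<beta> n) = \<chi> \<beta> powi (- n) \<odot>\<^bsub>DS \<chi>\<^esub> D_shifted \<alpha> n" for \<alpha> \<beta> n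
  proof -
    have "\<pi> (modes (d_mode \<alpha> \<beta>) (- n - 1)) = D_field \<chi> \<alpha> \<beta> (- n - 1)"
      using assms by blast
    then show ?thesis
      by (simp add: D_field_mode) (simp add: modes_def)
  qed
  interpret hD: complex_module_pair "gS_hat \<chi>" "DS \<chi>" ..
  interpret QD: complex_module_pair cov_quot "DS \<chi>" ..
  interpret DQ: complex_module_pair "DS \<chi>" cov_quot ..
  interpret QQ: complex_module_pair cov_quot cov_quot ..
  interpret DD: complex_module_pair "DS \<chi>" "DS \<chi>" ..
  \<comment> \<open>Invariance of \<pi> under S: the weight of the action on mode n cancels the
    change in the dilation factor.\<close>
  have cancel: "\<chi> \<gamma> powi n * \<chi> (\<beta> + \<gamma>) powi (- n) = \<chi> \<beta> powi (- n)" for \<beta> \<gamma> n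
    by (simp add: chi_add power_int_mult_distrib power_int_minus)
  have \<pi>_act: "\<pi> (gS_act \<chi> \<gamma> x) = \<pi> x" if "x \<in> carrier (gS_hat \<chi>)" for \<gamma> x
  proof (rule hD.lin_maps_eqI [OF lin_maps_comp [OF gS_act_lin \<pi>(1)] \<pi>(1) hat_gens_closed hat_span _ that])
    show "\<pi> (gS_act \<chi> \<gamma> x) = \<pi> x" if "x \<in> hat_gens" for x
      using that
      by (auto simp: hat_gens_def gS_act_k gS_act_d lin_maps_smult [OF \<pi>(1)] \<pi>_d cancel
          simp del: power_int_minus)
  qed
  have "\<pi> x = \<zero>\<^bsub>DS \<chi>\<^esub>" if "x \<in> cov_ideal (gS_hat \<chi>) (gS_act \<chi>)" for x
    using that
    by (induction rule: cov.cov_ideal_induct)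
      (simp_all add: hD.lin_maps_zero [OF \<pi>(1)] lin_maps_add [OF \<pi>(1)] lin_maps_smult [OF \<pi>(1)]
        hD.lin_maps_minus [OF \<pi>(1)] \<pi>_act DS.P.minus_eq_zero_iff lin_maps_closed [OF \<pi>(1)])
  then obtain \<phi> where \<phi>: "\<phi> \<in> lin_maps cov_quot (DS \<chi>)"
    "\<And>a. a \<in> carrier (gS_hat \<chi>) \<Longrightarrow> \<phi> (orbit a) = \<pi> a"
    using cov.Q_lift [OF DS.P.complex_module_axioms \<pi>(1)] unfolding orbit_def by blast
  obtain \<psi> where \<psi>: "\<psi> \<in> lin_maps (DS \<chi>) cov_quot"
    "\<And>x y. \<lbrakk>x \<in> carrier (DS \<chi>); y \<in> carrier (DS \<chi>)\<rbrakk> \<Longrightarrow>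
      \<psi> (x \<otimes>\<^bsub>DS \<chi>\<^esub> y) = \<psi> x \<otimes>\<^bsub>cov_quot\<^esub> \<psi> y"
    "\<And>x. \<psi> (pgen (DS_rels \<chi>) x) = DS_image x"
    using DS_hom by blast
  have \<phi>_k: "\<phi> kk = (- 1) \<odot>\<^bsub>DS \<chi>\<^esub> DS_c \<chi>"
    by (simp add: kk_def \<phi>(2) \<pi>(2) DS.P.uminus_eq_smult)
  have \<phi>_u: "\<phi> (u \<alpha> n) = D_shifted \<alpha> n" for \<alpha> n
    by (simp add: u_def \<phi>(2) \<pi>_d)
  have \<psi>_c: "\<psi> (DS_c \<chi>) = (- 1) \<odot>\<^bsub>cov_quot\<^esub> kk"
    by (simp add: DS_c_def \<psi>(3) DS_image_def)
  have \<psi>_D: "\<psi> (DS_D \<chi> \<alpha> n) = u \<alpha> n \<oplus>\<^bsub>cov_quot\<^esub> (of_bool (n = 0) * kappa \<alpha>) \<odot>\<^bsub>cov_quot\<^esub> kk" for \<alpha> n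
    by (simp add: DS_D_def \<psi>(3) DS_image_def)
  \<comment> \<open>The shift in \<open>D_shifted\<close> and the one in \<open>DS_image\<close>
    cancel because \<psi> changes the sign of the central element.\<close>
  have \<psi>_shifted: "\<psi> (D_shifted \<alpha> n) = u \<alpha> n" for \<alpha> n
    by (simp add: D_shifted_def lin_maps_add [OF \<psi>(1)] lin_maps_smult [OF \<psi>(1)] \<psi>_c \<psi>_D
        Q.M.a_assoc flip: Q.smult_add_left)
  have \<phi>\<psi>: "\<phi> (\<psi> x) = x" if "x \<in> carrier (DS \<chi>)" for x
  proof (rule DD.lin_maps_eqI [OF lin_maps_comp [OF \<psi>(1) \<phi>(1)] lin_maps_id _ DS_span _ that])
    show "range (pgen (DS_rels \<chi>)) \<subseteq> carrier (DS \<chi>)"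
      using DS.pgen_closed by auto
    fix x assume "x \<in> range (pgen (DS_rels \<chi>))"
    then obtain y where "x = pgen (DS_rels \<chi>) y" by auto
    then show "\<phi> (\<psi> x) = x"
      by (cases y) (simp_all add: \<psi>_c \<psi>_D \<phi>_k \<phi>_u lin_maps_add [OF \<phi>(1)] lin_maps_smult [OF \<phi>(1)]
          D_shifted_def DS.P.M.a_assoc flip: DS_c_def DS_D_def DS.P.smult_add_left)
  qed
  have \<psi>\<phi>: "\<psi> (\<phi> X) = X" if X: "X \<in> carrier cov_quot" for X
  proof -
    obtain x where x: "x \<in> carrier (gS_hat \<chi>)" "X = orbit x"
      using X by (auto simp: cov_quot_carrier)
    have "\<psi> (\<phi> (orbit x)) = orbit x"
    proof (rule hat_Q.lin_maps_eqI [OF lin_maps_comp [OF orbit_lin lin_maps_comp [OF \<phi>(1) \<psi>(1)]]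
          orbit_lin hat_gens_closed hat_span _ x(1)])
      fix x assume "x \<in> hat_gens"
      then show "\<psi> (\<phi> (orbit x)) = orbit x"
        by (auto simp: hat_gens_def orbit_d_mode \<phi>_k \<phi>_u \<psi>_c \<psi>_shifted lin_maps_smult [OF \<phi>(1)]
            lin_maps_smult [OF \<psi>(1)] simp flip: kk_def)
    qed
    then show ?thesis by (simp add: x)
  qed
  \<comment> \<open>No bracket of fields has to be computed in \<open>DS \<chi>\<close>: the inverse
    of a bijective homomorphism is a homomorphism.\<close>
  have mult: "\<phi> (X \<otimes>\<^bsub>cov_quot\<^esub> Y) = \<phi> X \<otimes>\<^bsub>DS \<chi>\<^esub> \<phi> Y"
    if "X \<in> carrier cov_quot" "Y \<in> carrier cov_quot" for X Y
  proof -
    have c: "\<phi> X \<in> carrier (DS \<chi>)" "\<phi> Y \<in> carrier (DS \<chi>)"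
      using that lin_maps_closed [OF \<phi>(1)] by auto
    then have "\<phi> X \<otimes>\<^bsub>DS \<chi>\<^esub> \<phi> Y = \<phi> (\<psi> (\<phi> X \<otimes>\<^bsub>DS \<chi>\<^esub> \<phi> Y))"
      by (simp add: \<phi>\<psi>)
    also have "\<dots> = \<phi> (X \<otimes>\<^bsub>cov_quot\<^esub> Y)"
      using that c by (simp add: \<psi>(2) \<psi>\<phi>)
    finally show ?thesis ..
  qed
  have "bij_betw \<phi> (carrier cov_quot) (carrier (DS \<chi>))"
    by (rule bij_betw_byWitness [where f' = \<psi>])
      (use \<phi>\<psi> \<psi>\<phi> lin_maps_closed [OF \<phi>(1)] lin_maps_closed [OF \<psi>(1)] in auto)
  then have "\<phi> \<in> lie_iso cov_quot (DS \<chi>)"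
    using \<phi>(1) mult Q.lie_algebra_axioms DS.present_lie by (simp add: lie_iso_def)
  then show ?thesis using \<phi>(2) by blast
qed

end

text \<open>The existence clause guards the universal one against being vacuous. The isomorphism is
  tied to \<pi> by its values on the cosets, so that it is the map induced by \<pi> and not just
  some isomorphism.\<close>

theorem theorem2p13:
  fixes \<chi> :: "'s::ab_group_add \<Rightarrow> complex"
  assumes "\<And>\<alpha>. \<chi> \<alpha> \<noteq> 0"
    and "\<And>\<alpha> \<beta>. \<chi> (\<alpha> + \<beta>) = \<chi> \<alpha> * \<chi> \<beta>"
    and "inj \<chi>"
  defines "is_pi \<equiv> \<lambda>\<pi>. \<pi> \<in> lin_maps (gS_hat \<chi>) (DS \<chi>) \<and>
      \<pi> (aff_k gS) = \<ominus>\<^bsub>DS \<chi>\<^esub> DS_c \<chi> \<and>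
      (\<forall>\<alpha> \<beta> k. \<pi> (modes (d_mode \<alpha> \<beta>) k) = D_field \<chi> \<alpha> \<beta> k)"
  shows "(\<exists>\<pi>. is_pi \<pi>) \<and>
    (\<forall>\<pi>. is_pi \<pi> \<longrightarrow>
      (\<exists>\<phi> \<in> lie_iso (cov_alg (gS_hat \<chi>) (gS_act \<chi>)) (DS \<chi>).
        \<forall>a \<in> carrier (gS_hat \<chi>).
          \<phi> (cov_ideal (gS_hat \<chi>) (gS_act \<chi>) +>\<^bsub>gS_hat \<chi>\<^esub> a) = \<pi> a))"
proof -
  interpret character \<chi>
    using assms(1-3) by unfold_locales
  show ?thesis
    unfolding is_pi_def using is_pi_exists is_pi_iso unfolding orbit_def by blast
qed

end
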